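(* Let $\Bbbk$ be a field of characteristic zero. Every pointed formal $\infty$-groupoid $\mathscr X_\bullet$ over $\Bbbk$ admits a PBW basis, i.e. there exists an isomorphism of almost simplicial coalgebras $$U^+_\bullet(\mathscr X)\xrightarrow{\ \cong\ }\mathrm{Sym}^{\mathrm{co},+}_\bullet(V),\qquad V_\bullet=U^+_\bullet\mathrm{Prim}(\mathscr X).$$
   Context: $\mathsf{CoCom}^{\mathrm{ft}}_{\mathrm{conil}}$ is the category of conilpotent counital cocommutative $\Bbbk$-coalgebras $C$ whose space of primitives $\mathrm{Prim}(C)$ is finite-dimensional. Linear duality $C\mapsto\Bbbk[C]=C^\vee$ is an anti-equivalence with the category of complete local Noetherian $\Bbbk$-algebras with residue field $\Bbbk$ and local morphisms. A morphism $C\to D$ is a formal submersion if $\Bbbk[D]\to\Bbbk[C]$ is formally smooth (for the adic topologies); $C$ is a pointed formal manifold if its counit $C\to\Bbbk$ is a formal submersion (equivalently $\Bbbk[C]$ is a formal power series ring in finitely many variables). For a simplicial object $X_\bullet$ and a horn $\Lambda^n_k$, $X^{\Lambda^n_k}=\hom(\Lambda^n_k,X_\bullet)$ denotes the matching object. A pointed formal $\infty$-groupoid is a simplicial object $\mathscr X_\bullet$ in pointed formal manifolds such that for all $n\ge1$, $0\le k\le n$ the matching object $\mathscr X^{\Lambda^n_k}$ exists in pointed formal manifolds and $\mathscr X_n\to\mathscr X^{\Lambda^n_k}$ is a formal submersion. Let $\Delta_+\subseteq\Delta$ be the wide subcategory of order-preserving maps fixing $0$. An almost simplicial object in a category $\mathsf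 C$ is a functor $\Delta_+^{\mathrm{op}}\to\mathsf C$ (i.e. a simplicial object without the face maps $d_0$); $U^+_\bullet$ is the restriction functor from simplicial to almost simplicial objects. $\mathrm{Prim}(\mathscr X)$ is the simplicial vector space of levelwise primitives, and $\mathrm{Sym}^{\mathrm{co},+}_\bullet(V)$ is the almost simplicial coalgebra obtained by applying levelwise the cofree conilpotent counital cocommutative coalgebra functor $\mathrm{Sym}^{\mathrm{co}}$ to an almost simplicial vector space $V_\bullet$. *)

theory Defs
  imports
    Complex_Main
    "HOL-Library.FuncSet"
    "HOL-Library.Multiset"
    "HOL-Library.Function_Algebras"
    "HOL-Algebra.QuotRing"
    "HOL-Algebra.Ideal_Product"
begin

text \<open>
  Conventions. A vector space over the field \<open>'k\<close> is a subspace \<open>V\<close> of an ambient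
  vector space \<open>'v\<close> with scalar multiplication \<open>s\<close>, so that families of vector spaces
  (one for each simplicial degree, say) can share a type. Maps are functions on the ambient
  type; only their values on the source subspace matter.
\<close>


section \<open>Duals and tensor products\<close>

definition linear_on ::
  "('k::field \<Rightarrow> 'v::ab_group_add \<Rightarrow> 'v) \<Rightarrow> ('k \<Rightarrow> 'w::ab_group_add \<Rightarrow> 'w) \<Rightarrow> 'v set \<Rightarrow> ('v \<Rightarrow> 'w) \<Rightarrow> bool"
  where "linear_on s t V f \<longleftrightarrow>
    (\<forall>x\<in>V. \<forall>y\<in>V. f (x + y) = f x + f y) \<and> (\<forall>a. \<forall>x\<in>V. f (s a x) = t a (f x))"

text \<open>Functions are extended by zero, so that equal functionals on \<open>V\<close> are equal as functions.\<close>

definition zero_ext :: "'v set \<Rightarrow> ('v \<Rightarrow> 'k::zero) \<Rightarrow> 'v \<Rightarrow> 'k"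
  where "zero_ext V f = (\<lambda>x. if x \<in> V then f x else 0)"

definition dual :: "('k::field \<Rightarrow> 'v::ab_group_add \<Rightarrow> 'v) \<Rightarrow> 'v set \<Rightarrow> ('v \<Rightarrow> 'k) set"
  where "dual s V = {\<phi>. linear_on s (*) V \<phi> \<and> (\<forall>x. x \<notin> V \<longrightarrow> \<phi> x = 0)}"

definition pullback :: "'v set \<Rightarrow> ('v \<Rightarrow> 'w) \<Rightarrow> ('w \<Rightarrow> 'k::zero) \<Rightarrow> 'v \<Rightarrow> 'k"
  where "pullback V f \<psi> = zero_ext V (\<lambda>x. \<psi> (f x))"

definition fscale :: "'k::field \<Rightarrow> ('i \<Rightarrow> 'k) \<Rightarrow> 'i \<Rightarrow> 'k"
  where "fscale a f = (\<lambda>i. a * f i)"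

text \<open>
  Over a field, the canonical map from \<open>V \<otimes> W\<close> to the bilinear forms on \<open>V\<^sup>* \<times> W\<^sup>*\<close>, sending
  \<open>v \<otimes> w\<close> to \<open>(\<phi>, \<psi>) \<mapsto> \<phi>(v) \<psi>(w)\<close>, is injective. The tensor product is taken to be
  its image; forms are extended by zero outside \<open>V\<^sup>* \<times> W\<^sup>*\<close>.
\<close>

type_synonym ('k, 'v, 'w) tens = "('v \<Rightarrow> 'k) \<times> ('w \<Rightarrow> 'k) \<Rightarrow> 'k"

definition pure_tensor ::
  "('k::field \<Rightarrow> 'v::ab_group_add \<Rightarrow> 'v) \<Rightarrow> 'v set \<Rightarrow> ('k \<Rightarrow> 'w::ab_group_add \<Rightarrow> 'w) \<Rightarrow> 'w set
    \<Rightarrow> 'v \<Rightarrow> 'w \<Rightarrow> ('k, 'v, 'w) tens"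
  where "pure_tensor s V t W v w = zero_ext (dual s V \<times> dual t W) (\<lambda>(\<phi>, \<psi>). \<phi> v * \<psi> w)"

definition tensor ::
  "('k::field \<Rightarrow> 'v::ab_group_add \<Rightarrow> 'v) \<Rightarrow> 'v set \<Rightarrow> ('k \<Rightarrow> 'w::ab_group_add \<Rightarrow> 'w) \<Rightarrow> 'w set
    \<Rightarrow> ('k, 'v, 'w) tens set"
  where "tensor s V t W = Modules.module.span fscale {pure_tensor s V t W v w | v w. v \<in> V \<and> w \<in> W}"

text \<open>The map \<open>f \<otimes> f : V \<otimes> V \<rightarrow> W \<otimes> W\<close> induced by \<open>f : V \<rightarrow> W\<close>; it sends
  \<open>v \<otimes> v'\<close> to \<open>f v \<otimes> f v'\<close>.\<close>

definition tensor_map ::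
  "'v set \<Rightarrow> ('k::field \<Rightarrow> 'w::ab_group_add \<Rightarrow> 'w) \<Rightarrow> 'w set \<Rightarrow> ('v \<Rightarrow> 'w)
    \<Rightarrow> ('k, 'v, 'v) tens \<Rightarrow> ('k, 'w, 'w) tens"
  where "tensor_map V t W f \<tau> =
    zero_ext (dual t W \<times> dual t W) (\<lambda>(\<phi>, \<psi>). \<tau> (pullback V f \<phi>, pullback V f \<psi>))"


section \<open>Conilpotent counital cocommutative coalgebras\<close>

text \<open>
  The coaugmentation is recorded by the image of \<open>1\<close>. In a conilpotent coalgebra this is the
  unique group-like element, and it is automatically preserved by coalgebra morphisms.
\<close>

record ('k, 'v) coalg =
  cspace :: "'v set"
  comult :: "'v \<Rightarrow> ('k, 'v, 'v) tens"
  counit :: "'v \<Rightarrow> 'k"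
  coaug  :: "'v"

definition conv :: "('k::field, 'v) coalg \<Rightarrow> ('v \<Rightarrow> 'k) \<Rightarrow> ('v \<Rightarrow> 'k) \<Rightarrow> 'v \<Rightarrow> 'k"
  where "conv C \<phi> \<psi> = zero_ext (cspace C) (\<lambda>c. comult C c (\<phi>, \<psi>))"

text \<open>
  The axioms are written in the above model of tensors: \<open>(\<Delta> \<otimes> id)\<tau>\<close>, as a trilinear form on
  the dual, has the value \<open>\<tau> (conv C \<phi> \<psi>, \<chi>)\<close> at \<open>(\<phi>, \<psi>, \<chi>)\<close>, and \<open>(\<epsilon> \<otimes> id)\<tau>\<close>, as
  a linear form on the dual, has the value \<open>\<tau> (\<epsilon>, \<phi>)\<close> at \<open>\<phi>\<close>.
\<close>

definition cocomm_coalgebra ::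
  "('k::field \<Rightarrow> 'v::ab_group_add \<Rightarrow> 'v) \<Rightarrow> ('k, 'v) coalg \<Rightarrow> bool"
  where "cocomm_coalgebra s C \<longleftrightarrow>
    vector_space s \<and> Modules.module.subspace s (cspace C) \<and>
    linear_on s fscale (cspace C) (comult C) \<and>
    comult C ` cspace C \<subseteq> tensor s (cspace C) s (cspace C) \<and>
    linear_on s (*) (cspace C) (counit C) \<and>
    \<comment> \<open>coassociativity: \<open>(\<Delta> \<otimes> id) \<circ> \<Delta> = (id \<otimes> \<Delta>) \<circ> \<Delta>\<close>\<close>
    (\<forall>c\<in>cspace C. \<forall>\<phi>\<in>dual s (cspace C). \<forall>\<psi>\<in>dual s (cspace C). \<forall>\<chi>\<in>dual s (cspace C).
       comult C c (conv C \<phi> \<psi>, \<chi>) = comult C c (\<phi>, conv C \<psi> \<chi>)) \<and>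
    \<comment> \<open>counit: \<open>(\<epsilon> \<otimes> id) \<circ> \<Delta> = id = (id \<otimes> \<epsilon>) \<circ> \<Delta>\<close>\<close>
    (\<forall>c\<in>cspace C. \<forall>\<phi>\<in>dual s (cspace C).
       comult C c (zero_ext (cspace C) (counit C), \<phi>) = \<phi> c \<and>
       comult C c (\<phi>, zero_ext (cspace C) (counit C)) = \<phi> c) \<and>
    \<comment> \<open>cocommutativity\<close>
    (\<forall>c\<in>cspace C. \<forall>\<phi>\<in>dual s (cspace C). \<forall>\<psi>\<in>dual s (cspace C).
       comult C c (\<phi>, \<psi>) = comult C c (\<psi>, \<phi>))"

definition coaugmented ::
  "('k::field \<Rightarrow> 'v::ab_group_add \<Rightarrow> 'v) \<Rightarrow> ('k, 'v) coalg \<Rightarrow> bool"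
  where "coaugmented s C \<longleftrightarrow>
    coaug C \<in> cspace C \<and> counit C (coaug C) = 1 \<and>
    comult C (coaug C) = pure_tensor s (cspace C) s (cspace C) (coaug C) (coaug C)"

text \<open>
  The reduced comultiplication \<open>x \<mapsto> \<Delta> x - x \<otimes> 1 - 1 \<otimes> x\<close> on \<open>ker \<epsilon>\<close>, extended to the whole
  coalgebra so as to vanish on the coaugmentation.
\<close>

definition red_comult ::
  "('k::field \<Rightarrow> 'v::ab_group_add \<Rightarrow> 'v) \<Rightarrow> ('k, 'v) coalg \<Rightarrow> 'v \<Rightarrow> ('k, 'v, 'v) tens"
  where "red_comult s C x =
    comult C x
    - pure_tensor s (cspace C) s (cspace C) x (coaug C)
    - pure_tensor s (cspace C) s (cspace C) (coaug C) x
    + fscale (counit C x) (pure_tensor s (cspace C) s (cspace C) (coaug C) (coaug C))"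

text \<open>
  The iterated reduced comultiplication, with values in the \<open>n\<close>-fold tensor power viewed as
  \<open>n\<close>-linear forms: the \<open>n\<close> arguments \<open>\<phi>\<^sub>1, \<dots>, \<phi>\<^sub>n\<close> form a list, and each step is
  \<open>(id \<otimes> iterate) \<circ> red_comult\<close>.
\<close>

fun iter_red_comult ::
  "('k::field \<Rightarrow> 'v::ab_group_add \<Rightarrow> 'v) \<Rightarrow> ('k, 'v) coalg \<Rightarrow> ('v \<Rightarrow> 'k) list \<Rightarrow> 'v \<Rightarrow> 'k"
  where
    "iter_red_comult s C [] x = counit C x"
  | "iter_red_comult s C [\<phi>] x = \<phi> x"
  | "iter_red_comult s C (\<phi> # \<psi> # \<phi>s) x =
       red_comult s C x (\<phi>, zero_ext (cspace C) (iter_red_comult s C (\<psi> # \<phi>s)))"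

definition conilpotent ::
  "('k::field \<Rightarrow> 'v::ab_group_add \<Rightarrow> 'v) \<Rightarrow> ('k, 'v) coalg \<Rightarrow> bool"
  where "conilpotent s C \<longleftrightarrow>
    (\<forall>x\<in>cspace C. counit C x = 0 \<longrightarrow>
      (\<exists>n\<ge>1. \<forall>\<phi>s. length \<phi>s = n \<and> set \<phi>s \<subseteq> dual s (cspace C) \<longrightarrow> iter_red_comult s C \<phi>s x = 0))"

definition prim :: "('k::field \<Rightarrow> 'v::ab_group_add \<Rightarrow> 'v) \<Rightarrow> ('k, 'v) coalg \<Rightarrow> 'v set"
  where "prim s C = {x \<in> cspace C.
    comult C x = pure_tensor s (cspace C) s (cspace C) x (coaug C)
               + pure_tensor s (cspace C) s (cspace C) (coaug C) x}"

definition CoCom_conil_ft :: "('k::field \<Rightarrow> 'v::ab_group_add \<Rightarrow> 'v) \<Rightarrow> ('k, 'v) coalg set"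
  where "CoCom_conil_ft s = {C.
    cocomm_coalgebra s C \<and> coaugmented s C \<and> conilpotent s C \<and>
    (\<exists>B. finite B \<and> Modules.module.span s B = prim s C)}"

definition coalg_hom ::
  "('k::field \<Rightarrow> 'v::ab_group_add \<Rightarrow> 'v) \<Rightarrow> ('k \<Rightarrow> 'w::ab_group_add \<Rightarrow> 'w)
    \<Rightarrow> ('k, 'v) coalg \<Rightarrow> ('k, 'w) coalg \<Rightarrow> ('v \<Rightarrow> 'w) set"
  where "coalg_hom s t C D = {f.
    f ` cspace C \<subseteq> cspace D \<and> linear_on s t (cspace C) f \<and>
    (\<forall>c\<in>cspace C. comult D (f c) = tensor_map (cspace C) t (cspace D) f (comult C c)) \<and>
    (\<forall>c\<in>cspace C. counit D (f c) = counit C c) \<and>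
    f (coaug C) = coaug D}"

definition coalg_iso ::
  "('k::field \<Rightarrow> 'v::ab_group_add \<Rightarrow> 'v) \<Rightarrow> ('k \<Rightarrow> 'w::ab_group_add \<Rightarrow> 'w)
    \<Rightarrow> ('k, 'v) coalg \<Rightarrow> ('k, 'w) coalg \<Rightarrow> ('v \<Rightarrow> 'w) set"
  where "coalg_iso s t C D = {f \<in> coalg_hom s t C D.
    \<exists>g\<in>coalg_hom t s D C. (\<forall>c\<in>cspace C. g (f c) = c) \<and> (\<forall>d\<in>cspace D. f (g d) = d)}"

definition ground_coalg :: "('k::field, 'k) coalg"
  where "ground_coalg =
    \<lparr> cspace = UNIV, comult = (\<lambda>a. pure_tensor (*) UNIV (*) UNIV a 1), counit = (\<lambda>a. a), coaug = 1 \<rparr>"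


section \<open>The dual algebra and formal submersions\<close>

text \<open>
  The ring underlying \<open>\<bbbk>[C]\<close>, and its maximal ideal: the kernel of the augmentation
  \<open>\<bbbk>[C] \<rightarrow> \<bbbk>\<close> dual to the coaugmentation.
\<close>

definition dual_ring ::
  "('k::field \<Rightarrow> 'v::ab_group_add \<Rightarrow> 'v) \<Rightarrow> ('k, 'v) coalg \<Rightarrow> ('v \<Rightarrow> 'k) ring"
  where "dual_ring s C =
    \<lparr> carrier = dual s (cspace C), mult = conv C, one = zero_ext (cspace C) (counit C),
      zero = (\<lambda>_. 0), add = (\<lambda>\<phi> \<psi> x. \<phi> x + \<psi> x) \<rparr>"

definition dual_max_ideal ::
  "('k::field \<Rightarrow> 'v::ab_group_add \<Rightarrow> 'v) \<Rightarrow> ('k, 'v) coalg \<Rightarrow> ('v \<Rightarrow> 'k) set"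
  where "dual_max_ideal s C = {\<phi> \<in> dual s (cspace C). \<phi> (coaug C) = 0}"

primrec ideal_power :: "'a ring \<Rightarrow> 'a set \<Rightarrow> nat \<Rightarrow> 'a set"
  where
    "ideal_power R I 0 = carrier R"
  | "ideal_power R I (Suc n) = ideal_prod R I (ideal_power R I n)"

text \<open>Continuity of a ring homomorphism from \<open>R\<close> with the \<open>I\<close>-adic topology to a discrete ring.\<close>

definition adic_cont :: "'a ring \<Rightarrow> 'a set \<Rightarrow> 'e ring \<Rightarrow> ('a \<Rightarrow> 'e) \<Rightarrow> bool"
  where "adic_cont R I E h \<longleftrightarrow> (\<exists>n. \<forall>x\<in>ideal_power R I n. h x = \<zero>\<^bsub>E\<^esub>)"

text \<open>
  Formal smoothness of a homomorphism \<open>f : B \<rightarrow> A\<close> for the \<open>I\<^sub>B\<close>-adic and \<open>I\<^sub>A\<close>-adic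
  topologies: for every discrete topological \<open>B\<close>-algebra \<open>E\<close> (with structure map \<open>e\<close>) and
  every nilpotent ideal \<open>N\<close> of \<open>E\<close>, each continuous \<open>B\<close>-algebra homomorphism
  \<open>u : A \<rightarrow> E/N\<close> lifts to a continuous \<open>B\<close>-algebra homomorphism \<open>v : A \<rightarrow> E\<close>.

  Restricting the elements of \<open>E\<close> to lists over \<open>'a + 'b\<close> loses nothing: an arbitrary \<open>E\<close> may
  be replaced by the subring generated by the image of \<open>B\<close> and a chosen lift of \<open>u a\<close> for each
  \<open>a\<close>, and the cardinality of this subring does not exceed that of this (infinite) type.
\<close>

definition formally_smooth ::
  "'b ring \<Rightarrow> 'b set \<Rightarrow> 'a ring \<Rightarrow> 'a set \<Rightarrow> ('b \<Rightarrow> 'a) \<Rightarrow> bool"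
  where "formally_smooth B IB A IA f \<longleftrightarrow>
    (\<forall>(E :: ('a + 'b) list ring) N e u.
       cring E \<and> ideal N E \<and> (\<exists>n. ideal_power E N n = {\<zero>\<^bsub>E\<^esub>}) \<and>
       e \<in> ring_hom B E \<and> adic_cont B IB E e \<and>
       u \<in> ring_hom A (E Quot N) \<and> adic_cont A IA (E Quot N) u \<and>
       (\<forall>b\<in>carrier B. u (f b) = N +>\<^bsub>E\<^esub> e b)
       \<longrightarrow> (\<exists>v. v \<in> ring_hom A E \<and> adic_cont A IA E v \<and>
              (\<forall>b\<in>carrier B. v (f b) = e b) \<and>
              (\<forall>a\<in>carrier A. u a = N +>\<^bsub>E\<^esub> v a)))"

definition formal_submersion ::
  "('k::field \<Rightarrow> 'v::ab_group_add \<Rightarrow> 'v) \<Rightarrow> ('k \<Rightarrow> 'w::ab_group_add \<Rightarrow> 'w)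
    \<Rightarrow> ('k, 'v) coalg \<Rightarrow> ('k, 'w) coalg \<Rightarrow> ('v \<Rightarrow> 'w) \<Rightarrow> bool"
  where "formal_submersion s t C D f \<longleftrightarrow>
    f \<in> coalg_hom s t C D \<and>
    formally_smooth (dual_ring t D) (dual_max_ideal t D) (dual_ring s C) (dual_max_ideal s C)
      (pullback (cspace C) f)"

definition pointed_formal_manifold ::
  "('k::field \<Rightarrow> 'v::ab_group_add \<Rightarrow> 'v) \<Rightarrow> ('k, 'v) coalg set"
  where "pointed_formal_manifold s =
    {C \<in> CoCom_conil_ft s. formal_submersion s (*) C ground_coalg (counit C)}"


section \<open>Simplicial and almost simplicial objects\<close>

text \<open>
  \<open>Delta m n\<close> is the set of order-preserving maps \<open>{0, \<dots>, m} \<rightarrow> {0, \<dots>, n}\<close>, that is, of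
  morphisms \<open>[m] \<rightarrow> [n]\<close> in the simplex category. A presheaf sends \<open>\<alpha> \<in> Delta m n\<close> to
  \<open>act X m n \<alpha> : ob X n \<rightarrow> ob X m\<close>.
\<close>

definition Delta :: "nat \<Rightarrow> nat \<Rightarrow> (nat \<Rightarrow> nat) set"
  where "Delta m n = {\<alpha> \<in> {..m} \<rightarrow>\<^sub>E {..n}. mono_on {..m} \<alpha>}"

definition Delta_plus :: "nat \<Rightarrow> nat \<Rightarrow> (nat \<Rightarrow> nat) set"
  where "Delta_plus m n = {\<alpha> \<in> Delta m n. \<alpha> 0 = 0}"

record ('o, 'v) presheaf =
  ob  :: "nat \<Rightarrow> 'o"
  act :: "nat \<Rightarrow> nat \<Rightarrow> (nat \<Rightarrow> nat) \<Rightarrow> 'v \<Rightarrow> 'v"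

definition simplicial_object_in ::
  "('k::field \<Rightarrow> 'v::ab_group_add \<Rightarrow> 'v) \<Rightarrow> ('k, 'v) coalg set \<Rightarrow> (('k, 'v) coalg, 'v) presheaf \<Rightarrow> bool"
  where "simplicial_object_in s \<C> X \<longleftrightarrow>
    (\<forall>n. ob X n \<in> \<C>) \<and>
    (\<forall>m n. \<forall>\<alpha>\<in>Delta m n. act X m n \<alpha> \<in> coalg_hom s s (ob X n) (ob X m)) \<and>
    (\<forall>n. \<forall>x\<in>cspace (ob X n). act X n n (\<lambda>i\<in>{..n}. i) x = x) \<and>
    (\<forall>l m n. \<forall>\<beta>\<in>Delta l m. \<forall>\<alpha>\<in>Delta m n. \<forall>x\<in>cspace (ob X n).
       act X l n (compose {..l} \<alpha> \<beta>) x = act X l m \<beta> (act X m n \<alpha> x))"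

text \<open>The restriction functor \<open>U\<^sup>+\<close>: same objects, action of \<open>Delta_plus\<close> only.\<close>

definition U_plus :: "('o, 'v) presheaf \<Rightarrow> ('o, 'v) presheaf"
  where "U_plus X =
    \<lparr> ob = ob X, act = (\<lambda>m n \<alpha>. if \<alpha> \<in> Delta_plus m n then act X m n \<alpha> else undefined) \<rparr>"

definition Prim ::
  "('k::field \<Rightarrow> 'v::ab_group_add \<Rightarrow> 'v) \<Rightarrow> (('k, 'v) coalg, 'v) presheaf \<Rightarrow> ('v set, 'v) presheaf"
  where "Prim s X = \<lparr> ob = (\<lambda>n. prim s (ob X n)), act = act X \<rparr>"

definition almost_simplicial_coalg_iso ::
  "('k::field \<Rightarrow> 'v::ab_group_add \<Rightarrow> 'v) \<Rightarrow> ('k \<Rightarrow> 'w::ab_group_add \<Rightarrow> 'w)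
    \<Rightarrow> (('k, 'v) coalg, 'v) presheaf \<Rightarrow> (('k, 'w) coalg, 'w) presheaf \<Rightarrow> (nat \<Rightarrow> 'v \<Rightarrow> 'w) \<Rightarrow> bool"
  where "almost_simplicial_coalg_iso s t X Y \<Phi> \<longleftrightarrow>
    (\<forall>n. \<Phi> n \<in> coalg_iso s t (ob X n) (ob Y n)) \<and>
    (\<forall>m n. \<forall>\<alpha>\<in>Delta_plus m n. \<forall>x\<in>cspace (ob X n).
       \<Phi> m (act X m n \<alpha> x) = act Y m n \<alpha> (\<Phi> n x))"


section \<open>Pointed formal infinity-groupoids\<close>

definition horn :: "nat \<Rightarrow> nat \<Rightarrow> nat \<Rightarrow> (nat \<Rightarrow> nat) set"
  where "horn n k m = {\<alpha> \<in> Delta m n. \<exists>i\<le>n. i \<noteq> k \<and> i \<notin> \<alpha> ` {..m}}"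

text \<open>
  A morphism of simplicial sets from the horn \<open>\<Lambda>\<^sup>n\<^sub>k\<close> to \<open>Hom(Y, X\<^sub>\<bullet>)\<close>: the family of
  morphisms \<open>q m \<alpha> : Y \<rightarrow> X\<^sub>m\<close> indexed by the simplices \<open>\<alpha>\<close> of the horn.
\<close>

definition horn_cone ::
  "('k::field \<Rightarrow> 'v::ab_group_add \<Rightarrow> 'v) \<Rightarrow> (('k, 'v) coalg, 'v) presheaf \<Rightarrow> nat \<Rightarrow> nat
    \<Rightarrow> ('k, 'v) coalg \<Rightarrow> (nat \<Rightarrow> (nat \<Rightarrow> nat) \<Rightarrow> 'v \<Rightarrow> 'v) \<Rightarrow> bool"
  where "horn_cone s X n k Y q \<longleftrightarrow>
    (\<forall>m. \<forall>\<alpha>\<in>horn n k m. q m \<alpha> \<in> coalg_hom s s Y (ob X m)) \<and>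
    (\<forall>l m. \<forall>\<beta>\<in>Delta l m. \<forall>\<alpha>\<in>horn n k m. \<forall>y\<in>cspace Y.
       q l (compose {..l} \<alpha> \<beta>) y = act X l m \<beta> (q m \<alpha> y))"

text \<open>
  \<open>M\<close> with the universal cone \<open>p\<close> represents \<open>Y \<mapsto> hom(\<Lambda>\<^sup>n\<^sub>k, Hom(Y, X\<^sub>\<bullet>))\<close> on pointed formal
  manifolds. Letting \<open>Y\<close> range over subspaces of the ambient space of \<open>X\<close> loses nothing: every
  object of \<open>CoCom_conil_ft\<close> has countable dimension, so it embeds in any ambient space of
  infinite dimension, and if all pointed formal manifolds in the ambient space are
  finite-dimensional, then in characteristic zero they are all trivial and so is \<open>X\<close>.
\<close>

definition is_matching_object ::
  "('k::field \<Rightarrow> 'v::ab_group_add \<Rightarrow> 'v) \<Rightarrow> (('k, 'v) coalg, 'v) presheaf \<Rightarrow> nat \<Rightarrow> nat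
    \<Rightarrow> ('k, 'v) coalg \<Rightarrow> (nat \<Rightarrow> (nat \<Rightarrow> nat) \<Rightarrow> 'v \<Rightarrow> 'v) \<Rightarrow> bool"
  where "is_matching_object s X n k M p \<longleftrightarrow>
    M \<in> pointed_formal_manifold s \<and> horn_cone s X n k M p \<and>
    (\<forall>Y q. Y \<in> pointed_formal_manifold s \<and> horn_cone s X n k Y q \<longrightarrow>
       (\<exists>h\<in>coalg_hom s s Y M.
          (\<forall>m. \<forall>\<alpha>\<in>horn n k m. \<forall>y\<in>cspace Y. p m \<alpha> (h y) = q m \<alpha> y) \<and>
          (\<forall>h'\<in>coalg_hom s s Y M.
             (\<forall>m. \<forall>\<alpha>\<in>horn n k m. \<forall>y\<in>cspace Y. p m \<alpha> (h' y) = q m \<alpha> y)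
             \<longrightarrow> (\<forall>y\<in>cspace Y. h' y = h y))))"

text \<open>The map \<open>h\<close> below is the canonical map from \<open>X\<^sub>n\<close> to the matching object, induced by
  the inclusion of the horn in the standard simplex.\<close>

definition pointed_formal_infty_groupoid ::
  "('k::field \<Rightarrow> 'v::ab_group_add \<Rightarrow> 'v) \<Rightarrow> (('k, 'v) coalg, 'v) presheaf \<Rightarrow> bool"
  where "pointed_formal_infty_groupoid s X \<longleftrightarrow>
    simplicial_object_in s (pointed_formal_manifold s) X \<and>
    (\<forall>n\<ge>1. \<forall>k\<le>n. \<exists>M p h.
       is_matching_object s X n k M p \<and>
       formal_submersion s s (ob X n) M h \<and>
       (\<forall>m. \<forall>\<alpha>\<in>horn n k m. \<forall>x\<in>cspace (ob X n). p m \<alpha> (h x) = act X m n \<alpha> x))"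


section \<open>The cofree conilpotent cocommutative coalgebra\<close>

text \<open>
  The tensor power \<open>V\<^sup>\<otimes>\<^sup>n\<close> is modelled by \<open>n\<close>-linear forms on \<open>V\<^sup>*\<close>, as above. The direct sum
  of all tensor powers then consists of functions on lists of functionals, the component of
  degree \<open>n\<close> being the restriction to lists of length \<open>n\<close>; \<open>word s V [v\<^sub>1, \<dots>, v\<^sub>n]\<close> is
  \<open>v\<^sub>1 \<otimes> \<dots> \<otimes> v\<^sub>n\<close>.
\<close>

definition word ::
  "('k::field \<Rightarrow> 'v::ab_group_add \<Rightarrow> 'v) \<Rightarrow> 'v set \<Rightarrow> 'v list \<Rightarrow> ('v \<Rightarrow> 'k) list \<Rightarrow> 'k"
  where "word s V vs = zero_ext {\<phi>s. length \<phi>s = length vs \<and> set \<phi>s \<subseteq> dual s V}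
    (\<lambda>\<phi>s. \<Prod>i<length vs. (\<phi>s ! i) (vs ! i))"

definition tensor_space ::
  "('k::field \<Rightarrow> 'v::ab_group_add \<Rightarrow> 'v) \<Rightarrow> 'v set \<Rightarrow> (('v \<Rightarrow> 'k) list \<Rightarrow> 'k) set"
  where "tensor_space s V = Modules.module.span fscale {word s V vs | vs. set vs \<subseteq> V}"

text \<open>The symmetric tensors, that is, the direct sum of the invariants of the symmetric groups.\<close>

definition sym_tensors ::
  "('k::field \<Rightarrow> 'v::ab_group_add \<Rightarrow> 'v) \<Rightarrow> 'v set \<Rightarrow> (('v \<Rightarrow> 'k) list \<Rightarrow> 'k) set"
  where "sym_tensors s V =
    {t \<in> tensor_space s V. \<forall>\<phi>s \<psi>s. mset \<phi>s = mset \<psi>s \<longrightarrow> t \<phi>s = t \<psi>s}"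

text \<open>
  Deconcatenation sends \<open>v\<^sub>1 \<dots> v\<^sub>n\<close> to the sum of the \<open>v\<^sub>1 \<dots> v\<^sub>i \<otimes> v\<^sub>i\<^sub>+\<^sub>1 \<dots> v\<^sub>n\<close>. In terms of forms,
  \<open>\<Delta> t\<close> pairs with evaluation at \<open>\<phi>s\<close> and evaluation at \<open>\<psi>s\<close> to \<open>t (\<phi>s @ \<psi>s)\<close>. As
  evaluations separate the elements of the tensor square of the symmetric tensors,
  this determines \<open>\<Delta> t\<close>.
\<close>

definition deconcat ::
  "('k::field \<Rightarrow> 'v::ab_group_add \<Rightarrow> 'v) \<Rightarrow> 'v set \<Rightarrow> (('v \<Rightarrow> 'k) list \<Rightarrow> 'k)
    \<Rightarrow> ('k, ('v \<Rightarrow> 'k) list \<Rightarrow> 'k, ('v \<Rightarrow> 'k) list \<Rightarrow> 'k) tens"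
  where "deconcat s V t = (THE \<tau>.
    \<tau> \<in> tensor fscale (sym_tensors s V) fscale (sym_tensors s V) \<and>
    (\<forall>\<phi>s \<psi>s. \<tau> (zero_ext (sym_tensors s V) (\<lambda>t'. t' \<phi>s), zero_ext (sym_tensors s V) (\<lambda>t'. t' \<psi>s))
              = t (\<phi>s @ \<psi>s)))"

definition Sym_co ::
  "('k::field \<Rightarrow> 'v::ab_group_add \<Rightarrow> 'v) \<Rightarrow> 'v set \<Rightarrow> ('k, ('v \<Rightarrow> 'k) list \<Rightarrow> 'k) coalg"
  where "Sym_co s V =
    \<lparr> cspace = sym_tensors s V, comult = deconcat s V, counit = (\<lambda>t. t []), coaug = word s V [] \<rparr>"

text \<open>The action of \<open>Sym_co\<close> on \<open>f : V \<rightarrow> W\<close>, which sends \<open>v\<^sub>1 \<dots> v\<^sub>n\<close> to \<open>f v\<^sub>1 \<dots> f v\<^sub>n\<close>.\<close>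

definition Sym_co_map ::
  "'v set \<Rightarrow> ('k::field \<Rightarrow> 'w::ab_group_add \<Rightarrow> 'w) \<Rightarrow> 'w set \<Rightarrow> ('v \<Rightarrow> 'w)
    \<Rightarrow> (('v \<Rightarrow> 'k) list \<Rightarrow> 'k) \<Rightarrow> ('w \<Rightarrow> 'k) list \<Rightarrow> 'k"
  where "Sym_co_map V t W f \<tau> =
    zero_ext {\<psi>s. set \<psi>s \<subseteq> dual t W} (\<lambda>\<psi>s. \<tau> (map (pullback V f) \<psi>s))"

definition Sym_co_plus ::
  "('k::field \<Rightarrow> 'v::ab_group_add \<Rightarrow> 'v) \<Rightarrow> ('v set, 'v) presheaf
    \<Rightarrow> (('k, ('v \<Rightarrow> 'k) list \<Rightarrow> 'k) coalg, ('v \<Rightarrow> 'k) list \<Rightarrow> 'k) presheaf"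
  where "Sym_co_plus s V =
    \<lparr> ob = (\<lambda>n. Sym_co s (ob V n)),
      act = (\<lambda>m n \<alpha>. Sym_co_map (ob V n) s (ob V m) (act V m n \<alpha>)) \<rparr>"

end

theory Submission
  imports Defs "HOL-Computational_Algebra.Formal_Power_Series" "HOL-Combinatorics.Permutations"
begin

text \<open>
  A pointed formal manifold \<open>C\<close> with a linear retraction \<open>R\<close> onto its primitives \<open>P\<close> maps to \<open>Sym\<^sup>c\<^sup>o(P)\<close> by
  \<open>c \<mapsto> (\<phi>\<^sub>1, \<dots>, \<phi>\<^sub>n) \<mapsto> (R\<^sup>*\<phi>\<^sub>1 \<cdots> R\<^sup>*\<phi>\<^sub>n)(c)\<close>, the product being taken in the dual algebra. Conilpotency
  makes this map injective. For surjectivity, formal smoothness lifts each tangent vector \<open>x \<in> P\<close>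
  to a curve \<open>\<bbbk>[C] \<rightarrow> \<bbbk>[t]/(t\<^sup>n\<^sup>+\<^sup>1)\<close>, whose top coefficient is evaluation at an element of \<open>C\<close> with
  leading term \<open>x \<otimes> \<dots> \<otimes> x\<close>; in characteristic zero such powers span the symmetric tensors.

  It remains to choose the retractions compatibly with \<open>\<Delta>\<^sub>+\<close>. Since \<open>d\<^sub>0\<close> is absent, the
  Dold-Kan decomposition splits every inclusion of almost simplicial vector spaces. Concretely, for
  \<open>S \<subseteq> {1..n}\<close> let \<open>a\<^sub>S(j) = j - 1\<close> for \<open>j \<in> S\<close> and \<open>a\<^sub>S(j) = j\<close> otherwise. The alternating sum of
  all \<open>a\<^sub>S\<close> is annihilated by the non-surjective maps of \<open>\<Delta>\<^sub>+\<close> on one side and by the non-injective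
  ones on the other, as toggling one element of \<open>S\<close> cancels the terms in pairs.
\<close>

section \<open>Linear algebra\<close>

text \<open>\<open>C\<close> is not given as the space of continuous functionals on its dual
  algebra, so a coefficient of a curve is not visibly evaluation at an element.
  \<open>form_in_image\<close> replaces reflexivity by separation: a functional on forms that kills
  the image of \<open>Phi\<close> is read as an element of the dual algebra; it must lie in a high
  power of the maximal ideal, where the continuous coefficient vanishes. Finite-dimensional
  primitives enter here, as they leave finitely many monomials in each degree. The retractions must
  also kill the coaugmentation: this puts the coordinates they induce in the maximal ideal, where
  conilpotency bounds the degree of \<open>Phi c\<close>. Naturality is obtained by recursion on the
  degree. A vector is its normalized part plus signed terms \<open>a_S x\<close> with S nonempty,
  and these pass through the preceding degree. The absence of \<open>d_0\<close> matters because a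
  non-surjective map fixing 0 misses some i >= 1, at which S can be toggled, whereas the coface
  behind \<open>d_0\<close> misses only 0.\<close>

lemma vector_space_fscale: "vector_space (fscale :: 'k::field \<Rightarrow> ('i \<Rightarrow> 'k) \<Rightarrow> 'i \<Rightarrow> 'k)"
  by standard (auto simp: fscale_def fun_eq_iff algebra_simps)

lemma fscale_apply: "fscale a f i = a * f i"
  by (simp add: fscale_def)

lemma sum_apply: "(\<Sum>i\<in>I. F i) x = (\<Sum>i\<in>I. F i x)"
  by (induction I rule: infinite_finite_induct) auto

lemma vector_space_times: "vector_space ((*) :: 'k::field \<Rightarrow> 'k \<Rightarrow> 'k)"
  by standard (auto simp: algebra_simps)

lemma vector_space_pointwise:
  assumes "vector_space s"
  shows "vector_space (\<lambda>a (f :: 'i \<Rightarrow> 'v::ab_group_add) i. s (a::'k::field) (f i))"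
proof -
  interpret vector_space s by fact
  show ?thesis by standard (auto simp: fun_eq_iff scale_right_distrib scale_left_distrib)
qed

lemma linear_on_sum:
  assumes "vector_space s" "vector_space t" "Modules.module.subspace s V" "linear_on s t V f"
    and "\<And>i. i \<in> I \<Longrightarrow> x i \<in> V"
  shows "f (\<Sum>i\<in>I. x i) = (\<Sum>i\<in>I. f (x i))"
proof -
  interpret s: vector_space s by fact
  interpret t: vector_space t by fact
  have "f (s 0 0) = t 0 (f 0)"
    using assms(4) s.subspace_0[OF assms(3)] unfolding linear_on_def by blast
  then have z: "f 0 = 0" by simp
  show ?thesis using assms(5)
  proof (induction I rule: infinite_finite_induct)
    case (insert i I)
    then have "(\<Sum>i\<in>I. x i) \<in> V" by (auto intro: s.subspace_sum[OF assms(3)])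
    with insert assms(4) show ?case by (auto simp: linear_on_def)
  qed (auto simp: z)
qed

lemma linear_on_zero:
  assumes "vector_space s" "vector_space t" "Modules.module.subspace s V" "linear_on s t V f"
  shows "f 0 = 0"
  using linear_on_sum[OF assms, of "{}"] by simp

lemma linear_on_diff:
  assumes "vector_space s" "vector_space t" "linear_on s t V f" "Modules.module.subspace s V"
    "x \<in> V" "y \<in> V"
  shows "f (x - y) = f x - f y"
proof -
  interpret s: vector_space s by fact
  have "x - y \<in> V" using s.subspace_diff assms(4-6) by auto
  then have "f (x - y + y) = f (x - y) + f y" using assms(3,6) unfolding linear_on_def by blast
  then show ?thesis by (simp add: algebra_simps)
qed

lemma linear_on_extend:
  assumes "vector_space s" "vector_space t" "Modules.module.subspace s V" "linear_on s t V f"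
  obtains g where "Vector_Spaces.linear s t g" "\<And>x. x \<in> V \<Longrightarrow> g x = f x"
proof -
  interpret s: vector_space s by fact
  interpret t: vector_space t by fact
  interpret vector_space_pair s t ..
  obtain B where B: "B \<subseteq> V" "s.independent B" "V \<subseteq> s.span B"
    using s.maximal_independent_subset by blast
  define g where "g = construct B f"
  have lg: "Vector_Spaces.linear s t g" unfolding g_def by (rule linear_construct[OF B(2)])
  have "s.subspace {x \<in> V. g x = f x}"
    using assms(4) s.subspace_0[OF assms(3)] linear_on_zero[OF assms]
    by (auto simp: s.subspace_def linear_on_def linear_add[OF lg] linear_scale[OF lg] linear_0[OF lg]
        s.subspace_add[OF assms(3)] s.subspace_scale[OF assms(3)])
  then have "s.span B \<subseteq> {x \<in> V. g x = f x}"
    using B by (intro s.span_minimal) (auto simp: g_def construct_basis)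
  with B lg that show ?thesis by blast
qed

lemma dual_add: "\<phi> \<in> dual s V \<Longrightarrow> x \<in> V \<Longrightarrow> y \<in> V \<Longrightarrow> \<phi> (x + y) = \<phi> x + \<phi> y"
  and dual_scale: "\<phi> \<in> dual s V \<Longrightarrow> x \<in> V \<Longrightarrow> \<phi> (s a x) = a * \<phi> x"
  and dual_outside: "\<phi> \<in> dual s V \<Longrightarrow> x \<notin> V \<Longrightarrow> \<phi> x = 0"
  by (auto simp: dual_def linear_on_def)

lemma dual_linear_on: "\<phi> \<in> dual s V \<Longrightarrow> linear_on s (*) V \<phi>"
  by (simp add: dual_def)

lemma zero_ext_in_dual:
  assumes "vector_space s" "Modules.module.subspace s V" "linear_on s (*) V f"
  shows "zero_ext V f \<in> dual s V"
proof -
  interpret s: vector_space s by fact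
  show ?thesis using assms(3) s.subspace_add[OF assms(2)] s.subspace_scale[OF assms(2)]
    by (auto simp: dual_def zero_ext_def linear_on_def)
qed

lemma linear_zero_ext_in_dual:
  assumes "Vector_Spaces.linear s (*) g" "Modules.module.subspace s V"
  shows "zero_ext V g \<in> dual s V"
  using assms by (intro zero_ext_in_dual) (auto simp: Vector_Spaces.linear_iff linear_on_def)

lemma pullback_in_dual:
  assumes "vector_space s" "Modules.module.subspace s V" "linear_on s t V f" "f ` V \<subseteq> W" "\<psi> \<in> dual t W"
  shows "pullback V f \<psi> \<in> dual s V"
  unfolding pullback_def using assms
  by (intro zero_ext_in_dual) (auto simp: dual_def linear_on_def image_subset_iff)

lemma dual_eqI:
  assumes "\<phi> \<in> dual s V" "\<psi> \<in> dual s V" "\<And>x. x \<in> V \<Longrightarrow> \<phi> x = \<psi> x"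
  shows "\<phi> = \<psi>"
  using assms by (intro ext) (auto simp: dual_def, metis)

lemma dual_plus: "\<phi> \<in> dual s V \<Longrightarrow> \<psi> \<in> dual s V \<Longrightarrow> \<phi> + \<psi> \<in> dual s V"
  and dual_fscale: "\<phi> \<in> dual s V \<Longrightarrow> fscale a \<phi> \<in> dual s V"
  and dual_zero: "0 \<in> dual s V"
  and dual_minus: "\<phi> \<in> dual s V \<Longrightarrow> \<psi> \<in> dual s V \<Longrightarrow> \<phi> - \<psi> \<in> dual s V"
  by (auto simp: dual_def linear_on_def fscale_def algebra_simps)

lemma dual_sum: "(\<And>i. i \<in> I \<Longrightarrow> f i \<in> dual s V) \<Longrightarrow> (\<Sum>i\<in>I. f i) \<in> dual s V"
  by (induction I rule: infinite_finite_induct) (auto intro: dual_zero dual_plus)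

lemma separating_functional:
  assumes "vector_space s" "Modules.module.subspace s D" "x \<notin> D"
  obtains l where "Vector_Spaces.linear s (*) l" "\<And>d. d \<in> D \<Longrightarrow> l d = 0" "l x = 1"
proof -
  interpret s: vector_space s by fact
  interpret k: vector_space "(*) :: 'a \<Rightarrow> 'a \<Rightarrow> 'a" by (rule vector_space_times)
  interpret vector_space_pair s "(*) :: 'a \<Rightarrow> 'a \<Rightarrow> 'a" ..
  obtain B where B: "B \<subseteq> D" "s.independent B" "D \<subseteq> s.span B"
    using s.maximal_independent_subset by blast
  have "s.span B \<subseteq> D" using B assms(2) by (simp add: s.span_minimal)
  with assms B have xB: "x \<notin> s.span B" by auto
  then have i: "s.independent (insert x B)" using B by (simp add: s.independent_insertI)
  then obtain l where l: "Vector_Spaces.linear s (*) l" "\<forall>y\<in>insert x B. l y = (if y = x then 1 else 0)"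
    using linear_independent_extend[OF i, of "\<lambda>y. if y = x then 1 else 0"] by blast
  have "x \<notin> B" using xB s.span_base by auto
  have "\<forall>y\<in>s.span B. l y = 0"
  proof (intro ballI, rule linear_eq_0_on_span[OF l(1), of B])
    fix y assume "y \<in> B"
    with \<open>x \<notin> B\<close> l(2) show "l y = 0" by auto
  qed
  with B(3) l show ?thesis by (intro that[of l]) auto
qed

lemma dual_separates:
  assumes "vector_space s" "Modules.module.subspace s V" "x \<in> V" "\<And>\<phi>. \<phi> \<in> dual s V \<Longrightarrow> \<phi> x = 0"
  shows "x = 0"
proof (rule ccontr)
  interpret s: vector_space s by fact
  assume "x \<noteq> 0"
  then obtain l where l: "Vector_Spaces.linear s (*) l" "l x = 1"
    using separating_functional[OF assms(1), of "{0}" x] s.subspace_single_0 by auto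
  then have "zero_ext V l \<in> dual s V" using assms by (intro linear_zero_ext_in_dual)
  with assms(4)[of "zero_ext V l"] assms(3) l show False by (auto simp: zero_ext_def)
qed

text \<open>Two preimages of a point differ by a kernel vector, so \<open>p\<close> descends to the
  image of \<delta>. Extending it to the whole target allows \<open>g\<close> to be evaluated off
  the image, as \<open>annihilator_expand\<close> requires.\<close>

lemma functional_factors:
  assumes "vector_space s" "vector_space t" "Modules.module.subspace s V" "linear_on s t V \<delta>"
    "linear_on s (*) V p" "\<And>x. x \<in> V \<Longrightarrow> \<delta> x = 0 \<Longrightarrow> p x = 0"
  obtains g where "Vector_Spaces.linear t (*) g" "\<And>x. x \<in> V \<Longrightarrow> p x = g (\<delta> x)"
proof -
  interpret s: vector_space s by fact
  interpret t: vector_space t by fact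
  define q where "q y = p (SOME x. x \<in> V \<and> \<delta> x = y)" for y
  have q: "q (\<delta> x) = p x" if "x \<in> V" for x
  proof -
    define x' where "x' = (SOME x'. x' \<in> V \<and> \<delta> x' = \<delta> x)"
    have x': "x' \<in> V \<and> \<delta> x' = \<delta> x" unfolding x'_def by (rule someI[of _ x]) (use that in auto)
    then have "p (x' - x) = 0"
      using that assms(6)[of "x' - x"] linear_on_diff[OF assms(1,2,4,3), of x' x]
        s.subspace_diff[OF assms(3)] by auto
    then show ?thesis
      using linear_on_diff[OF assms(1) vector_space_times[where 'k='a] assms(5,3), of x' x] x' that
      by (simp add: q_def x'_def[symmetric])
  qed
  have sub: "t.subspace (\<delta> ` V)"
    unfolding t.subspace_def
  proof (intro conjI ballI allI)
    show "0 \<in> \<delta> ` V" using linear_on_zero[OF assms(1-4)] s.subspace_0[OF assms(3)] by force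
  next
    fix x y assume "x \<in> \<delta> ` V" "y \<in> \<delta> ` V"
    then obtain a b where *: "a \<in> V" "b \<in> V" "x = \<delta> a" "y = \<delta> b" by auto
    then have "x + y = \<delta> (a + b)" using assms(4) by (auto simp: linear_on_def)
    then show "x + y \<in> \<delta> ` V" using * s.subspace_add[OF assms(3)] by blast
  next
    fix c x assume "x \<in> \<delta> ` V"
    then obtain a where *: "a \<in> V" "x = \<delta> a" by auto
    then have "t c x = \<delta> (s c a)" using assms(4) by (auto simp: linear_on_def)
    then show "t c x \<in> \<delta> ` V" using * s.subspace_scale[OF assms(3)] by blast
  qed
  have "linear_on t (*) (\<delta> ` V) q"
    unfolding linear_on_def
  proof (intro conjI ballI allI)
    fix x y assume "x \<in> \<delta> ` V" "y \<in> \<delta> ` V"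
    then obtain a b where "a \<in> V" "b \<in> V" "x = \<delta> a" "y = \<delta> b" by auto
    then show "q (x + y) = q x + q y"
      using q[of a] q[of b] q[of "a + b"] assms(4,5) s.subspace_add[OF assms(3)]
      by (simp add: linear_on_def)
  next
    fix c x assume "x \<in> \<delta> ` V"
    then obtain a where "a \<in> V" "x = \<delta> a" by auto
    then show "q (t c x) = c * q x"
      using q[of a] q[of "s c a"] assms(4,5) s.subspace_scale[OF assms(3)]
      by (simp add: linear_on_def)
  qed
  then obtain g where "Vector_Spaces.linear t (*) g" "\<And>x. x \<in> \<delta> ` V \<Longrightarrow> g x = q x"
    using linear_on_extend[OF assms(2) vector_space_times sub] by blast
  with q that show ?thesis by force
qed

text \<open>The value at \<open>e\<close> can be prescribed because \<open>e\<close> is independent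
  of a basis of \<open>V\<close>. It stands for the coaugmentation.\<close>

lemma subspace_retraction:
  assumes "vector_space s" "Modules.module.subspace s V" "e \<notin> V"
  obtains r where "Vector_Spaces.linear s s r" "range r \<subseteq> V" "\<And>x. x \<in> V \<Longrightarrow> r x = x" "r e = 0"
proof -
  interpret s: vector_space s by fact
  interpret vector_space_pair s s ..
  obtain B where B: "B \<subseteq> V" "s.independent B" "V \<subseteq> s.span B"
    using s.maximal_independent_subset by blast
  have sB: "s.span B \<subseteq> V" using B assms(2) by (simp add: s.span_minimal)
  with assms B have eB: "e \<notin> s.span B" by auto
  then have i: "s.independent (insert e B)" using B by (simp add: s.independent_insertI)
  define f where "f y = (if y = e then 0 else y)" for y
  obtain r where r: "Vector_Spaces.linear s s r" "\<forall>y\<in>insert e B. r y = f y"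
     "range r = s.span (f ` insert e B)"
    using linear_independent_extend_subspace[OF i, of f] by blast
  have eB': "e \<notin> B" using eB s.span_base by auto
  have "f ` insert e B \<subseteq> V"
    using B eB' s.subspace_0[OF assms(2)] by (auto simp: f_def)
  then have "range r \<subseteq> V" using r(3) assms(2) by (metis s.span_minimal)
  moreover have "r x = id x" if "x \<in> s.span B" for x
    using r(2) eB' by (intro linear_eq_on[OF r(1) s.linear_id that]) (force simp: f_def)
  ultimately show ?thesis using B(3) r(1,2) by (intro that[of r]) (auto simp: f_def)
qed

text \<open>In infinite dimension a bilinear form on two full duals need not be represented by
  vectors. For a finite sum of pure tensors, fixing one argument leaves a finite combination of
  vectors.\<close>

lemma tensor_slice:
  assumes "vector_space s" "vector_space t" "Modules.module.subspace s V" "Modules.module.subspace t W"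
    and "\<tau> \<in> tensor s V t W"
  shows "\<phi> \<in> dual s V \<Longrightarrow> \<exists>w\<in>W. \<forall>\<psi>\<in>dual t W. \<tau> (\<phi>, \<psi>) = \<psi> w" (is "_ \<Longrightarrow> ?L")
    and "\<psi> \<in> dual t W \<Longrightarrow> \<exists>v\<in>V. \<forall>\<phi>\<in>dual s V. \<tau> (\<phi>, \<psi>) = \<phi> v" (is "_ \<Longrightarrow> ?R")
    and "p \<notin> dual s V \<times> dual t W \<Longrightarrow> \<tau> p = 0" (is "_ \<Longrightarrow> ?Z")
proof -
  interpret s: vector_space s by fact
  interpret t: vector_space t by fact
  interpret f: vector_space fscale by (rule vector_space_fscale)
  note sc = s.subspace_scale[OF assms(3)] t.subspace_scale[OF assms(4)]
    s.subspace_add[OF assms(3)] t.subspace_add[OF assms(4)]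
  have m: "\<tau> \<in> f.span {pure_tensor s V t W v w | v w. v \<in> V \<and> w \<in> W}"
    using assms(5) by (simp add: tensor_def)
  show ?L if \<phi>: "\<phi> \<in> dual s V"
    using m
  proof (induction rule: f.span_induct_alt)
    case base
    show ?case using t.subspace_0[OF assms(4)]
      by (intro bexI[of _ 0]) (auto simp: linear_on_zero[OF assms(2) vector_space_times assms(4) dual_linear_on])
  next
    case (step c x y)
    then obtain v w w' where *: "v \<in> V" "w \<in> W" "x = pure_tensor s V t W v w"
       "w' \<in> W" "\<forall>\<psi>\<in>dual t W. y (\<phi>, \<psi>) = \<psi> w'" by auto
    show ?case
      by (rule bexI[of _ "t (c * \<phi> v) w + w'"])
        (use * \<phi> sc in \<open>auto simp: pure_tensor_def zero_ext_def fscale_def dual_add dual_scale\<close>)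
  qed
  show ?R if \<psi>: "\<psi> \<in> dual t W"
    using m
  proof (induction rule: f.span_induct_alt)
    case base
    show ?case using s.subspace_0[OF assms(3)]
      by (intro bexI[of _ 0]) (auto simp: linear_on_zero[OF assms(1) vector_space_times assms(3) dual_linear_on])
  next
    case (step c x y)
    then obtain v w w' where *: "v \<in> V" "w \<in> W" "x = pure_tensor s V t W v w"
       "w' \<in> V" "\<forall>\<phi>\<in>dual s V. y (\<phi>, \<psi>) = \<phi> w'" by auto
    show ?case
      by (rule bexI[of _ "s (c * \<psi> w) v + w'"])
        (use * \<psi> sc in \<open>auto simp: pure_tensor_def zero_ext_def fscale_def dual_add dual_scale\<close>)
  qed
  show ?Z if p: "p \<notin> dual s V \<times> dual t W"
    using m
    by (induction rule: f.span_induct_alt)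
      (use p in \<open>auto simp: pure_tensor_def zero_ext_def fscale_def\<close>)
qed


section \<open>Conilpotent coalgebras and their dual algebras\<close>

locale conil_coalg =
  fixes s :: "'k::field \<Rightarrow> 'v::ab_group_add \<Rightarrow> 'v" and Co :: "('k, 'v) coalg"
  assumes cocomm: "cocomm_coalgebra s Co"
    and coaug: "coaugmented s Co"
    and conil: "conilpotent s Co"
begin

abbreviation C where "C \<equiv> cspace Co"
abbreviation A where "A \<equiv> dual s C"
abbreviation \<u> where "\<u> \<equiv> coaug Co"
abbreviation mul (infixl "\<star>" 70) where "\<phi> \<star> \<psi> \<equiv> conv Co \<phi> \<psi>"
abbreviation \<m> where "\<m> \<equiv> dual_max_ideal s Co"

definition \<epsilon> where "\<epsilon> = zero_ext C (counit Co)"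

lemma vs: "vector_space s" and subC: "Modules.module.subspace s C"
  using cocomm by (auto simp: cocomm_coalgebra_def)

sublocale vector_space s by (rule vs)

lemma C_add: "x \<in> C \<Longrightarrow> y \<in> C \<Longrightarrow> x + y \<in> C" and C_scale: "x \<in> C \<Longrightarrow> s a x \<in> C"
  and C_diff: "x \<in> C \<Longrightarrow> y \<in> C \<Longrightarrow> x - y \<in> C" and C_0: "0 \<in> C"
  using subC subspace_add subspace_scale subspace_diff subspace_0 by blast+

lemma u_C: "\<u> \<in> C" and counit_u: "counit Co \<u> = 1"
  using coaug by (auto simp: coaugmented_def)

lemma counit_linear: "linear_on s (*) C (counit Co)"
  using cocomm by (simp add: cocomm_coalgebra_def)

lemma eps_A: "\<epsilon> \<in> A"
  unfolding \<epsilon>_def by (rule zero_ext_in_dual[OF vs subC counit_linear])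

lemma eps_apply: "c \<in> C \<Longrightarrow> \<epsilon> c = counit Co c"
  by (simp add: \<epsilon>_def zero_ext_def)

lemma eps_u: "\<epsilon> \<u> = 1"
  by (simp add: eps_apply u_C counit_u)

lemma comult_tensor: "c \<in> C \<Longrightarrow> comult Co c \<in> tensor s C s C"
  using cocomm by (auto simp: cocomm_coalgebra_def)

lemma comult_outside: "c \<in> C \<Longrightarrow> p \<notin> A \<times> A \<Longrightarrow> comult Co c p = 0"
  using tensor_slice(3)[OF vs vs subC subC comult_tensor] by blast

lemma mul_apply: "c \<in> C \<Longrightarrow> (\<phi> \<star> \<psi>) c = comult Co c (\<phi>, \<psi>)"
  by (simp add: conv_def zero_ext_def)

lemma mul_A: "\<phi> \<star> \<psi> \<in> A"
  unfolding conv_def using cocomm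
  by (intro zero_ext_in_dual[OF vs subC])
    (auto simp: cocomm_coalgebra_def linear_on_def fscale_def)

lemma mul_assoc:
  assumes "\<phi> \<in> A" "\<psi> \<in> A" "\<chi> \<in> A"
  shows "\<phi> \<star> \<psi> \<star> \<chi> = \<phi> \<star> (\<psi> \<star> \<chi>)"
  using cocomm assms by (auto simp: cocomm_coalgebra_def conv_def[of Co "\<phi> \<star> \<psi>"]
      conv_def[of Co \<phi> "\<psi> \<star> \<chi>"] zero_ext_def fun_eq_iff)

lemma mul_comm:
  assumes "\<phi> \<in> A" "\<psi> \<in> A"
  shows "\<phi> \<star> \<psi> = \<psi> \<star> \<phi>"
  using cocomm assms by (auto simp: cocomm_coalgebra_def conv_def zero_ext_def fun_eq_iff)

lemma mul_eps: 
  assumes "\<phi> \<in> A"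
  shows "\<phi> \<star> \<epsilon> = \<phi>" "\<epsilon> \<star> \<phi> = \<phi>"
proof -
  have "(\<phi> \<star> \<epsilon>) c = \<phi> c" "(\<epsilon> \<star> \<phi>) c = \<phi> c" if "c \<in> C" for c
    using cocomm assms that by (simp_all add: cocomm_coalgebra_def mul_apply \<epsilon>_def)
  then show "\<phi> \<star> \<epsilon> = \<phi>" "\<epsilon> \<star> \<phi> = \<phi>"
    by (auto intro!: dual_eqI[of _ s C] mul_A assms)
qed

lemma contract_ex: "c \<in> C \<Longrightarrow> \<psi> \<in> A \<Longrightarrow> \<exists>c'\<in>C. \<forall>\<phi>\<in>A. (\<phi> \<star> \<psi>) c = \<phi> c'"
  using tensor_slice(2)[OF vs vs subC subC comult_tensor] by (auto simp: mul_apply)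

text \<open>The action of the dual algebra on the coalgebra: the transpose of multiplication by
  \<psi>. The choice is unambiguous because functionals separate points.\<close>

definition contract where
  "contract \<psi> c = (SOME c'. c' \<in> C \<and> (\<forall>\<phi>\<in>A. (\<phi> \<star> \<psi>) c = \<phi> c'))"

lemma contract_C: "c \<in> C \<Longrightarrow> \<psi> \<in> A \<Longrightarrow> contract \<psi> c \<in> C"
  and contract: "c \<in> C \<Longrightarrow> \<psi> \<in> A \<Longrightarrow> \<phi> \<in> A \<Longrightarrow> \<phi> (contract \<psi> c) = (\<phi> \<star> \<psi>) c"
proof -
  have "contract \<psi> c \<in> C \<and> (\<forall>\<phi>\<in>A. (\<phi> \<star> \<psi>) c = \<phi> (contract \<psi> c))" if "c \<in> C" "\<psi> \<in> A"
    unfolding contract_def by (rule someI_ex) (use contract_ex[OF that] in auto)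
  then show "c \<in> C \<Longrightarrow> \<psi> \<in> A \<Longrightarrow> contract \<psi> c \<in> C"
    "c \<in> C \<Longrightarrow> \<psi> \<in> A \<Longrightarrow> \<phi> \<in> A \<Longrightarrow> \<phi> (contract \<psi> c) = (\<phi> \<star> \<psi>) c" by auto
qed

lemma separate: "x \<in> C \<Longrightarrow> y \<in> C \<Longrightarrow> (\<And>\<phi>. \<phi> \<in> A \<Longrightarrow> \<phi> x = \<phi> y) \<Longrightarrow> x = y"
  using dual_separates[OF vs subC, of "x - y"] C_diff[of x y]
    linear_on_diff[OF vs vector_space_times dual_linear_on subC, of _ x y] by force

lemma contract_linear:
  assumes "\<psi> \<in> A" shows "linear_on s s C (contract \<psi>)"
  unfolding linear_on_def using assms
  by (auto intro!: separate contract_C C_add C_scale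
      simp: contract C_add C_scale dual_add[of _ s C] dual_scale[of _ s C] contract_C dual_add[OF mul_A] dual_scale[OF mul_A])

text \<open>The comultiplication takes values in functions on pairs of functionals. Additivity in
  the first argument comes from their being tensors: multiplying by \<psi> amounts to evaluating
  \<phi> at the single vector \<open>contract \<psi> c\<close>.\<close>

lemma mul_plus_left: "\<phi> \<in> A \<Longrightarrow> \<phi>' \<in> A \<Longrightarrow> \<psi> \<in> A \<Longrightarrow> (\<phi> + \<phi>') \<star> \<psi> = \<phi> \<star> \<psi> + \<phi>' \<star> \<psi>"
  using contract[of _ \<psi> "\<phi> + \<phi>'"]
  by (intro dual_eqI[of _ s C]) (auto simp: contract dual_plus intro: mul_A dual_plus)

lemma mul_scale_left: "\<phi> \<in> A \<Longrightarrow> \<psi> \<in> A \<Longrightarrow> fscale a \<phi> \<star> \<psi> = fscale a (\<phi> \<star> \<psi>)"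
  by (intro dual_eqI[of _ s C] mul_A dual_fscale) (simp_all add: contract[of _ \<psi> \<phi>] mul_A dual_fscale fscale_apply flip: contract[of _ \<psi> "fscale a \<phi>"])

lemma mul_plus_right: "\<phi> \<in> A \<Longrightarrow> \<phi>' \<in> A \<Longrightarrow> \<psi> \<in> A \<Longrightarrow> \<psi> \<star> (\<phi> + \<phi>') = \<psi> \<star> \<phi> + \<psi> \<star> \<phi>'"
  using mul_plus_left by (simp add: mul_comm dual_plus)

lemma mul_scale_right: "\<phi> \<in> A \<Longrightarrow> \<psi> \<in> A \<Longrightarrow> \<psi> \<star> fscale a \<phi> = fscale a (\<psi> \<star> \<phi>)"
  using mul_scale_left by (simp add: mul_comm dual_fscale)

lemma mul_zero: "\<phi> \<in> A \<Longrightarrow> 0 \<star> \<phi> = 0" "\<phi> \<in> A \<Longrightarrow> \<phi> \<star> 0 = 0"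
  using mul_plus_left[of 0 0 \<phi>] mul_comm[of 0 \<phi>] by (auto simp: dual_zero)

lemma mul_u: "\<phi> \<in> A \<Longrightarrow> \<psi> \<in> A \<Longrightarrow> (\<phi> \<star> \<psi>) \<u> = \<phi> \<u> * \<psi> \<u>"
  using coaug by (simp add: mul_apply u_C coaugmented_def pure_tensor_def zero_ext_def)

definition lprod where "lprod \<phi>s = foldr (\<star>) \<phi>s \<epsilon>"

lemma lprod_simps [simp]: "lprod [] = \<epsilon>" "lprod (\<phi> # \<phi>s) = \<phi> \<star> lprod \<phi>s"
  by (simp_all add: lprod_def)

lemma lprod_A: "lprod \<phi>s \<in> A"
  by (cases \<phi>s) (auto simp: eps_A mul_A)

lemma lprod_append: "set \<phi>s \<subseteq> A \<Longrightarrow> lprod (\<phi>s @ \<psi>s) = lprod \<phi>s \<star> lprod \<psi>s"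
  by (induction \<phi>s) (auto simp: mul_assoc lprod_A mul_eps)

lemma lprod_remove1: "set \<phi>s \<subseteq> A \<Longrightarrow> \<phi> \<in> set \<phi>s \<Longrightarrow> lprod \<phi>s = \<phi> \<star> lprod (remove1 \<phi> \<phi>s)"
proof (induction \<phi>s)
  case (Cons \<psi> \<phi>s)
  show ?case
  proof (cases "\<phi> = \<psi>")
    case False
    with Cons have A: "\<psi> \<in> A" "\<phi> \<in> A" by auto
    with Cons False have "lprod (\<psi> # \<phi>s) = \<psi> \<star> (\<phi> \<star> lprod (remove1 \<phi> \<phi>s))" by simp
    also have "\<dots> = \<phi> \<star> (\<psi> \<star> lprod (remove1 \<phi> \<phi>s))"
      using A mul_comm[of \<phi> \<psi>] by (simp add: mul_assoc[symmetric] lprod_A)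
    finally show ?thesis using False by simp
  qed simp
qed simp

lemma lprod_mset: "set \<phi>s \<subseteq> A \<Longrightarrow> mset \<phi>s = mset \<psi>s \<Longrightarrow> lprod \<phi>s = lprod \<psi>s"
proof (induction \<phi>s arbitrary: \<psi>s)
  case (Cons \<phi> \<phi>s)
  have *: "\<phi> \<in> set \<psi>s" "set \<psi>s \<subseteq> A"
    using Cons.prems mset_eq_setD by (metis list.set_intros(1))+
  have "mset \<phi>s = mset (remove1 \<phi> \<psi>s)" using Cons.prems(2) 
    by (metis add_mset_remove_trivial mset.simps(2) mset_remove1)
  with Cons have "lprod \<phi>s = lprod (remove1 \<phi> \<psi>s)" by auto
  with lprod_remove1[OF *(2,1)] show ?case by simp
qed simp

section \<open>The maximal ideal, its powers and the primitives\<close>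

lemma m_A: "\<phi> \<in> \<m> \<Longrightarrow> \<phi> \<in> A" and m_u: "\<phi> \<in> \<m> \<Longrightarrow> \<phi> \<u> = 0"
  by (auto simp: dual_max_ideal_def)

lemma m_mul: "\<phi> \<in> \<m> \<Longrightarrow> \<psi> \<in> A \<Longrightarrow> \<phi> \<star> \<psi> \<in> \<m>"
  by (auto simp: dual_max_ideal_def mul_A mul_u)

lemma lprod_m: "set \<phi>s \<subseteq> \<m> \<Longrightarrow> \<phi>s \<noteq> [] \<Longrightarrow> lprod \<phi>s \<in> \<m>"
  by (cases \<phi>s) (auto simp: m_mul lprod_A)

text \<open>Each correction term in \<open>red_comult\<close> contains the value of an argument at
  \<open>\<u>\<close>, which is 0 on \<m>. Conilpotency thus becomes a statement about products in
  the maximal ideal.\<close>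

lemma iter_red_comult_m:
  assumes "set \<phi>s \<subseteq> \<m>" "\<phi>s \<noteq> []" "c \<in> C"
  shows "iter_red_comult s Co \<phi>s c = lprod \<phi>s c"
  using assms
proof (induction \<phi>s arbitrary: c rule: induct_list012)
  case (2 \<phi>) then show ?case by (simp add: mul_eps m_A)
next
  case (3 \<phi> \<psi> \<phi>s)
  have z: "zero_ext C (iter_red_comult s Co (\<psi> # \<phi>s)) = lprod (\<psi> # \<phi>s)"
    using 3 dual_outside[OF lprod_A[of "\<psi> # \<phi>s"]] by (auto simp: zero_ext_def fun_eq_iff)
  have m: "lprod (\<psi> # \<phi>s) \<in> \<m>" "\<phi> \<in> \<m>" using 3 by (auto intro!: m_mul lprod_A)
  have "iter_red_comult s Co (\<phi> # \<psi> # \<phi>s) c = red_comult s Co c (\<phi>, lprod (\<psi> # \<phi>s))"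
    by (simp only: iter_red_comult.simps z)
  also have "\<dots> = lprod (\<phi> # \<psi> # \<phi>s) c"
    using m m_u[OF m(1)] m_u[OF m(2)] mul_apply[OF 3(5)] m_A[OF m(1)]
    by (simp add: red_comult_def pure_tensor_def zero_ext_def fscale_def del: lprod_simps(2))
       (simp add: lprod_simps(2)[of \<phi>] mul_apply[OF 3(5)])
  finally show ?case .
qed simp

text \<open>Orthogonality to the n-th power of \<m>: for n >= 1 a step of the coradical filtration.
  For n = 0 the empty product is \<epsilon>, and the condition is vanishing of the counit; hence the
  bounds 1 <= n below.\<close>

definition killed :: "nat \<Rightarrow> 'v \<Rightarrow> bool" where
  "killed n c \<longleftrightarrow> (\<forall>\<phi>s. set \<phi>s \<subseteq> \<m> \<and> length \<phi>s = n \<longrightarrow> lprod \<phi>s c = 0)"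

text \<open>Multiplying the last k - n + 1 factors into one element of \<m> leaves a product of n
  factors.\<close>

lemma killed_le:
  assumes "killed n c" "n \<le> k" "1 \<le> n"
  shows "killed k c"
  unfolding killed_def
proof (intro allI impI)
  fix \<phi>s assume \<phi>s: "set \<phi>s \<subseteq> \<m> \<and> length \<phi>s = k"
  define \<psi>s where "\<psi>s = drop (n - 1) \<phi>s"
  have n: "\<psi>s \<noteq> []" using assms \<phi>s by (auto simp: \<psi>s_def)
  have sub: "set \<psi>s \<subseteq> \<m>" "set (take (n - 1) \<phi>s) \<subseteq> \<m>" 
    using \<phi>s set_drop_subset[of "n - 1" \<phi>s] set_take_subset[of "n - 1" \<phi>s] by (auto simp: \<psi>s_def)
  have "lprod \<phi>s = lprod (take (n - 1) \<phi>s @ \<psi>s)" by (simp add: \<psi>s_def)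
  also have "\<dots> = lprod (take (n - 1) \<phi>s @ [lprod \<psi>s])"
    using sub m_A by (subst (1 2) lprod_append) (auto simp: mul_eps lprod_A)
  finally show "lprod \<phi>s c = 0"
    using assms sub \<phi>s lprod_m[OF sub(1) n] unfolding killed_def by (auto simp: min_def)
qed

text \<open>\<open>conilpotent\<close> speaks of the kernel of the counit. Splitting off a multiple
  of \<open>\<u>\<close> reaches every element, since nonempty products in \<m> vanish at
  \<open>\<u>\<close>.\<close>

lemma killed_ex:
  assumes "c \<in> C" obtains n where "n \<ge> 1" "killed n c"
proof -
  define c0 where "c0 = c - s (counit Co c) \<u>"
  have c0: "c0 \<in> C" "counit Co c0 = 0"
    using assms by (auto simp: c0_def C_diff C_scale u_C counit_u
        linear_on_diff[OF vs vector_space_times counit_linear subC] 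
        counit_linear[unfolded linear_on_def, THEN conjunct2])
  with conil obtain n where n: "n \<ge> 1" "\<And>\<phi>s. length \<phi>s = n \<and> set \<phi>s \<subseteq> A \<Longrightarrow> iter_red_comult s Co \<phi>s c0 = 0"
    unfolding conilpotent_def by blast
  have "lprod \<phi>s c = 0" if "set \<phi>s \<subseteq> \<m>" "length \<phi>s = n" for \<phi>s
  proof -
    have ne: "\<phi>s \<noteq> []" using that n by auto
    have "lprod \<phi>s c0 = 0" using n(2)[of \<phi>s] that m_A iter_red_comult_m[OF that(1) ne c0(1)] by auto
    moreover have "lprod \<phi>s c0 = lprod \<phi>s c - counit Co c * lprod \<phi>s \<u>"
      using assms by (simp add: c0_def C_scale u_C 
        linear_on_diff[OF vs vector_space_times dual_linear_on[OF lprod_A] subC] dual_scale[OF lprod_A])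
    ultimately show ?thesis using m_u[OF lprod_m[OF that(1) ne]] by simp
  qed
  with n that show thesis by (auto simp: killed_def)
qed

text \<open>Dually, primitives are the derivations of \<open>A\<close> at the augmentation, that is,
  tangent vectors. Comparing forms on \<open>A \<times> A\<close> suffices because tensors vanish
  elsewhere.\<close>

lemma prim_iff: "x \<in> prim s Co \<longleftrightarrow> x \<in> C \<and> (\<forall>\<phi>\<in>A. \<forall>\<psi>\<in>A. (\<phi> \<star> \<psi>) x = \<phi> x * \<psi> \<u> + \<phi> \<u> * \<psi> x)"
  using comult_outside[of x]
  by (fastforce simp: prim_def mul_apply fun_eq_iff pure_tensor_def zero_ext_def)

abbreviation P where "P \<equiv> prim s Co"

lemma prim_C: "x \<in> P \<Longrightarrow> x \<in> C" by (simp add: prim_iff)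

lemma prim_mul: "x \<in> P \<Longrightarrow> \<phi> \<in> A \<Longrightarrow> \<psi> \<in> A \<Longrightarrow> (\<phi> \<star> \<psi>) x = \<phi> x * \<psi> \<u> + \<phi> \<u> * \<psi> x"
  by (simp add: prim_iff)

lemma prim_subspace: "subspace P"
  unfolding subspace_def
  by (auto simp: prim_iff C_0 C_add C_scale dual_add[OF mul_A] dual_scale[OF mul_A]
    dual_add[of _ s C] dual_scale[of _ s C] algebra_simps linear_on_zero[OF vs vector_space_times subC dual_linear_on] 
    linear_on_zero[OF vs vector_space_times subC dual_linear_on[OF mul_A]])

lemma prim_counit: "x \<in> P \<Longrightarrow> counit Co x = 0"
  using prim_mul[of x \<epsilon> \<epsilon>]
  by (simp only: eps_A mul_eps eps_u eps_apply prim_C mult_1 mult_1_right simp_thms True_implies_equals)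
    (metis add_cancel_left_left)

lemma u_not_prim: "\<u> \<notin> P"
  using prim_counit counit_u by force

text \<open>The parts \<open>\<phi>0\<close> and \<open>\<psi>0\<close> in \<m> have product zero at
  \<open>c\<close>. Expanding this gives the Leibniz rule up to a counit term, which the subtracted
  multiple of \<open>\<u>\<close> removes.\<close>

lemma killed_2_prim:
  assumes "c \<in> C" "killed 2 c"
  shows "c - s (counit Co c) \<u> \<in> P"
proof -
  define c0 where "c0 = c - s (counit Co c) \<u>"
  have c0: "c0 \<in> C" by (simp add: c0_def assms C_diff C_scale u_C)
  have ev: "\<phi> c0 = \<phi> c - counit Co c * \<phi> \<u>" if "\<phi> \<in> A" for \<phi>
    using that assms by (simp add: c0_def C_scale u_C 
        linear_on_diff[OF vs vector_space_times dual_linear_on subC] dual_scale[of _ s C])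
  have "(\<phi> \<star> \<psi>) c0 = \<phi> c0 * \<psi> \<u> + \<phi> \<u> * \<psi> c0" if A: "\<phi> \<in> A" "\<psi> \<in> A" for \<phi> \<psi>
  proof -
    define \<phi>0 where "\<phi>0 = \<phi> + fscale (- \<phi> \<u>) \<epsilon>"
    define \<psi>0 where "\<psi>0 = \<psi> + fscale (- \<psi> \<u>) \<epsilon>"
    have m: "\<phi>0 \<in> \<m>" "\<psi>0 \<in> \<m>"
      using A by (auto simp: dual_max_ideal_def \<phi>0_def \<psi>0_def eps_u eps_A fscale_apply
         intro!: dual_plus dual_fscale)
    have "(\<phi>0 \<star> \<psi>0) c = 0"
      using assms(2) m unfolding killed_def by (auto dest!: spec[of _ "[\<phi>0, \<psi>0]"] simp: mul_eps m_A)
    moreover have "\<phi>0 \<star> \<psi>0 = \<phi> \<star> \<psi> + fscale (- \<psi> \<u>) \<phi> + fscale (- \<phi> \<u>) \<psi> + fscale (\<phi> \<u> * \<psi> \<u>) \<epsilon>"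
      using A by (simp add: \<phi>0_def \<psi>0_def mul_plus_left mul_plus_right mul_scale_left mul_scale_right
          dual_plus dual_fscale eps_A mul_A mul_eps)
        (simp add: fscale_def fun_eq_iff algebra_simps)
    ultimately have "(\<phi> \<star> \<psi>) c = \<phi> c * \<psi> \<u> + \<phi> \<u> * \<psi> c - \<phi> \<u> * \<psi> \<u> * counit Co c"
      by (simp add: fscale_def eps_apply assms algebra_simps)
    with A show ?thesis by (simp add: ev mul_A mul_u algebra_simps)
  qed
  with c0 show ?thesis unfolding prim_iff c0_def by blast
qed

end


section \<open>Multilinear forms\<close>

text \<open>Forms of all degrees at once, linear in the slot where the list is split. In finite
  dimension bounded degree singles out the tensors among them.\<close>

definition multilin where
  "multilin s V f \<longleftrightarrow>
    (\<forall>\<phi>s. \<not> set \<phi>s \<subseteq> dual s V \<longrightarrow> f \<phi>s = 0) \<and>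
    (\<forall>as \<phi> \<psi> bs. set as \<subseteq> dual s V \<and> set bs \<subseteq> dual s V \<and> \<phi> \<in> dual s V \<and> \<psi> \<in> dual s V \<longrightarrow>
       f (as @ (\<phi> + \<psi>) # bs) = f (as @ \<phi> # bs) + f (as @ \<psi> # bs)) \<and>
    (\<forall>as \<phi> a bs. set as \<subseteq> dual s V \<and> set bs \<subseteq> dual s V \<and> \<phi> \<in> dual s V \<longrightarrow>
       f (as @ fscale a \<phi> # bs) = a * f (as @ \<phi> # bs))"

lemma multilin_outside: "multilin s V f \<Longrightarrow> \<not> set \<phi>s \<subseteq> dual s V \<Longrightarrow> f \<phi>s = 0"
  by (auto simp: multilin_def)

lemma multilin_plus:
  "multilin s V f \<Longrightarrow> set as \<subseteq> dual s V \<Longrightarrow> set bs \<subseteq> dual s V \<Longrightarrow> \<phi> \<in> dual s V \<Longrightarrow> \<psi> \<in> dual s V \<Longrightarrow>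
       f (as @ (\<phi> + \<psi>) # bs) = f (as @ \<phi> # bs) + f (as @ \<psi> # bs)"
  by (auto simp: multilin_def)

lemma multilin_scale:
  "multilin s V f \<Longrightarrow> set as \<subseteq> dual s V \<Longrightarrow> set bs \<subseteq> dual s V \<Longrightarrow> \<phi> \<in> dual s V \<Longrightarrow>
       f (as @ fscale a \<phi> # bs) = a * f (as @ \<phi> # bs)"
  by (auto simp: multilin_def)

lemma multilin_zero: "multilin s V 0"
  by (auto simp: multilin_def)

lemma multilin_add_scale: "multilin s V f \<Longrightarrow> multilin s V g \<Longrightarrow> multilin s V (fscale a f + g)"
  unfolding multilin_def by (auto simp: fscale_apply algebra_simps)

lemma multilin_sum:
  assumes "multilin s V f" "set as \<subseteq> dual s V" "set bs \<subseteq> dual s V" "\<And>i. i \<in> I \<Longrightarrow> \<phi> i \<in> dual s V"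
    and "finite I"
  shows "f (as @ (\<Sum>i\<in>I. fscale (c i) (\<phi> i)) # bs) = (\<Sum>i\<in>I. c i * f (as @ \<phi> i # bs))"
  using \<open>finite I\<close> assms(4)
proof (induction I rule: finite_induct)
  case empty
  have "f (as @ fscale 0 0 # bs) = 0"
    using assms(1-3) by (simp add: multilin_scale dual_zero)
  moreover have "fscale 0 0 = (0 :: 'b \<Rightarrow> 'a)" by (simp add: fscale_def fun_eq_iff)
  ultimately show ?case by (simp only: sum.empty)
next
  case (insert i I)
  have D: "\<phi> i \<in> dual s V" "(\<Sum>i\<in>I. fscale (c i) (\<phi> i)) \<in> dual s V"
    using insert by (auto intro: dual_sum dual_fscale)
  have "f (as @ (fscale (c i) (\<phi> i) + (\<Sum>i\<in>I. fscale (c i) (\<phi> i))) # bs)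
      = c i * f (as @ \<phi> i # bs) + f (as @ (\<Sum>i\<in>I. fscale (c i) (\<phi> i)) # bs)"
    using assms(1-3) D by (subst multilin_plus[OF assms(1-3)]) (auto simp: multilin_scale dual_fscale)
  with insert show ?case by (simp only: sum.insert insert_iff simp_thms)
qed

lemma word_eq:
  "word s V vs \<phi>s = (if length \<phi>s = length vs \<and> set \<phi>s \<subseteq> dual s V then \<Prod>(v, \<phi>)\<leftarrow>zip vs \<phi>s. \<phi> v else 0)"
proof (cases "length \<phi>s = length vs \<and> set \<phi>s \<subseteq> dual s V")
  case True
  have "(\<Prod>i<length vs. (\<phi>s ! i) (vs ! i)) = (\<Prod>(v, \<phi>)\<leftarrow>zip vs \<phi>s. \<phi> v)"
    using True by (simp add: prod.list_conv_set_nth atLeast0LessThan)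
  with True show ?thesis by (simp add: word_def zero_ext_def)
qed (auto simp: word_def zero_ext_def)

lemma word_simps:
  "word s V [] [] = 1" "word s V (v # vs) [] = 0" "word s V [] (\<phi> # \<phi>s) = 0"
  "\<phi> \<in> dual s V \<Longrightarrow> word s V (v # vs) (\<phi> # \<phi>s) = \<phi> v * word s V vs \<phi>s"
  "length \<phi>s \<noteq> length vs \<Longrightarrow> word s V vs \<phi>s = 0"
  "\<not> set \<phi>s \<subseteq> dual s V \<Longrightarrow> word s V vs \<phi>s = 0"
  by (auto simp: word_eq)

lemma word_append:
  "length as = length vs \<Longrightarrow> word s V (vs @ ws) (as @ bs) = word s V vs as * word s V ws bs"
  by (auto simp: word_eq)

lemma word_multilin:
  assumes "set vs \<subseteq> V"
  shows "multilin s V (word s V vs)"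
  unfolding multilin_def
proof (intro conjI allI impI)
  fix as bs \<phi> \<psi>
  assume *: "set as \<subseteq> dual s V \<and> set bs \<subseteq> dual s V \<and> \<phi> \<in> dual s V \<and> \<psi> \<in> dual s V"
  show "word s V vs (as @ (\<phi> + \<psi>) # bs) = word s V vs (as @ \<phi> # bs) + word s V vs (as @ \<psi> # bs)"
  proof (cases "length vs = length as + Suc (length bs)")
    case True
    then obtain vs1 v vs2 where "vs = vs1 @ v # vs2" "length vs1 = length as"
      by (metis id_take_nth_drop length_take less_add_Suc1 add_Suc_right min.absorb2 less_imp_le)
    with * show ?thesis
      by (simp add: word_append word_simps dual_plus algebra_simps)
  qed (simp add: word_simps)
next
  fix as bs \<phi> a
  assume *: "set as \<subseteq> dual s V \<and> set bs \<subseteq> dual s V \<and> \<phi> \<in> dual s V"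
  show "word s V vs (as @ fscale a \<phi> # bs) = a * word s V vs (as @ \<phi> # bs)"
  proof (cases "length vs = length as + Suc (length bs)")
    case True
    then obtain vs1 v vs2 where "vs = vs1 @ v # vs2" "length vs1 = length as"
      by (metis id_take_nth_drop length_take less_add_Suc1 add_Suc_right min.absorb2 less_imp_le)
    with * show ?thesis
      by (simp add: word_append word_simps dual_fscale fscale_apply algebra_simps)
  qed (simp add: word_simps)
qed (simp add: word_simps)

lemma tensor_space_multilin:
  assumes "t \<in> tensor_space s V"
  shows "multilin s V t" "\<exists>N. \<forall>\<phi>s. N \<le> length \<phi>s \<longrightarrow> t \<phi>s = 0"
proof -
  interpret f: vector_space fscale by (rule vector_space_fscale)
  have "t \<in> f.span {word s V vs | vs. set vs \<subseteq> V}" using assms by (simp add: tensor_space_def)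
  then have "multilin s V t \<and> (\<exists>N. \<forall>\<phi>s. N \<le> length \<phi>s \<longrightarrow> t \<phi>s = 0)"
  proof (induction rule: f.span_induct_alt)
    case base
    show ?case using multilin_zero by (auto simp: zero_fun_def)
  next
    case (step c x y)
    then obtain vs N where *: "set vs \<subseteq> V" "x = word s V vs" "multilin s V y" "\<forall>\<phi>s. N \<le> length \<phi>s \<longrightarrow> y \<phi>s = 0"
      by auto
    then have "\<forall>\<phi>s. max N (Suc (length vs)) \<le> length \<phi>s \<longrightarrow> (fscale c x + y) \<phi>s = 0"
      by (auto simp: fscale_apply intro!: word_simps(5))
    with * show ?case by (metis multilin_add_scale word_multilin)
  qed
  then show "multilin s V t" "\<exists>N. \<forall>\<phi>s. N \<le> length \<phi>s \<longrightarrow> t \<phi>s = 0" by auto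
qed

lemma sym_tensors_subspace: "Modules.module.subspace fscale (sym_tensors s V)"
proof -
  interpret f: vector_space fscale by (rule vector_space_fscale)
  have "f.subspace (tensor_space s V)" by (simp add: tensor_space_def)
  moreover have "f.subspace {t. \<forall>\<phi>s \<psi>s. mset \<phi>s = mset \<psi>s \<longrightarrow> t \<phi>s = t \<psi>s}"
    unfolding f.subspace_def mem_Collect_eq plus_fun_apply fscale_apply
    by (intro conjI ballI allI impI arg_cong2[of _ _ _ _ "(+)"] arg_cong2[of _ _ _ _ "(*)"]) (simp, blast, blast, simp, blast)
  ultimately have "f.subspace (tensor_space s V \<inter> {t. \<forall>\<phi>s \<psi>s. mset \<phi>s = mset \<psi>s \<longrightarrow> t \<phi>s = t \<psi>s})"
    by (rule f.subspace_inter)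
  then show ?thesis unfolding sym_tensors_def Int_def mem_Collect_eq .
qed

locale finite_basis = vector_space s
  for s :: "'k::field \<Rightarrow> 'v::ab_group_add \<Rightarrow> 'v" +
  fixes V :: "'v set" and B :: "'v set" and \<beta> :: "'v \<Rightarrow> 'v \<Rightarrow> 'k"
  assumes fin: "finite B" and BV: "B \<subseteq> V" and subV: "subspace V"
    and beta: "\<And>b. b \<in> B \<Longrightarrow> \<beta> b \<in> dual s V"
    and dual_expand: "\<And>\<phi>. \<phi> \<in> dual s V \<Longrightarrow> \<phi> = (\<Sum>b\<in>B. fscale (\<phi> b) (\<beta> b))"
begin

definition words where "words n = {ws. set ws \<subseteq> B \<and> length ws = n}"

lemma finite_words: "finite (words n)"
  unfolding words_def using finite_lists_length_eq[OF fin] .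

lemma words_0: "words 0 = {[]}"
  by (auto simp: words_def)

lemma sum_words_Suc: "(\<Sum>ws\<in>words (Suc n). g ws) = (\<Sum>b\<in>B. \<Sum>ws\<in>words n. g (b # ws))"
proof -
  have "words (Suc n) = (\<lambda>(b, ws). b # ws) ` (B \<times> words n)"
    by (force simp: words_def length_Suc_conv image_iff)
  moreover have "inj_on (\<lambda>(b, ws). b # ws) (B \<times> words n)" by (auto simp: inj_on_def)
  ultimately show ?thesis
    by (simp add: sum.reindex sum.cartesian_product case_prod_beta')
qed

text \<open>Expanding the first argument turns it into some \<open>\<beta> b\<close>, which joins
  the prefix \<open>as\<close>; the induction therefore runs over arbitrary prefixes.\<close>

lemma multilin_expand_aux:
  assumes "multilin s V f" "set as \<subseteq> dual s V" "set \<phi>s \<subseteq> dual s V"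
  shows "f (as @ \<phi>s) = (\<Sum>ws\<in>words (length \<phi>s). word s V ws \<phi>s * f (as @ map \<beta> ws))"
  using assms(2,3)
proof (induction \<phi>s arbitrary: as)
  case Nil
  then show ?case by (simp add: words_0 word_simps)
next
  case (Cons \<phi> \<phi>s)
  have "f (as @ \<phi> # \<phi>s) = f (as @ (\<Sum>b\<in>B. fscale (\<phi> b) (\<beta> b)) # \<phi>s)"
    using dual_expand[of \<phi>] Cons.prems by simp
  also have "\<dots> = (\<Sum>b\<in>B. \<phi> b * f ((as @ [\<beta> b]) @ \<phi>s))"
    using Cons.prems by (subst multilin_sum[OF assms(1)]) (auto simp: beta fin)
  also have "\<dots> = (\<Sum>b\<in>B. \<phi> b * (\<Sum>ws\<in>words (length \<phi>s). word s V ws \<phi>s * f ((as @ [\<beta> b]) @ map \<beta> ws)))"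
    using Cons.prems by (intro sum.cong refl arg_cong2[of _ _ _ _ "(*)"] Cons.IH) (auto simp: beta)
  finally show ?case
    using Cons.prems by (simp add: sum_words_Suc word_simps sum_distrib_left mult.assoc)
qed

lemma multilin_expand:
  assumes "multilin s V f" "length \<phi>s = n"
  shows "f \<phi>s = (\<Sum>ws\<in>words n. word s V ws \<phi>s * f (map \<beta> ws))"
proof (cases "set \<phi>s \<subseteq> dual s V")
  case True
  with multilin_expand_aux[OF assms(1), of "[]" \<phi>s] assms(2) show ?thesis by simp
next
  case False
  with assms show ?thesis by (simp add: multilin_outside word_simps)
qed

lemma multilin_bounded_expand:
  assumes "multilin s V f" "\<And>\<phi>s. N \<le> length \<phi>s \<Longrightarrow> f \<phi>s = 0"
  shows "f = (\<Sum>n<N. \<Sum>ws\<in>words n. fscale (f (map \<beta> ws)) (word s V ws))"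
proof
  fix \<phi>s
  have "(\<Sum>n<N. \<Sum>ws\<in>words n. fscale (f (map \<beta> ws)) (word s V ws)) \<phi>s
    = (\<Sum>n<N. \<Sum>ws\<in>words n. word s V ws \<phi>s * f (map \<beta> ws))"
    by (simp add: sum_apply fscale_apply mult.commute)
  also have "\<dots> = (\<Sum>n<N. if n = length \<phi>s then f \<phi>s else 0)"
    by (intro sum.cong refl)
      (auto simp: multilin_expand[OF assms(1) refl, of \<phi>s] word_simps(5) words_def intro!: sum.neutral)
  also have "\<dots> = f \<phi>s" using assms(2) by (auto simp: sum.delta not_less)
  finally show "f \<phi>s = (\<Sum>n<N. \<Sum>ws\<in>words n. fscale (f (map \<beta> ws)) (word s V ws)) \<phi>s" ..
qed

text \<open>The values on the dual basis are the coefficients of a finite sum of words. This is how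
  finiteness of the primitives makes \<open>Phi c\<close> a tensor.\<close>

lemma multilin_tensor_space:
  assumes "multilin s V f" "\<And>\<phi>s. N \<le> length \<phi>s \<Longrightarrow> f \<phi>s = 0"
  shows "f \<in> tensor_space s V"
proof -
  interpret f: vector_space fscale by (rule vector_space_fscale)
  have "(\<Sum>n<N. \<Sum>ws\<in>words n. fscale (f (map \<beta> ws)) (word s V ws)) \<in> tensor_space s V"
    unfolding tensor_space_def using BV
    by (intro f.span_sum f.span_scale f.span_base) (auto simp: words_def)
  then show ?thesis by (subst multilin_bounded_expand[OF assms])
qed

end

lemma finite_basis_ex:
  assumes "vector_space s" "finite G" "Modules.module.span s G = V"
  obtains B \<beta> where "finite_basis s V B \<beta>"
proof -
  interpret s: vector_space s by fact
  interpret k: vector_space "(*) :: 'a \<Rightarrow> 'a \<Rightarrow> 'a" by (rule vector_space_times)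
  interpret vector_space_pair s "(*) :: 'a \<Rightarrow> 'a \<Rightarrow> 'a" ..
  obtain B where B: "B \<subseteq> G" "s.independent B" "G \<subseteq> s.span B"
    using s.maximal_independent_subset by blast
  have sub: "s.subspace V" using assms by auto
  have BV: "B \<subseteq> V" using B assms(3) s.span_superset by blast
  have spB: "s.span B = V" using B assms(3) by (metis s.span_eq s.span_superset subset_trans)
  have fin: "finite B" using B assms(2) finite_subset by blast
  define \<beta> where "\<beta> b = zero_ext V (construct B (\<lambda>b'. if b' = b then 1 else 0))" for b
  have beta: "\<beta> b \<in> dual s V" for b
    unfolding \<beta>_def by (rule linear_zero_ext_in_dual[OF linear_construct[OF B(2)] sub])
  have bb: "\<beta> b b' = (if b' = b then 1 else 0)" if "b' \<in> B" for b b'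
    using that BV construct_basis[OF B(2), of b' "\<lambda>b'. if b' = b then 1 else 0"]
    by (auto simp: \<beta>_def zero_ext_def)
  have "\<phi> = (\<Sum>b\<in>B. fscale (\<phi> b) (\<beta> b))" if \<phi>: "\<phi> \<in> dual s V" for \<phi>
  proof (rule dual_eqI)
    let ?\<psi> = "\<Sum>b\<in>B. fscale (\<phi> b) (\<beta> b)"
    show \<psi>: "?\<psi> \<in> dual s V" by (intro dual_sum dual_fscale beta)
    fix x assume "x \<in> V"
    then have "x \<in> s.span B" by (simp add: spB)
    then have "x \<in> V \<and> \<phi> x = ?\<psi> x"
    proof (induction rule: s.span_induct_alt)
      case base
      have "\<phi> 0 = 0" "?\<psi> 0 = 0"
        using \<phi> \<psi> by (blast intro: linear_on_zero[OF assms(1) vector_space_times sub dual_linear_on])+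
      then show ?case using s.subspace_0[OF sub] by simp
    next
      case (step c x y)
      have sum_app: "?\<psi> z = (\<Sum>b\<in>B. \<phi> b * \<beta> b z)" for z
        using fin by (induction B rule: finite_induct) (auto simp: fscale_apply)
      have "?\<psi> x = \<phi> x"
        using step fin by (simp add: sum_app bb if_distrib[of "\<lambda>u. \<phi> _ * u"] sum.delta cong: if_cong)
      moreover have "x \<in> V" "s c x \<in> V" using step BV s.subspace_scale[OF sub] by auto
      ultimately show ?case using step \<phi> \<psi> s.subspace_add[OF sub]
        by (simp add: dual_add[of _ s V] dual_scale[of _ s V])
    qed
    then show "\<phi> x = ?\<psi> x" ..
  qed (rule \<phi>)
  with fin BV sub beta have "finite_basis s V B \<beta>"
    by unfold_locales
  then show thesis by (rule that)
qed


section \<open>The coalgebra map given by a retraction onto primitives\<close>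

text \<open>\<open>R \<u> = 0\<close> makes the pulled-back functionals vanish at the
  coaugmentation, hence elements of \<m>. They serve as coordinates: by \<open>R_id\<close> they
  restrict to the given functionals on primitives.\<close>

locale retracted_coalg = conil_coalg s Co + finite_basis s "prim s Co" B \<beta>
  for s :: "'k::field \<Rightarrow> 'v::ab_group_add \<Rightarrow> 'v" and Co B \<beta> +
  fixes R :: "'v \<Rightarrow> 'v"
  assumes R_linear: "linear_on s s C R" and R_P: "\<And>x. x \<in> C \<Longrightarrow> R x \<in> P"
    and R_id: "\<And>x. x \<in> P \<Longrightarrow> R x = x" and R_u: "R \<u> = 0"
begin

abbreviation D where "D \<equiv> dual s P"

definition Rs where "Rs \<phi> = pullback C R \<phi>"

lemma Rs_apply: "c \<in> C \<Longrightarrow> Rs \<phi> c = \<phi> (R c)"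
  by (simp add: Rs_def pullback_def zero_ext_def)

lemma Rs_A: "\<phi> \<in> D \<Longrightarrow> Rs \<phi> \<in> A"
  unfolding Rs_def using R_P by (intro pullback_in_dual[OF vs subC R_linear]) auto

lemma D_zero: "\<phi> \<in> D \<Longrightarrow> \<phi> 0 = 0"
  by (rule linear_on_zero[OF vs vector_space_times prim_subspace dual_linear_on])

lemma Rs_m: "\<phi> \<in> D \<Longrightarrow> Rs \<phi> \<in> \<m>"
  by (simp add: dual_max_ideal_def Rs_A Rs_apply u_C R_u D_zero)

lemma map_Rs: "set \<phi>s \<subseteq> D \<Longrightarrow> set (map Rs \<phi>s) \<subseteq> \<m>" "set \<phi>s \<subseteq> D \<Longrightarrow> set (map Rs \<phi>s) \<subseteq> A"
  using Rs_m Rs_A by auto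

lemma Rs_plus: "\<phi> \<in> D \<Longrightarrow> \<psi> \<in> D \<Longrightarrow> Rs (\<phi> + \<psi>) = Rs \<phi> + Rs \<psi>"
  and Rs_scale: "\<phi> \<in> D \<Longrightarrow> Rs (fscale a \<phi>) = fscale a (Rs \<phi>)"
  by (auto simp: Rs_def pullback_def zero_ext_def fun_eq_iff fscale_apply)

definition form where
  "form v \<phi>s = (if set \<phi>s \<subseteq> D then v (lprod (map Rs \<phi>s)) else 0)"

lemma form_multilin:
  assumes "\<And>\<phi> \<psi>. \<phi> \<in> A \<Longrightarrow> \<psi> \<in> A \<Longrightarrow> v (\<phi> + \<psi>) = v \<phi> + v \<psi>"
    and "\<And>a \<phi>. \<phi> \<in> A \<Longrightarrow> v (fscale a \<phi>) = a * v \<phi>"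
  shows "multilin s P (form v)"
  unfolding multilin_def
proof (intro conjI allI impI)
  fix as bs \<phi> \<psi>
  assume *: "set as \<subseteq> D \<and> set bs \<subseteq> D \<and> \<phi> \<in> D \<and> \<psi> \<in> D"
  then have "lprod (map Rs (as @ (\<phi> + \<psi>) # bs)) = lprod (map Rs (as @ \<phi> # bs)) + lprod (map Rs (as @ \<psi> # bs))"
    using map_Rs(2)[of as]
    by (simp add: lprod_append Rs_plus mul_plus_left mul_plus_right Rs_A lprod_A mul_A)
  with * show "form v (as @ (\<phi> + \<psi>) # bs) = form v (as @ \<phi> # bs) + form v (as @ \<psi> # bs)"
    by (simp add: form_def dual_plus assms lprod_A del: lprod_simps)
next
  fix as bs \<phi> a
  assume *: "set as \<subseteq> D \<and> set bs \<subseteq> D \<and> \<phi> \<in> D"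
  then have "lprod (map Rs (as @ fscale a \<phi> # bs)) = fscale a (lprod (map Rs (as @ \<phi> # bs)))"
    using map_Rs(2)[of as]
    by (simp add: lprod_append Rs_scale mul_scale_left mul_scale_right Rs_A lprod_A mul_A)
  with * show "form v (as @ fscale a \<phi> # bs) = a * form v (as @ \<phi> # bs)"
    by (simp add: form_def dual_fscale assms lprod_A del: lprod_simps)
qed (auto simp: form_def)

lemma form_sym: "mset \<phi>s = mset \<psi>s \<Longrightarrow> form v \<phi>s = form v \<psi>s"
  using lprod_mset[of "map Rs \<phi>s" "map Rs \<psi>s"] map_Rs(2)[of \<phi>s]
  by (auto simp: form_def dest: mset_eq_setD)

definition Phi where "Phi c = form (\<lambda>\<phi>. \<phi> c)"

lemma Phi_apply: "set \<phi>s \<subseteq> D \<Longrightarrow> Phi c \<phi>s = lprod (map Rs \<phi>s) c"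
  by (simp add: Phi_def form_def)

lemma Phi_outside: "\<not> set \<phi>s \<subseteq> D \<Longrightarrow> Phi c \<phi>s = 0"
  unfolding Phi_def form_def by (rule if_not_P)

lemma Phi_multilin: "multilin s P (Phi c)"
  unfolding Phi_def by (rule form_multilin) (auto simp: fscale_apply)

lemma killed_Phi:
  assumes "killed n c" "n \<ge> 1" "n \<le> length \<phi>s"
  shows "Phi c \<phi>s = 0"
proof (cases "set \<phi>s \<subseteq> D")
  case True
  then show ?thesis using killed_le[OF assms(1,3,2)] map_Rs(1)[OF True]
    by (auto simp: killed_def Phi_apply)
qed (simp add: Phi_outside)

lemma Phi_sym_tensors:
  assumes "c \<in> C" shows "Phi c \<in> sym_tensors s P"
proof -
  obtain n where n: "n \<ge> 1" "killed n c" using killed_ex[OF assms] .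
  have "Phi c \<in> tensor_space s P"
    by (rule multilin_tensor_space[OF Phi_multilin, of n]) (rule killed_Phi[OF n(2,1)])
  moreover have "\<forall>\<phi>s \<psi>s. mset \<phi>s = mset \<psi>s \<longrightarrow> Phi c \<phi>s = Phi c \<psi>s"
    unfolding Phi_def by (blast intro: form_sym)
  ultimately show ?thesis unfolding sym_tensors_def by blast
qed

lemma Phi_linear: "linear_on s fscale C Phi"
  unfolding linear_on_def
proof (intro conjI ballI allI ext)
  fix x y \<phi>s assume "x \<in> C" "y \<in> C"
  then show "Phi (x + y) \<phi>s = (Phi x + Phi y) \<phi>s"
    by (simp add: Phi_def form_def dual_add[OF lprod_A])
next
  fix a x \<phi>s assume "x \<in> C"
  then show "Phi (s a x) \<phi>s = fscale a (Phi x) \<phi>s"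
    by (simp add: Phi_def form_def dual_scale[OF lprod_A] fscale_apply)
qed

text \<open>An element of \<open>\<m>\<close> which vanishes on primitives pairs to zero with every element killed by
  \<open>\<m>\<^sup>2\<close>, so modulo \<open>\<m>\<^sup>n\<^sup>+\<^sup>1\<close> a product of \<open>n\<close> elements of \<open>\<m>\<close> only depends on their restrictions
  to primitives.\<close>

lemma killed_descent:
  assumes c: "c \<in> C" "killed (Suc k) c" "k \<ge> 1"
    and Phi: "\<And>\<phi>s. length \<phi>s = k \<Longrightarrow> Phi c \<phi>s = 0"
  shows "killed k c"
proof -
  \<comment> \<open>The factors are replaced one at a time by pullbacks along \<open>R\<close>;
    \<open>as\<close> records those already replaced.\<close>
  have "lprod (map Rs as @ \<phi>s) c = 0" if "set as \<subseteq> D" "set \<phi>s \<subseteq> \<m>" "length as + length \<phi>s = k" for as \<phi>s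
    using that
  proof (induction \<phi>s arbitrary: as)
    case Nil
    then show ?case using Phi[of as] by (simp add: Phi_apply)
  next
    case (Cons \<phi> \<phi>s)
    define \<phi>1 where "\<phi>1 = zero_ext P \<phi>"
    have "linear_on s (*) P \<phi>"
      using Cons.prems m_A[of \<phi>] by (auto simp: linear_on_def dual_add[of _ s C] dual_scale[of _ s C] prim_C)
    then have \<phi>1: "\<phi>1 \<in> D" unfolding \<phi>1_def by (rule zero_ext_in_dual[OF vs prim_subspace])
    define \<phi>2 where "\<phi>2 = \<phi> - Rs \<phi>1"
    have \<phi>2: "\<phi>2 \<in> \<m>"
      using Cons.prems Rs_m[OF \<phi>1] by (auto simp: dual_max_ideal_def \<phi>2_def intro!: dual_minus)
    have \<phi>2P: "\<phi>2 x = 0" if "x \<in> P" for x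
      using that by (simp add: \<phi>2_def Rs_apply prim_C R_id \<phi>1_def zero_ext_def)
    have eq: "\<phi> = Rs \<phi>1 + \<phi>2" by (simp add: \<phi>2_def)
    define \<psi> where "\<psi> = lprod (map Rs as @ \<phi>s)"
    have \<psi>A: "\<psi> \<in> A" by (simp add: \<psi>_def lprod_A)
    have perm: "lprod (map Rs as @ \<chi> # \<phi>s) = \<chi> \<star> \<psi>" if "\<chi> \<in> \<m>" for \<chi>
    proof -
      have "set \<phi>s \<subseteq> A" using Cons.prems m_A by auto
      then show ?thesis
        using lprod_mset[of "map Rs as @ \<chi> # \<phi>s" "\<chi> # map Rs as @ \<phi>s"] that Cons.prems map_Rs(2)[of as] m_A
        by (auto simp: \<psi>_def)
    qed
    \<comment> \<open>Contraction with the other k - 1 factors. Two further elements of \<m> make a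
      product of k + 1, so \<open>c'\<close> is primitive up to a multiple of \<open>\<u>\<close>,
      and \<open>\<phi>2\<close> vanishes on both.\<close>
    define c' where "c' = contract \<psi> c"
    have c': "c' \<in> C" using c(1) \<psi>A by (simp add: c'_def contract_C)
    have "killed 2 c'"
      unfolding killed_def
    proof (intro allI impI)
      fix \<chi>s assume \<chi>s: "set \<chi>s \<subseteq> \<m> \<and> length \<chi>s = 2"
      then have "lprod (\<chi>s @ map Rs as @ \<phi>s) c = 0"
        using c(2) Cons.prems map_Rs[of as] unfolding killed_def by auto
      then show "lprod \<chi>s c' = 0"
        using \<chi>s m_A by (subst (asm) lprod_append) (auto simp: c'_def contract c(1) \<psi>A lprod_A \<psi>_def[symmetric])
    qed
    then have "c' - s (counit Co c') \<u> \<in> P" by (rule killed_2_prim[OF c'])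
    then have "\<phi>2 (c' - s (counit Co c') \<u>) = 0" by (rule \<phi>2P)
    then have "\<phi>2 c' = 0"
      using m_u[OF \<phi>2] m_A[OF \<phi>2] c' by (simp add: C_scale u_C 
        linear_on_diff[OF vs vector_space_times dual_linear_on subC] dual_scale[of _ s C])
    then have z: "lprod (map Rs as @ \<phi>2 # \<phi>s) c = 0"
      using perm[OF \<phi>2] m_A[OF \<phi>2] by (simp add: c'_def contract c(1) \<psi>A)
    have "lprod (map Rs (as @ [\<phi>1]) @ \<phi>s) c = 0"
      using Cons.prems \<phi>1 by (intro Cons.IH) auto
    then have "lprod (map Rs as @ Rs \<phi>1 # \<phi>s) c = 0" by simp
    with z show ?case
      using perm[of \<phi>] perm[OF \<phi>2] perm[OF Rs_m[OF \<phi>1]] Cons.prems m_A[OF \<phi>2] Rs_A[OF \<phi>1] \<psi>A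
      by (simp add: eq mul_plus_left)
  qed
  from this[of "[]"] show ?thesis by (simp add: killed_def)
qed

text \<open>Conilpotency supplies some bound, which \<open>killed_descent\<close> lowers one step at
  a time to n.\<close>

lemma Phi_killed:
  assumes "c \<in> C" "n \<ge> 1" "\<And>\<phi>s. length \<phi>s \<ge> n \<Longrightarrow> Phi c \<phi>s = 0"
  shows "killed n c"
proof -
  obtain N where N: "N \<ge> 1" "killed N c" using killed_ex[OF assms(1)] .
  then have max: "killed (max n N) c" by (auto intro: killed_le)
  have "n \<le> max n N" by simp
  then show ?thesis
  proof (induction rule: inc_induct)
    case (step k)
    show ?case
    proof (rule killed_descent[OF assms(1) step.IH])
      show "k \<ge> 1" using step.hyps assms(2) by linarith
      show "Phi c \<phi>s = 0" if "length \<phi>s = k" for \<phi>s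
        using step.hyps that by (intro assms(3)) simp
    qed
  qed (rule max)
qed

text \<open>\<open>A\<close> is spanned by \<epsilon> and \<m>: the empty list takes care of
  \<epsilon>, and \<open>Phi_killed\<close> with n = 1 of \<m>.\<close>

lemma Phi_zero:
  assumes "c \<in> C" "Phi c = 0"
  shows "c = 0"
proof (rule dual_separates[OF vs subC assms(1)])
  fix \<phi> assume \<phi>: "\<phi> \<in> A"
  have k: "killed 1 c" using assms by (intro Phi_killed) auto
  have e: "\<epsilon> c = 0" using assms Phi_apply[of "[]" c] by simp
  define \<phi>0 where "\<phi>0 = \<phi> + fscale (- \<phi> \<u>) \<epsilon>"
  have "\<phi>0 \<in> \<m>"
    using \<phi> by (auto simp: dual_max_ideal_def \<phi>0_def eps_u eps_A fscale_apply intro!: dual_plus dual_fscale)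
  then have "\<phi>0 c = 0"
    using k unfolding killed_def by (auto dest!: spec[of _ "[\<phi>0]"] simp: mul_eps m_A)
  then show "\<phi> c = 0" using e by (simp add: \<phi>0_def fscale_apply)
qed

lemma Phi_inj: "inj_on Phi C"
proof (rule inj_onI)
  fix x y assume *: "x \<in> C" "y \<in> C" "Phi x = Phi y"
  then have "Phi (x - y) = 0"
    by (simp add: linear_on_diff[OF vs vector_space_fscale Phi_linear subC])
  with * show "x = y" using Phi_zero[of "x - y"] by (simp add: C_diff)
qed

end


section \<open>Lifting tangent vectors to curves\<close>

text \<open>The right summand will be the type of functionals on the ground field, so a coefficient
  is stored as a constant function. The n + 1 entries hold the coefficients up to
  \<open>t^n\<close>.\<close>

definition trunc_enc :: "nat \<Rightarrow> 'k::field fps \<Rightarrow> ('x + ('k \<Rightarrow> 'k)) list" where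
  "trunc_enc n f = map (\<lambda>i. Inr (\<lambda>_. fps_nth f i)) [0..<Suc n]"

definition trunc_dec :: "('x + ('k \<Rightarrow> 'k)) list \<Rightarrow> 'k::field fps" where
  "trunc_dec xs = Abs_fps (\<lambda>i. if i < length xs then case xs ! i of Inl _ \<Rightarrow> 0 | Inr g \<Rightarrow> g 0 else 0)"

text \<open>A copy of \<open>\<bbbk>[t]/(t\<^sup>n\<^sup>+\<^sup>1)\<close> on the type of test rings of \<^const>\<open>formally_smooth\<close>.\<close>

definition trunc_ring :: "nat \<Rightarrow> ('x + ('k::field \<Rightarrow> 'k)) list ring" where
  "trunc_ring n = \<lparr> carrier = range (trunc_enc n), mult = (\<lambda>x y. trunc_enc n (trunc_dec x * trunc_dec y)),
     one = trunc_enc n 1, zero = trunc_enc n 0, add = (\<lambda>x y. trunc_enc n (trunc_dec x + trunc_dec y)) \<rparr>"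

lemma trunc_enc_eq: "trunc_enc n f = trunc_enc n g \<longleftrightarrow> (\<forall>i\<le>n. fps_nth f i = fps_nth g i)"
  by (auto simp: trunc_enc_def fun_eq_iff simp del: upt_Suc)

lemma trunc_dec_enc: "fps_nth (trunc_dec (trunc_enc n f)) i = (if i \<le> n then fps_nth f i else 0)"
  by (auto simp: trunc_dec_def trunc_enc_def less_Suc_eq_le simp del: upt_Suc)

lemma trunc_enc_mult: "trunc_enc n (trunc_dec (trunc_enc n f) * trunc_dec (trunc_enc n g)) = trunc_enc n (f * g)"
  by (auto simp: trunc_enc_eq fps_mult_nth trunc_dec_enc intro!: sum.cong)

lemma trunc_enc_add: "trunc_enc n (trunc_dec (trunc_enc n f) + trunc_dec (trunc_enc n g)) = trunc_enc n (f + g)"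
  by (auto simp: trunc_enc_eq trunc_dec_enc)

text \<open>\<open>N\<close> is the ideal generated by \<open>t^2\<close>, so maps to
  \<open>E Quot N\<close> see tangent vectors. For n = 0 the coefficient at 1 is already truncated
  away and \<open>N\<close> is zero.\<close>

locale truncated_powers =
  fixes n :: nat and enc :: "'k::field fps \<Rightarrow> ('x + ('k \<Rightarrow> 'k)) list"
    and E :: "('x + ('k \<Rightarrow> 'k)) list ring" and N
  assumes enc_def: "enc = trunc_enc n" and E_def: "E = trunc_ring n"
    and N_def: "N = enc ` {f. fps_nth f 0 = 0 \<and> fps_nth f 1 = 0}"
begin

lemma enc_eq: "enc f = enc g \<longleftrightarrow> (\<forall>i\<le>n. fps_nth f i = fps_nth g i)"
  by (simp add: enc_def trunc_enc_eq)

lemma truncated_ring_simps [simp]: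
  "carrier (E) = range (enc)" "\<one>\<^bsub>E\<^esub> = enc 1" "\<zero>\<^bsub>E\<^esub> = enc 0"
  "enc f \<otimes>\<^bsub>E\<^esub> enc g = enc (f * g)"
  "enc f \<oplus>\<^bsub>E\<^esub> enc g = enc (f + g)"
  by (simp_all add: E_def trunc_ring_def enc_def trunc_enc_mult trunc_enc_add)

lemma E_cring: "cring (E)"
proof (rule cringI)
  show "abelian_group (E)"
  proof (rule abelian_groupI)
    fix x assume "x \<in> carrier (E)"
    then obtain f where "x = enc f" by auto
    then show "\<exists>y\<in>carrier (E). y \<oplus>\<^bsub>E\<^esub> x = \<zero>\<^bsub>E\<^esub>"
      by (intro bexI[of _ "enc (- f)"]) auto
  qed (auto simp: algebra_simps)
  show "comm_monoid (E)"
    by (rule comm_monoidI) (auto simp: algebra_simps)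
qed (auto simp: algebra_simps)

lemma E_minus: "enc f \<ominus>\<^bsub>E\<^esub> enc g = enc (f - g)"
proof -
  interpret cring "E" by (rule E_cring)
  have "\<ominus>\<^bsub>E\<^esub> enc g = enc (- g)"
    by (rule minus_equality) auto
  then show ?thesis unfolding a_minus_def by simp
qed

lemma N_ideal: "ideal (N) (E)"
proof -
  interpret cring "E" by (rule E_cring)
  show ?thesis
  proof (rule idealI)
    show "subgroup (N) (add_monoid (E))"
    proof (rule group.subgroupI)
      show "Group.group (add_monoid (E))" by (rule a_group)
      fix x assume "x \<in> N"
      then obtain f where f: "x = enc f" "fps_nth f 0 = 0" "fps_nth f 1 = 0"
        by (auto simp: N_def)
      then have "\<ominus>\<^bsub>E\<^esub> x = enc (- f)"
        by (intro minus_equality) auto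
      with f show "inv\<^bsub>add_monoid (E)\<^esub> x \<in> N"
        by (auto simp: N_def a_inv_def)
    next
      fix x y assume "x \<in> N" "y \<in> N"
      then obtain f g where "x = enc f" "fps_nth f 0 = 0" "fps_nth f 1 = 0"
         "y = enc g" "fps_nth g 0 = 0" "fps_nth g 1 = 0"
        by (auto simp: N_def)
      then show "x \<otimes>\<^bsub>add_monoid (E)\<^esub> y \<in> N"
        by (auto simp: N_def)
    qed (auto simp: N_def intro: exI[of _ 0])
  next
    fix x y assume "x \<in> N" "y \<in> carrier (E)"
    then obtain f g where "x = enc f" "fps_nth f 0 = 0" "fps_nth f 1 = 0" "y = enc g"
        by (auto simp: N_def)
    then show "y \<otimes>\<^bsub>E\<^esub> x \<in> N" and "x \<otimes>\<^bsub>E\<^esub> y \<in> N"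
      by (auto simp: N_def fps_mult_nth)
  qed (rule ring_axioms)
qed

lemma coset_eq: "N +>\<^bsub>E\<^esub> enc f = N +>\<^bsub>E\<^esub> enc g
    \<longleftrightarrow> (\<forall>i\<le>n. i \<le> 1 \<longrightarrow> fps_nth f i = fps_nth g i)"
proof -
  interpret cring "E" by (rule E_cring)
  have "N +>\<^bsub>E\<^esub> enc f = N +>\<^bsub>E\<^esub> enc g
    \<longleftrightarrow> enc (f - g) \<in> N"
    using quotient_eq_iff_same_a_r_cos[OF N_ideal, of "enc f" "enc g"]
    by (simp add: E_minus)
  also have "\<dots> \<longleftrightarrow> (\<forall>i\<le>n. i \<le> 1 \<longrightarrow> fps_nth f i = fps_nth g i)"
  proof
    assume "enc (f - g) \<in> N"
    then obtain h where h: "\<forall>i\<le>n. fps_nth (f - g) i = fps_nth h i" "fps_nth h 0 = 0" "fps_nth h 1 = 0"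
      unfolding N_def by (auto simp only: enc_eq image_iff mem_Collect_eq)
    show "\<forall>i\<le>n. i \<le> 1 \<longrightarrow> fps_nth f i = fps_nth g i"
    proof (intro allI impI)
      fix i assume "i \<le> n" "i \<le> (1::nat)"
      with h show "fps_nth f i = fps_nth g i" by (cases "i = 0") (auto simp: le_Suc_eq)
    qed
  next
    assume *: "\<forall>i\<le>n. i \<le> 1 \<longrightarrow> fps_nth f i = fps_nth g i"
    \<comment> \<open>For n = 0 the series f - g may have a nonzero coefficient at 1, which
      \<open>enc\<close> ignores; \<open>h\<close> clears it.\<close>
    define h where "h = Abs_fps (\<lambda>i. if i \<le> 1 then 0 else fps_nth (f - g) i)"
    have "enc (f - g) = enc h" using * by (auto simp: enc_eq h_def)
    then show "enc (f - g) \<in> N" by (auto simp: N_def h_def)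
  qed
  finally show ?thesis .
qed

text \<open>A zero constant term in each factor already puts the k-th power into the multiples of
  \<open>t^k\<close>, which is enough at k = n + 1.\<close>

lemma N_nilpotent: "ideal_power (E) (N) (Suc n) = {\<zero>\<^bsub>E\<^esub>}"
proof -
  have "ideal_power (E) (N) k \<subseteq> enc ` {f. \<forall>i<k. fps_nth f i = 0}" for k
  proof (induction k)
    case (Suc k)
    show ?case
    proof
      fix x assume "x \<in> ideal_power (E) (N) (Suc k)"
      then have "x \<in> ideal_prod (E) (N) (ideal_power (E) (N) k)" by simp
      then show "x \<in> enc ` {f. \<forall>i<Suc k. fps_nth f i = 0}"
      proof (induction rule: ideal_prod.induct)
        case (prod i j)
        from prod(1) obtain f where "i = enc f" "fps_nth f 0 = 0" by (auto simp: N_def)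
        moreover from prod(2) Suc obtain g where "j = enc g" and g: "\<forall>i<k. fps_nth g i = 0" by auto
        moreover have "fps_nth (f * g) i = 0" if "i < Suc k" for i
          unfolding fps_mult_nth
        proof (intro sum.neutral ballI)
          fix j assume "j \<in> {0..i}"
          then show "fps_nth f j * fps_nth g (i - j) = 0"
            using that g \<open>fps_nth f 0 = 0\<close> by (cases "j = 0") auto
        qed
        ultimately show ?case by auto
      next
        case (sum x y)
        then show ?case by (auto simp: image_iff) (metis (no_types, lifting) add_0 fps_add_nth)
      qed
    qed
  qed auto
  from this[of "Suc n"] have "ideal_power (E) (N) (Suc n) \<subseteq> {\<zero>\<^bsub>E\<^esub>}"
    by (auto simp: enc_eq less_Suc_eq_le simp del: ideal_power.simps)
  moreover have "\<zero>\<^bsub>E\<^esub> \<in> ideal_power (E) (N) k" for k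
  proof (induction k)
    case (Suc k)
    have "\<zero>\<^bsub>E\<^esub> \<in> N" by (auto simp: N_def)
    from ideal_prod.prod[OF this Suc, of E] show ?case by simp
  qed auto
  ultimately show ?thesis by blast
qed

end

section \<open>Lifting first-order data at the coaugmentation to curves\<close>

context conil_coalg
begin

abbreviation dring where "dring \<equiv> dual_ring s Co"

lemma dring_simps: "carrier dring = A" "\<one>\<^bsub>dring\<^esub> = \<epsilon>" "\<phi> \<otimes>\<^bsub>dring\<^esub> \<psi> = \<phi> \<star> \<psi>" "\<phi> \<oplus>\<^bsub>dring\<^esub> \<psi> = \<phi> + \<psi>"
  by (simp_all add: dual_ring_def \<epsilon>_def plus_fun_def)

lemma m_plus: "\<phi> \<in> \<m> \<Longrightarrow> \<psi> \<in> \<m> \<Longrightarrow> \<phi> + \<psi> \<in> \<m>"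
  using dual_plus[of \<phi> s C \<psi>] m_u[of \<phi>] m_u[of \<psi>] m_A[of \<phi>] m_A[of \<psi>] 
  unfolding dual_max_ideal_def[of s Co] mem_Collect_eq plus_fun_apply by simp

lemma ideal_prod_m: "\<phi> \<in> ideal_prod dring \<m> J \<Longrightarrow> J \<subseteq> A \<Longrightarrow> \<phi> \<in> \<m>"
proof (induction rule: ideal_prod.induct)
  case (sum x y)
  then show ?case unfolding dring_simps(4) by (intro m_plus)
qed (auto simp: dring_simps m_mul)

lemma m_squared_prim:
  assumes "\<phi> \<in> ideal_prod dring \<m> \<m>" "x \<in> P"
  shows "\<phi> x = 0"
  using assms(1)
  by (induction rule: ideal_prod.induct) (auto simp: dring_simps prim_mul[OF assms(2)] m_A m_u)

text \<open>The Leibniz rule makes \<open>tan\<close> multiplicative modulo \<open>t^2\<close>, and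
  smoothness lifts it across the nilpotent ideal \<open>N\<close>. The identities are stated for i
  <= n because \<open>w\<close> decodes truncated series; \<open>M\<close> expresses continuity of
  the lift.\<close>

lemma curve_lift:
  assumes smooth: "formally_smooth (dual_ring (*) ground_coalg) (dual_max_ideal (*) ground_coalg) dring \<m> (pullback C (counit Co))"
    and x: "x \<in> P"
  obtains w :: "('v \<Rightarrow> 'k) \<Rightarrow> 'k fps" and M where
    "\<And>\<phi> \<psi> i. \<phi> \<in> A \<Longrightarrow> \<psi> \<in> A \<Longrightarrow> i \<le> n \<Longrightarrow> fps_nth (w (\<phi> + \<psi>)) i = fps_nth (w \<phi> + w \<psi>) i"
    "\<And>\<phi> \<psi> i. \<phi> \<in> A \<Longrightarrow> \<psi> \<in> A \<Longrightarrow> i \<le> n \<Longrightarrow> fps_nth (w (\<phi> \<star> \<psi>)) i = fps_nth (w \<phi> * w \<psi>) i"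
    "\<And>\<phi> a i. \<phi> \<in> A \<Longrightarrow> i \<le> n \<Longrightarrow> fps_nth (w (fscale a \<phi>)) i = a * fps_nth (w \<phi>) i"
    "\<And>i. i \<le> n \<Longrightarrow> fps_nth (w \<epsilon>) i = fps_nth 1 i"
    "\<And>\<phi>. \<phi> \<in> A \<Longrightarrow> fps_nth (w \<phi>) 0 = \<phi> \<u>"
    "\<And>\<phi>. \<phi> \<in> A \<Longrightarrow> 1 \<le> n \<Longrightarrow> fps_nth (w \<phi>) 1 = \<phi> x"
    "\<And>\<phi> i. \<phi> \<in> ideal_power dring \<m> M \<Longrightarrow> i \<le> n \<Longrightarrow> fps_nth (w \<phi>) i = 0"
proof -
  define E :: "(('v \<Rightarrow> 'k) + ('k \<Rightarrow> 'k)) list ring" where "E = trunc_ring n"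
  define enc :: "'k fps \<Rightarrow> (('v \<Rightarrow> 'k) + ('k \<Rightarrow> 'k)) list" where "enc = trunc_enc n"
  define N where "N = enc ` {f. fps_nth f 0 = 0 \<and> fps_nth f 1 = 0}"
  interpret T: truncated_powers n enc E N by standard (simp_all add: E_def enc_def N_def)
  \<comment> \<open>A functional b on the ground field is multiplication by b(1), so this is the
    scalar structure map.\<close>
  define e :: "('k \<Rightarrow> 'k) \<Rightarrow> (('v \<Rightarrow> 'k) + ('k \<Rightarrow> 'k)) list" where "e b = enc (fps_const (b 1))" for b
  define tan where "tan \<phi> = fps_const (\<phi> \<u>) + fps_const (\<phi> x) * fps_X" for \<phi> :: "'v \<Rightarrow> 'k"
  have tan: "fps_nth (tan \<phi>) i = (if i = 0 then \<phi> \<u> else if i = 1 then \<phi> x else 0)" for \<phi> i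
    by (simp add: tan_def)
  define u where "u \<phi> = N +>\<^bsub>E\<^esub> enc (tan \<phi>)" for \<phi>
  define k where "k = (ground_coalg :: ('k, 'k) coalg)"
  define f :: "('k \<Rightarrow> 'k) \<Rightarrow> 'v \<Rightarrow> 'k" where "f = pullback C (counit Co)"
  interpret E: cring E by (rule T.E_cring)
  interpret N: ideal N E by (rule T.N_ideal)
  have xC: "x \<in> C" using x by (rule prim_C)
  have carr: "enc g \<in> carrier E" for g by simp
  have kmul: "conv k b c 1 = b 1 * c 1" if "b \<in> dual (*) UNIV" "c \<in> dual (*) UNIV" for b c
    using that by (simp add: conv_def k_def ground_coalg_def zero_ext_def pure_tensor_def)
  have kr: "carrier (dual_ring (*) k) = dual (*) UNIV" "dual_max_ideal (*) k = {b \<in> dual (*) UNIV. b 1 = 0}"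
    "\<one>\<^bsub>dual_ring (*) k\<^esub> 1 = 1" "(b \<otimes>\<^bsub>dual_ring (*) k\<^esub> c) = conv k b c"
    "(b \<oplus>\<^bsub>dual_ring (*) k\<^esub> c) 1 = b 1 + c 1" for b c
    by (simp_all add: dual_ring_def dual_max_ideal_def k_def ground_coalg_def zero_ext_def)
  have e: "e \<in> ring_hom (dual_ring (*) k) E"
    by (rule ring_hom_memI) (simp_all add: e_def kr kmul)
  have "e b = \<zero>\<^bsub>E\<^esub>" if "b \<in> ideal_power (dual_ring (*) k) (dual_max_ideal (*) k) 1" for b
  proof -
    from that have "b \<in> ideal_prod (dual_ring (*) k) (dual_max_ideal (*) k) (carrier (dual_ring (*) k))" by simp
    then have "b 1 = 0"
      by (induction rule: ideal_prod.induct) (auto simp: kr kmul)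
    then show ?thesis by (simp add: e_def)
  qed
  then have e_cont: "adic_cont (dual_ring (*) k) (dual_max_ideal (*) k) E e"
    unfolding adic_cont_def by blast
  have u_eq: "u \<phi> = N +>\<^bsub>E\<^esub> enc g \<longleftrightarrow> (\<forall>i\<le>n. i \<le> 1 \<longrightarrow> fps_nth (tan \<phi>) i = fps_nth g i)" for \<phi> g
    unfolding u_def by (rule T.coset_eq)
  have u: "u \<in> ring_hom dring (E Quot N)"
  proof (rule ring_hom_memI)
    fix \<phi> assume "\<phi> \<in> carrier dring"
    show "u \<phi> \<in> carrier (E Quot N)"
      unfolding u_def by (simp add: FactRing_def E.a_rcosetsI[OF N.a_subset] carr)
  next
    fix \<phi> \<psi> assume A: "\<phi> \<in> carrier dring" "\<psi> \<in> carrier dring"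
    have "u (\<phi> \<otimes>\<^bsub>dring\<^esub> \<psi>) = N +>\<^bsub>E\<^esub> enc (tan \<phi> * tan \<psi>)"
      unfolding u_eq using A
      by (auto simp: tan dring_simps mul_u prim_mul[OF x] fps_mult_nth le_Suc_eq)
    then show "u (\<phi> \<otimes>\<^bsub>dring\<^esub> \<psi>) = u \<phi> \<otimes>\<^bsub>E Quot N\<^esub> u \<psi>"
      unfolding u_def by (simp add: FactRing_def N.rcoset_mult_add carr)
    have "u (\<phi> \<oplus>\<^bsub>dring\<^esub> \<psi>) = N +>\<^bsub>E\<^esub> enc (tan \<phi> + tan \<psi>)"
      unfolding u_eq using A by (auto simp: tan dring_simps)
    then show "u (\<phi> \<oplus>\<^bsub>dring\<^esub> \<psi>) = u \<phi> \<oplus>\<^bsub>E Quot N\<^esub> u \<psi>"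
      unfolding u_def by (simp add: FactRing_def N.a_rcos_sum carr)
  next
    have "u \<one>\<^bsub>dring\<^esub> = N +>\<^bsub>E\<^esub> enc 1"
      unfolding u_eq using prim_counit[OF x] by (auto simp: tan dring_simps eps_u eps_apply xC)
    then show "u \<one>\<^bsub>dring\<^esub> = \<one>\<^bsub>E Quot N\<^esub>" by (simp add: FactRing_def)
  qed
  \<comment> \<open>Continuity with exponent 2: a product of two elements of \<m> vanishes at
    \<open>\<u>\<close> and at the primitive \<open>x\<close>.\<close>
  have "u \<phi> = \<zero>\<^bsub>E Quot N\<^esub>" if "\<phi> \<in> ideal_power dring \<m> 2" for \<phi>
  proof -
    have "\<phi> \<in> ideal_prod dring \<m> (ideal_prod dring \<m> A)"
      using that by (simp add: numeral_2_eq_2 dring_simps)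
    then have "\<phi> \<in> ideal_prod dring \<m> \<m>"
    proof (induction rule: ideal_prod.induct)
      case (prod i j)
      then show ?case by (auto intro: ideal_prod.prod ideal_prod_m)
    qed (auto intro: ideal_prod.sum)
    then have "\<phi> x = 0" "\<phi> \<u> = 0"
      using m_squared_prim[OF _ x] ideal_prod_m[of \<phi> \<m>] m_u m_A by auto
    then have "u \<phi> = N +>\<^bsub>E\<^esub> enc 0" unfolding u_eq by (simp add: tan)
    then show ?thesis using N.a_rcos_const[OF N.zero_closed] by (simp add: FactRing_def)
  qed
  then have u_cont: "adic_cont dring \<m> (E Quot N) u" unfolding adic_cont_def by blast
  have f_A: "f b \<in> A" "f b = fscale (b 1) \<epsilon>" if "b \<in> dual (*) UNIV" for b
  proof -
    have "b (counit Co y) = b 1 * counit Co y" for y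
      using dual_scale[OF that, of 1 "counit Co y"] by simp
    then show "f b = fscale (b 1) \<epsilon>" by (auto simp: f_def pullback_def zero_ext_def fun_eq_iff fscale_apply \<epsilon>_def)
    then show "f b \<in> A" by (simp add: dual_fscale eps_A)
  qed
  have compat: "\<forall>b\<in>carrier (dual_ring (*) k). u (f b) = N +>\<^bsub>E\<^esub> e b"
    unfolding e_def u_eq using prim_counit[OF x]
    by (auto simp: tan kr f_A fscale_apply eps_u eps_apply xC)
  have nil: "\<exists>n. ideal_power E N n = {\<zero>\<^bsub>E\<^esub>}" using T.N_nilpotent by blast
  obtain v where v: "v \<in> ring_hom dring E" "adic_cont dring \<m> E v"
      "\<And>b. b \<in> carrier (dual_ring (*) k) \<Longrightarrow> v (f b) = e b" "\<And>\<phi>. \<phi> \<in> A \<Longrightarrow> u \<phi> = N +>\<^bsub>E\<^esub> v \<phi>"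
    using smooth[unfolded formally_smooth_def, folded k_def f_def, rule_format, of E N e u]
      E.cring_axioms N.ideal_axioms nil e e_cont u u_cont compat by (auto simp: dring_simps)
  obtain M where M: "\<And>\<phi>. \<phi> \<in> ideal_power dring \<m> M \<Longrightarrow> v \<phi> = \<zero>\<^bsub>E\<^esub>"
    using v(2) unfolding adic_cont_def by blast
  define w where "w \<phi> = trunc_dec (v \<phi>)" for \<phi>
  have dec: "fps_nth (trunc_dec (enc g)) i = fps_nth g i" if "i \<le> n" for g i
    using that by (simp add: enc_def trunc_dec_enc)
  have vw: "v \<phi> = enc (w \<phi>)" if "\<phi> \<in> A" for \<phi>
    using ring_hom_closed[OF v(1), of \<phi>] that
    by (auto simp: dring_simps w_def T.enc_eq dec)
  have w_iff: "fps_nth (w \<phi>) i = fps_nth g i" if "v \<phi> = enc g" "i \<le> n" for \<phi> g i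
    using that by (simp add: w_def dec)
  have w_add: "v (\<phi> + \<psi>) = enc (w \<phi> + w \<psi>)" if "\<phi> \<in> A" "\<psi> \<in> A" for \<phi> \<psi>
    using ring_hom_add[OF v(1), of \<phi> \<psi>] that by (simp add: dring_simps vw dual_plus)
  have w_mul: "v (\<phi> \<star> \<psi>) = enc (w \<phi> * w \<psi>)" if "\<phi> \<in> A" "\<psi> \<in> A" for \<phi> \<psi>
    using ring_hom_mult[OF v(1), of \<phi> \<psi>] that by (simp add: dring_simps vw mul_A)
  \<comment> \<open>Ring homomorphisms carry no scalars. Linearity over the field is recovered from
    \<open>e\<close>, by writing \<open>fscale a \<phi>\<close> as the product of
    \<open>fscale a \<epsilon>\<close> and \<phi>.\<close>
  have w_const: "v (fscale a \<epsilon>) = enc (fps_const a)" for a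
  proof -
    have "(\<lambda>c. a * c) \<in> dual (*) UNIV" by (auto simp: dual_def linear_on_def algebra_simps)
    then show ?thesis using v(3)[of "\<lambda>c. a * c"] f_A(2)[of "\<lambda>c. a * c"]
      by (simp add: kr e_def)
  qed
  show thesis
  proof (rule that[of w M])
    fix \<phi> a i assume \<phi>: "\<phi> \<in> A" and i: "i \<le> n"
    have "fscale a \<phi> = fscale a \<epsilon> \<star> \<phi>" using \<phi> by (simp add: mul_scale_left eps_A mul_eps)
    then have "v (fscale a \<phi>) = enc (w (fscale a \<epsilon>) * w \<phi>)"
      using \<phi> by (simp add: w_mul dual_fscale eps_A)
    also have "\<dots> = enc (fps_const a * w \<phi>)"
      using w_iff[OF w_const] by (auto simp: T.enc_eq fps_mult_nth intro!: sum.cong)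
    finally show "fps_nth (w (fscale a \<phi>)) i = a * fps_nth (w \<phi>) i"
      using w_iff i by fastforce
  next
    fix i assume "i \<le> n"
    have "v \<epsilon> = enc 1" using ring_hom_one[OF v(1)] by (simp add: dring_simps)
    then show "fps_nth (w \<epsilon>) i = fps_nth 1 i" using \<open>i \<le> n\<close> by (rule w_iff)
  next
    fix \<phi> assume \<phi>: "\<phi> \<in> A"
    have *: "\<forall>i\<le>n. i \<le> 1 \<longrightarrow> fps_nth (tan \<phi>) i = fps_nth (w \<phi>) i"
      using v(4)[OF \<phi>] unfolding vw[OF \<phi>] u_eq .
    then show "fps_nth (w \<phi>) 0 = \<phi> \<u>" by (auto simp: tan)
    assume "1 \<le> n"
    then show "fps_nth (w \<phi>) 1 = \<phi> x" using *[rule_format, of 1] by (auto simp: tan)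
  next
    fix \<phi> i assume "\<phi> \<in> ideal_power dring \<m> M" "i \<le> n"
    then show "fps_nth (w \<phi>) i = 0" using w_iff[of \<phi> 0 i] M[of \<phi>] by simp
  qed (use w_iff w_add w_mul in blast)+
qed

end


section \<open>Polarization\<close>

text \<open>\<open>T\<close> and \<open>insert i T\<close> contribute with opposite signs. The
  values are vectors because the lemma serves both scalar sums in \<open>polarization\<close> and
  sums of simplicial operators.\<close>

lemma sum_Pow_toggle:
  assumes "vector_space s" "finite S" "i \<in> S" "\<And>T. T \<subseteq> S \<Longrightarrow> i \<notin> T \<Longrightarrow> g (insert i T) = g T"
  shows "(\<Sum>T\<in>Pow S. s ((-1) ^ card T) (g T)) = 0"
proof -
  interpret vector_space s by fact
  define S' where "S' = S - {i}"
  have S: "S = insert i S'" "i \<notin> S'" "finite S'" using assms by (auto simp: S'_def)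
  have inj: "inj_on (insert i) (Pow S')" using S by (intro inj_onI) (metis Diff_insert_absorb PowD subset_iff)
  have "(\<Sum>T\<in>Pow S. s ((-1) ^ card T) (g T))
      = (\<Sum>T\<in>Pow S'. s ((-1) ^ card T) (g T)) + (\<Sum>T\<in>insert i ` Pow S'. s ((-1) ^ card T) (g T))"
    unfolding S(1) Pow_insert using S by (intro sum.union_disjoint) auto
  also have "(\<Sum>T\<in>insert i ` Pow S'. s ((-1) ^ card T) (g T)) = (\<Sum>T\<in>Pow S'. - s ((-1) ^ card T) (g T))"
    unfolding sum.reindex[OF inj]
  proof (rule sum.cong[OF refl])
    fix T assume "T \<in> Pow S'"
    then have "i \<notin> T" "finite T" "g (insert i T) = g T" using S assms(4)[of T] by (auto intro: finite_subset)
    then show "((\<lambda>T. s ((-1) ^ card T) (g T)) \<circ> insert i) T = - s ((-1) ^ card T) (g T)" by simp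
  qed
  finally show ?thesis by (simp add: sum_negf)
qed

text \<open>Ryser's formula for the permanent. The product expands over the maps from S to S whose
  image avoids T; inclusion-exclusion over T leaves the surjective ones, which are the
  permutations.\<close>

lemma polarization:
  fixes a :: "'i \<Rightarrow> 'i \<Rightarrow> 'k::field"
  assumes S: "finite S"
  shows "(\<Sum>T\<in>Pow S. (-1) ^ card T * (\<Prod>i\<in>S. \<Sum>j\<in>S - T. a i j)) = (\<Sum>p | p permutes S. \<Prod>i\<in>S. a i (p i))"
proof -
  have "(\<Sum>T\<in>Pow S. (-1) ^ card T * (\<Prod>i\<in>S. \<Sum>j\<in>S - T. a i j))
    = (\<Sum>T\<in>Pow S. \<Sum>f\<in>S \<rightarrow>\<^sub>E S. (-1) ^ card T * (if f ` S \<subseteq> S - T then \<Prod>i\<in>S. a i (f i) else 0))"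
  proof (rule sum.cong[OF refl])
    fix T assume T: "T \<in> Pow S"
    have "(\<Prod>i\<in>S. \<Sum>j\<in>S - T. a i j) = (\<Sum>f\<in>S \<rightarrow>\<^sub>E (S - T). \<Prod>i\<in>S. a i (f i))"
      using S by (intro prod_sum_PiE) auto
    also have "\<dots> = (\<Sum>f\<in>{f \<in> S \<rightarrow>\<^sub>E S. f ` S \<subseteq> S - T}. \<Prod>i\<in>S. a i (f i))"
      by (rule sum.cong) (auto simp: PiE_iff extensional_def)
    also have "\<dots> = (\<Sum>f\<in>S \<rightarrow>\<^sub>E S. if f ` S \<subseteq> S - T then \<Prod>i\<in>S. a i (f i) else 0)"
      using S by (subst sum.inter_filter) (auto intro: finite_PiE)
    finally show "(-1) ^ card T * (\<Prod>i\<in>S. \<Sum>j\<in>S - T. a i j)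
      = (\<Sum>f\<in>S \<rightarrow>\<^sub>E S. (-1) ^ card T * (if f ` S \<subseteq> S - T then \<Prod>i\<in>S. a i (f i) else 0))"
      by (simp add: sum_distrib_left)
  qed
  also have "\<dots> = (\<Sum>f\<in>S \<rightarrow>\<^sub>E S. \<Sum>T\<in>Pow S. (-1) ^ card T * (if f ` S \<subseteq> S - T then \<Prod>i\<in>S. a i (f i) else 0))"
    by (rule sum.swap)
  also have "\<dots> = (\<Sum>f\<in>S \<rightarrow>\<^sub>E S. if f ` S = S then \<Prod>i\<in>S. a i (f i) else 0)"
  proof (rule sum.cong[OF refl])
    fix f assume f: "f \<in> S \<rightarrow>\<^sub>E S"
    show "(\<Sum>T\<in>Pow S. (-1) ^ card T * (if f ` S \<subseteq> S - T then \<Prod>i\<in>S. a i (f i) else 0))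
      = (if f ` S = S then \<Prod>i\<in>S. a i (f i) else 0)"
    proof (cases "f ` S = S")
      case True
      have "(\<Sum>T\<in>Pow S. (-1) ^ card T * (if f ` S \<subseteq> S - T then \<Prod>i\<in>S. a i (f i) else 0))
        = (\<Sum>T\<in>{{}}. (-1) ^ card T * (if f ` S \<subseteq> S - T then \<Prod>i\<in>S. a i (f i) else 0))"
        using S True by (intro sum.mono_neutral_right) auto
      with True show ?thesis by simp
    next
      case False
      with f obtain j where j: "j \<in> S" "j \<notin> f ` S" by auto
      have "f ` S \<subseteq> S - insert j T \<longleftrightarrow> f ` S \<subseteq> S - T" for T using j by auto
      then show ?thesis using False j S
        by (subst sum_Pow_toggle[OF vector_space_times, of S j]) auto
    qed
  qed
  also have "\<dots> = (\<Sum>f\<in>{f \<in> S \<rightarrow>\<^sub>E S. f ` S = S}. \<Prod>i\<in>S. a i (f i))"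
    using S by (subst sum.inter_filter) (auto intro: finite_PiE)
  also have "\<dots> = (\<Sum>p | p permutes S. \<Prod>i\<in>S. a i (p i))"
  \<comment> \<open>The two index sets differ in the default outside S: \<open>undefined\<close> for
    extensional functions, the identity for permutations.\<close>
  proof (rule sum.reindex_bij_witness[of _ "\<lambda>p. restrict p S" "\<lambda>f i. if i \<in> S then f i else i"])
    fix f assume f: "f \<in> {f \<in> S \<rightarrow>\<^sub>E S. f ` S = S}"
    show "restrict (\<lambda>i. if i \<in> S then f i else i) S = f"
      using f by (auto simp: fun_eq_iff PiE_iff extensional_def)
    have "inj_on f S" using f S by (auto intro: eq_card_imp_inj_on)
    then have "bij_betw (\<lambda>i. if i \<in> S then f i else i) S S"
      using f by (auto simp: bij_betw_def inj_on_def image_iff)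
    then show "(\<lambda>i. if i \<in> S then f i else i) \<in> {p. p permutes S}"
      by (auto intro: bij_imp_permutes)
    show "(\<Prod>i\<in>S. a i (if i \<in> S then f i else i)) = (\<Prod>i\<in>S. a i (f i))" by simp
  next
    fix p assume p: "p \<in> {p. p permutes S}"
    then show "(\<lambda>i. if i \<in> S then restrict p S i else i) = p"
      by (auto simp: fun_eq_iff permutes_def)
    show "restrict p S \<in> {f \<in> S \<rightarrow>\<^sub>E S. f ` S = S}"
      using p permutes_image[of p S] permutes_in_image[of p S] by auto
  qed
  finally show ?thesis .
qed

context finite_basis
begin

text \<open>The symmetrization of a word is a combination of powers, and \<open>n!\<close> times a symmetric form is a
  combination of symmetrized words.\<close>

lemma symmetric_in_span_powers:
  fixes f :: "('v \<Rightarrow> 'k) list \<Rightarrow> 'k"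
  assumes f: "multilin s V f" and sym: "\<And>\<phi>s \<psi>s. mset \<phi>s = mset \<psi>s \<Longrightarrow> f \<phi>s = f \<psi>s"
    and char: "(of_nat (fact n) :: 'k) \<noteq> 0"
  shows "(\<lambda>\<phi>s. if length \<phi>s = n then f \<phi>s else 0)
    \<in> Modules.module.span fscale {word s V (replicate n x) | x. x \<in> V}"
proof -
  interpret f: vector_space fscale by (rule vector_space_fscale)
  define S where "S = {..<n}"
  \<comment> \<open>T collects positions rather than letters, so that repeated letters of
    \<open>ws\<close> are kept apart.\<close>
  define pow where "pow ws T = word s V (replicate n (\<Sum>i\<in>S - T. ws ! i))" for ws T
  define g where "g = (\<Sum>ws\<in>words n. fscale (f (map \<beta> ws)) (\<Sum>T\<in>Pow S. fscale ((-1) ^ card T) (pow ws T)))"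
  have wsV: "ws ! j \<in> V" if "ws \<in> words n" "j < n" for ws j
  proof -
    have "ws ! j \<in> set ws" "set ws \<subseteq> B" using that by (auto simp: words_def)
    then show ?thesis using BV by blast
  qed
  have perm_sum: "(\<Sum>T\<in>Pow S. (-1) ^ card T * pow ws T \<phi>s) = (\<Sum>p | p permutes S. word s V ws (map (\<lambda>i. \<phi>s ! p i) [0..<n]))"
    if ws: "ws \<in> words n" and \<phi>s: "length \<phi>s = n" "set \<phi>s \<subseteq> dual s V" for ws \<phi>s
  proof -
    have len: "length ws = n" using ws by (simp add: words_def)
    have "pow ws T \<phi>s = (\<Prod>i\<in>S. \<Sum>j\<in>S - T. (\<phi>s ! i) (ws ! j))" for T
    proof -
      have "(\<phi>s ! i) (\<Sum>j\<in>S - T. ws ! j) = (\<Sum>j\<in>S - T. (\<phi>s ! i) (ws ! j))" if "i < n" for i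
      proof (rule linear_on_sum[OF vector_space_axioms vector_space_times subV dual_linear_on])
        show "\<phi>s ! i \<in> dual s V" using \<phi>s that by auto
      qed (use wsV[OF ws] in \<open>auto simp: S_def\<close>)
      then show ?thesis using \<phi>s by (simp add: pow_def word_def zero_ext_def S_def)
    qed
    then have "(\<Sum>T\<in>Pow S. (-1) ^ card T * pow ws T \<phi>s) = (\<Sum>p | p permutes S. \<Prod>i\<in>S. (\<phi>s ! i) (ws ! p i))"
      using polarization[of S "\<lambda>i j. (\<phi>s ! i) (ws ! j)"] by (simp add: S_def)
    \<comment> \<open>Passing to inverses moves the permutation from the letters to the arguments,
      where the symmetry of \<open>f\<close> can absorb it.\<close>
    also have "\<dots> = (\<Sum>p | p permutes S. \<Prod>i\<in>S. (\<phi>s ! i) (ws ! inv_into UNIV p i))"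
      by (rule sum_permutations_inverse)
    also have "\<dots> = (\<Sum>p | p permutes S. word s V ws (map (\<lambda>i. \<phi>s ! p i) [0..<n]))"
    proof (rule sum.cong[OF refl])
      fix p assume "p \<in> {p. p permutes S}"
      then have p: "p permutes S" by simp
      have "(\<Prod>i\<in>S. (\<phi>s ! i) (ws ! inv_into UNIV p i)) = (\<Prod>i\<in>S. (\<phi>s ! p i) (ws ! inv_into UNIV p (p i)))"
        by (rule prod.permute[OF p, unfolded o_def])
      also have "\<dots> = (\<Prod>i\<in>S. (\<phi>s ! p i) (ws ! i))" using p by (simp add: permutes_inverses)
      also have "\<dots> = word s V ws (map (\<lambda>i. \<phi>s ! p i) [0..<n])"
        using \<phi>s len permutes_in_image[OF p] by (auto simp: word_def zero_ext_def S_def subset_iff)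
      finally show "(\<Prod>i\<in>S. (\<phi>s ! i) (ws ! inv_into UNIV p i)) = word s V ws (map (\<lambda>i. \<phi>s ! p i) [0..<n])" .
    qed
    finally show ?thesis .
  qed
  have g: "g \<phi>s = (if length \<phi>s = n then of_nat (fact n) * f \<phi>s else 0)" for \<phi>s
  proof (cases "length \<phi>s = n \<and> set \<phi>s \<subseteq> dual s V")
    case True
    then have "g \<phi>s = (\<Sum>ws\<in>words n. f (map \<beta> ws) * (\<Sum>T\<in>Pow S. (-1) ^ card T * pow ws T \<phi>s))"
      by (simp add: g_def sum_apply fscale_apply)
    also have "\<dots> = (\<Sum>ws\<in>words n. f (map \<beta> ws) * (\<Sum>p | p permutes S. word s V ws (map (\<lambda>i. \<phi>s ! p i) [0..<n])))"
      using True by (intro sum.cong refl arg_cong2[of _ _ _ _ "(*)"] perm_sum) auto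
    also have "\<dots> = (\<Sum>p | p permutes S. \<Sum>ws\<in>words n. word s V ws (map (\<lambda>i. \<phi>s ! p i) [0..<n]) * f (map \<beta> ws))"
      unfolding sum_distrib_left by (subst sum.swap) (simp add: mult.commute)
    also have "\<dots> = (\<Sum>p | p permutes S. f (map (\<lambda>i. \<phi>s ! p i) [0..<n]))"
      by (intro sum.cong refl multilin_expand[OF f, symmetric]) simp
    also have "\<dots> = (\<Sum>p | p permutes S. f \<phi>s)"
    proof (intro sum.cong refl sym)
      fix p assume "p \<in> {p. p permutes S}"
      then have "p permutes {..<length \<phi>s}" using True by (simp add: S_def)
      from mset_permute_list[OF this] show "mset (map (\<lambda>i. \<phi>s ! p i) [0..<n]) = mset \<phi>s"
        using True by (simp add: permute_list_def)
    qed
    also have "\<dots> = of_nat (fact n) * f \<phi>s"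
      using card_permutations[of S n] by (simp add: S_def)
    finally show ?thesis using True by simp
  next
    case False
    then have "pow ws T \<phi>s = 0" for ws T by (auto simp: pow_def word_def zero_ext_def)
    with False show ?thesis
      by (auto simp: g_def sum_apply fscale_apply multilin_outside[OF f])
  qed
  have "g \<in> f.span {word s V (replicate n x) | x. x \<in> V}"
    unfolding g_def pow_def
  proof (intro f.span_sum f.span_scale f.span_base)
    fix ws T assume "ws \<in> words n" "T \<in> Pow S"
    then have "(\<Sum>i\<in>S - T. ws ! i) \<in> V"
      using wsV by (intro subspace_sum[OF subV]) (auto simp: S_def)
    then show "word s V (replicate n (\<Sum>i\<in>S - T. ws ! i)) \<in> {word s V (replicate n x) | x. x \<in> V}"
      by blast
  qed
  then have "fscale (inverse (of_nat (fact n))) g \<in> f.span {word s V (replicate n x) | x. x \<in> V}"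
    by (rule f.span_scale)
  moreover have "fscale (inverse (of_nat (fact n))) g = (\<lambda>\<phi>s. if length \<phi>s = n then f \<phi>s else 0)"
    using char by (auto simp: fun_eq_iff fscale_apply g)
  ultimately show ?thesis by simp
qed

end


section \<open>Surjectivity for formal manifolds\<close>

locale smooth_coalg = retracted_coalg s Co B \<beta> R
  for s :: "'k::field_char_0 \<Rightarrow> 'v::ab_group_add \<Rightarrow> 'v" and Co B \<beta> R +
  assumes smooth: "formally_smooth (dual_ring (*) ground_coalg) (dual_max_ideal (*) ground_coalg)
    dring \<m> (pullback C (counit Co))"
begin

definition monom where "monom w = lprod (map Rs (map \<beta> w))"

lemma monom_A: "monom w \<in> A"
  by (simp add: monom_def lprod_A)

lemma beta_words: "w \<in> words n \<Longrightarrow> set (map \<beta> w) \<subseteq> D" "w \<in> words n \<Longrightarrow> length (map \<beta> w) = n"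
  using beta by (auto simp: words_def)

lemma form_monom: "w \<in> words n \<Longrightarrow> form v (map \<beta> w) = v (monom w)"
  using beta_words by (auto simp: form_def monom_def)

text \<open>Any \<open>g\<close> is allowed because the zeroth power is the whole ring. The lemma is
  applied to the terms produced by \<open>annihilator_expand\<close>.\<close>

lemma ideal_power_lprod:
  assumes "set \<phi>s \<subseteq> \<m>" "g \<in> A" "k \<le> length \<phi>s"
  shows "lprod \<phi>s \<star> g \<in> ideal_power dring \<m> k"
  using assms
proof (induction \<phi>s arbitrary: k)
  case Nil
  then show ?case by (simp add: dring_simps mul_A)
next
  case (Cons \<phi> \<phi>s)
  then have eq: "lprod (\<phi> # \<phi>s) \<star> g = \<phi> \<star> (lprod \<phi>s \<star> g)" by (simp add: mul_assoc m_A lprod_A)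
  show ?case
  proof (cases k)
    case 0
    then show ?thesis by (simp add: dring_simps mul_A)
  next
    case (Suc j)
    with Cons have "lprod \<phi>s \<star> g \<in> ideal_power dring \<m> j" by auto
    then have "\<phi> \<otimes>\<^bsub>dring\<^esub> (lprod \<phi>s \<star> g) \<in> ideal_power dring \<m> (Suc j)"
      using Cons.prems by (auto intro: ideal_prod.prod)
    then show ?thesis using Suc eq by (simp add: dring_simps)
  qed
qed

text \<open>A functional which vanishes on the elements killed by \<open>\<m>\<^sup>M\<close> factors through contraction with
  the monomials of degree \<open>M\<close>.\<close>

lemma annihilator_expand:
  assumes p: "p \<in> A" "\<And>c. c \<in> C \<Longrightarrow> killed M c \<Longrightarrow> p c = 0" and M: "M \<ge> 1"
  obtains g where "\<And>w. g w \<in> A" "p = (\<Sum>w\<in>words M. monom w \<star> g w)"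
proof -
  \<comment> \<open>The finitely many contractions with monomials of degree \<open>M\<close> are
    packed into one linear map, so that \<open>functional_factors\<close> applies.\<close>
  define \<delta> where "\<delta> c = (\<lambda>w. if w \<in> words M then contract (monom w) c else 0)" for c
  define t where "t = (\<lambda>a (f :: 'v list \<Rightarrow> 'v) i. s a (f i))"
  have t: "vector_space t" unfolding t_def by (rule vector_space_pointwise[OF vs])
  interpret t: vector_space t by (rule t)
  have \<delta>: "linear_on s t C \<delta>"
    using contract_linear[OF monom_A] by (auto simp: linear_on_def \<delta>_def t_def fun_eq_iff)
  \<comment> \<open>A monomial of length at least \<open>M\<close> has a prefix of length
    \<open>M\<close>, so \<open>\<delta> c = 0\<close> makes \<open>Phi c\<close> vanish in these
    degrees, and \<open>Phi_killed\<close> gives orthogonality.\<close>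
  have ker: "p c = 0" if c: "c \<in> C" and \<delta>0: "\<delta> c = 0" for c
  proof (rule p(2)[OF c], rule Phi_killed[OF c M])
    fix \<phi>s :: "('v \<Rightarrow> 'k) list" assume len: "M \<le> length \<phi>s"
    have "Phi c (map \<beta> w) = 0" if w: "w \<in> words (length \<phi>s)" for w
    proof -
      define w1 where "w1 = take M w"
      have w1: "w1 \<in> words M" and sets: "set (map \<beta> (drop M w)) \<subseteq> D" "set (map \<beta> w1) \<subseteq> D"
        using w len set_take_subset[of M w] set_drop_subset[of M w] beta by (auto simp: words_def w1_def)
      have "monom w = monom w1 \<star> monom (drop M w)"
        using map_Rs(2)[OF sets(2)]
        by (subst append_take_drop_id[of M w, symmetric])
           (simp only: monom_def map_append lprod_append w1_def)
      also have "\<dots> = monom (drop M w) \<star> monom w1" by (simp add: mul_comm monom_A)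
      finally have "Phi c (map \<beta> w) = monom (drop M w) (contract (monom w1) c)"
        using form_monom[OF w] c by (simp add: Phi_def contract monom_A)
      also have "contract (monom w1) c = 0" using fun_cong[OF \<delta>0, of w1] w1 by (simp add: \<delta>_def)
      finally show ?thesis
        using linear_on_zero[OF vs vector_space_times subC dual_linear_on[OF monom_A]] by simp
    qed
    then show "Phi c \<phi>s = 0" using multilin_expand[OF Phi_multilin refl, of c \<phi>s] by simp
  qed
  obtain G where G: "Vector_Spaces.linear t (*) G" "\<And>c. c \<in> C \<Longrightarrow> p c = G (\<delta> c)"
    using functional_factors[OF vs t subC \<delta> dual_linear_on[OF p(1)] ker] by blast
  \<comment> \<open>Functions supported at one word split \<open>G\<close> into components, which
    become the cofactors \<open>g w\<close>.\<close>
  define single where "single w y = (\<lambda>w'. if w' = w then y else 0)" for w :: "'v list" and y :: 'v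
  define g where "g w = zero_ext C (\<lambda>y. G (single w y))" for w
  have G': "G (x + y) = G x + G y" "G (t a x) = a * G x" for x y a
    using G(1) by (auto simp: Vector_Spaces.linear_iff)
  have single: "single w (x + y) = single w x + single w y" "single w (s a x) = t a (single w x)" for w x y a
    by (auto simp: single_def t_def fun_eq_iff)
  have g: "g w \<in> A" for w
    unfolding g_def by (rule zero_ext_in_dual[OF vs subC]) (auto simp: linear_on_def single G')
  have "p = (\<Sum>w\<in>words M. monom w \<star> g w)"
  proof (rule dual_eqI[OF p(1)])
    fix c assume c: "c \<in> C"
    have "\<delta> c = (\<Sum>w\<in>words M. single w (contract (monom w) c))"
      using finite_words by (auto simp: sum_apply fun_eq_iff single_def \<delta>_def)
    then have "p c = (\<Sum>w\<in>words M. G (single w (contract (monom w) c)))"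
      using G c linear_on_sum[OF t vector_space_times t.subspace_UNIV, of G]
      by (auto simp: linear_on_def G')
    also have "\<dots> = (\<Sum>w\<in>words M. g w (contract (monom w) c))"
      using c by (simp add: g_def zero_ext_def contract_C monom_A)
    also have "\<dots> = (\<Sum>w\<in>words M. monom w \<star> g w) c"
      using c g by (simp add: sum_apply contract monom_A mul_comm)
    finally show "p c = (\<Sum>w\<in>words M. monom w \<star> g w) c" .
  qed (intro dual_sum mul_A)
  with g that show thesis by blast
qed

lemma Phi_image_subspace: "Modules.module.subspace fscale (Phi ` C)"
proof -
  interpret f: vector_space fscale by (rule vector_space_fscale)
  show ?thesis
  proof (rule f.subspaceI)
    show "0 \<in> Phi ` C"
      using linear_on_zero[OF vs vector_space_fscale subC Phi_linear] C_0 by force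
  next
    fix x y assume "x \<in> Phi ` C" "y \<in> Phi ` C"
    then obtain a b where *: "a \<in> C" "b \<in> C" "x = Phi a" "y = Phi b" by auto
    then have "x + y = Phi (a + b)" using Phi_linear by (auto simp: linear_on_def)
    then show "x + y \<in> Phi ` C" using * C_add by blast
  next
    fix c x assume "x \<in> Phi ` C"
    then obtain a where *: "a \<in> C" "x = Phi a" by auto
    then have "fscale c x = Phi (s c a)" using Phi_linear by (auto simp: linear_on_def)
    then show "fscale c x \<in> Phi ` C" using * C_scale by blast
  qed
qed

lemma subspace_A: "Modules.module.subspace fscale A"
proof -
  interpret f: vector_space fscale by (rule vector_space_fscale)
  show ?thesis by (intro f.subspaceI dual_zero dual_plus dual_fscale)
qed

text \<open>Otherwise some \<open>l\<close> separates the form from the image. Its values on words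
  are the coefficients of an element \<open>p\<close> of \<open>A\<close> with
  \<open>p c = l (Phi c)\<close> whenever \<open>killed M c\<close>, and with
  \<open>v p = l (form v) = 1\<close>. By the first property and \<open>annihilator_expand\<close>,
  \<open>p\<close> is a combination of monomials of degree \<open>M\<close>, so continuity forces
  \<open>v p = 0\<close>.\<close>

lemma form_in_image:
  assumes v: "linear_on fscale (*) A v" and cont: "\<And>\<phi>. \<phi> \<in> ideal_power dring \<m> M0 \<Longrightarrow> v \<phi> = 0"
    and bounded: "\<And>\<phi>s. N \<le> length \<phi>s \<Longrightarrow> form v \<phi>s = 0"
  shows "form v \<in> Phi ` C"
proof (rule ccontr)
  assume "form v \<notin> Phi ` C"
  then obtain l where l: "Vector_Spaces.linear fscale (*) l" "\<And>t. t \<in> Phi ` C \<Longrightarrow> l t = 0" "l (form v) = 1"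
    using separating_functional[OF vector_space_fscale Phi_image_subspace] by metis
  interpret f: vector_space fscale by (rule vector_space_fscale)
  \<comment> \<open>Beyond the continuity exponent and the degree bound of the form, and positive as
    \<open>annihilator_expand\<close> requires.\<close>
  define M where "M = Suc (max M0 N)"
  have vsum: "v (\<Sum>i\<in>I. F i) = (\<Sum>i\<in>I. v (F i))" if "\<And>i. i \<in> I \<Longrightarrow> F i \<in> A" for I :: "'i set" and F
    by (rule linear_on_sum[OF vector_space_fscale vector_space_times subspace_A v that])
  have lsum: "l (\<Sum>i\<in>I. F i) = (\<Sum>i\<in>I. l (F i))" for I :: "'i set" and F
    using l(1) by (intro linear_on_sum[OF vector_space_fscale vector_space_times f.subspace_UNIV])
      (auto simp: linear_on_def Vector_Spaces.linear_iff)
  have lscale: "l (fscale a x) = a * l x" for a x using l(1) by (simp add: Vector_Spaces.linear_iff)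
  define lam where "lam w = l (word s P w)" for w
  have l_expand: "l h = (\<Sum>n<M. \<Sum>w\<in>words n. h (map \<beta> w) * lam w)"
    if "multilin s P h" "\<And>\<phi>s. M \<le> length \<phi>s \<Longrightarrow> h \<phi>s = 0" for h
    by (subst multilin_bounded_expand[OF that, of M]) (simp_all add: lsum lscale lam_def)
  define p where "p = (\<Sum>n<M. \<Sum>w\<in>words n. fscale (lam w) (monom w))"
  have pA: "p \<in> A" unfolding p_def by (intro dual_sum dual_fscale monom_A)
  have p0: "p c = 0" if c: "c \<in> C" "killed M c" for c
  proof -
    have "p c = (\<Sum>n<M. \<Sum>w\<in>words n. Phi c (map \<beta> w) * lam w)"
      by (simp add: p_def sum_apply fscale_apply Phi_def form_monom mult.commute)
    also have "\<dots> = l (Phi c)"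
      using killed_Phi[OF c(2)] by (intro l_expand[symmetric] Phi_multilin) (auto simp: M_def)
    finally show ?thesis using l(2) c by simp
  qed
  obtain g where g: "\<And>w. g w \<in> A" "p = (\<Sum>w\<in>words M. monom w \<star> g w)"
    using annihilator_expand[OF pA p0] by (auto simp: M_def)
  have "monom w \<star> g w \<in> ideal_power dring \<m> M0" if "w \<in> words M" for w
    unfolding monom_def using beta_words[OF that] map_Rs(1)[OF beta_words(1)[OF that]] g(1)
    by (intro ideal_power_lprod) (auto simp: M_def)
  then have "v p = 0" unfolding g(2) by (subst vsum) (auto simp: mul_A cont)
  moreover have "v p = (\<Sum>n<M. \<Sum>w\<in>words n. form v (map \<beta> w) * lam w)"
    using v unfolding p_def
    by (simp add: vsum dual_sum dual_fscale monom_A linear_on_def form_monom mult.commute)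
  moreover have "\<dots> = l (form v)"
    using v bounded by (intro l_expand[symmetric] form_multilin) (auto simp: linear_on_def M_def)
  ultimately show False using l(3) by simp
qed

text \<open>Along the curve a coordinate \<open>Rs \<phi>\<close> becomes \<phi>(x) t plus higher
  terms, so a product of k coordinates starts at \<open>t^k\<close> with the product of the values
  at x as coefficient. This determines the coefficient at n on products of length at least n;
  shorter ones are not controlled.\<close>

lemma power_lift:
  assumes x: "x \<in> P"
  obtains c where "c \<in> C" "\<And>\<phi>s. n \<le> length \<phi>s \<Longrightarrow> Phi c \<phi>s = word s P (replicate n x) \<phi>s"
proof -
  obtain w :: "('v \<Rightarrow> 'k) \<Rightarrow> 'k fps" and M where
    w_add: "\<And>\<phi> \<psi> i. \<phi> \<in> A \<Longrightarrow> \<psi> \<in> A \<Longrightarrow> i \<le> n \<Longrightarrow> fps_nth (w (\<phi> + \<psi>)) i = fps_nth (w \<phi> + w \<psi>) i" and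
    w_mul: "\<And>\<phi> \<psi> i. \<phi> \<in> A \<Longrightarrow> \<psi> \<in> A \<Longrightarrow> i \<le> n \<Longrightarrow> fps_nth (w (\<phi> \<star> \<psi>)) i = fps_nth (w \<phi> * w \<psi>) i" and
    w_scale: "\<And>\<phi> a i. \<phi> \<in> A \<Longrightarrow> i \<le> n \<Longrightarrow> fps_nth (w (fscale a \<phi>)) i = a * fps_nth (w \<phi>) i" and
    w_eps: "\<And>i. i \<le> n \<Longrightarrow> fps_nth (w \<epsilon>) i = fps_nth 1 i" and
    w_0: "\<And>\<phi>. \<phi> \<in> A \<Longrightarrow> fps_nth (w \<phi>) 0 = \<phi> \<u>" and
    w_1: "\<And>\<phi>. \<phi> \<in> A \<Longrightarrow> 1 \<le> n \<Longrightarrow> fps_nth (w \<phi>) 1 = \<phi> x" and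
    w_cont: "\<And>\<phi> i. \<phi> \<in> ideal_power dring \<m> M \<Longrightarrow> i \<le> n \<Longrightarrow> fps_nth (w \<phi>) i = 0"
    using curve_lift[OF smooth x, of n] by blast
  have coeff: "(\<forall>i\<le>n. i < length \<phi>s \<longrightarrow> fps_nth (w (lprod (map Rs \<phi>s))) i = 0) \<and>
      (length \<phi>s \<le> n \<longrightarrow> fps_nth (w (lprod (map Rs \<phi>s))) (length \<phi>s) = word s P (replicate (length \<phi>s) x) \<phi>s)"
    if "set \<phi>s \<subseteq> D" for \<phi>s
    using that
  proof (induction \<phi>s)
    case Nil
    then show ?case by (simp add: w_eps word_simps)
  next
    case (Cons \<phi> \<phi>s)
    let ?f = "w (Rs \<phi>)" and ?g = "w (lprod (map Rs \<phi>s))"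
    have \<phi>: "\<phi> \<in> D" "Rs \<phi> \<in> A" "Rs \<phi> \<u> = 0" "Rs \<phi> x = \<phi> x"
      using Cons.prems Rs_A m_u[OF Rs_m] x by (auto simp: Rs_apply prim_C R_id)
    have mul: "fps_nth (w (lprod (map Rs (\<phi> # \<phi>s)))) i = (\<Sum>j=0..i. fps_nth ?f j * fps_nth ?g (i - j))" if "i \<le> n" for i
      using that \<phi> by (simp add: w_mul lprod_A fps_mult_nth)
    have f0: "fps_nth ?f 0 = 0" using \<phi> by (simp add: w_0)
    have g0: "fps_nth ?g i = 0" if "i \<le> n" "i < length \<phi>s" for i
      using Cons that by auto
    show ?case
    proof (intro conjI allI impI)
      fix i assume i: "i \<le> n" "i < length (\<phi> # \<phi>s)"
      have "fps_nth ?f j * fps_nth ?g (i - j) = 0" if "j \<in> {0..i}" for j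
        using that i f0 g0[of "i - j"] by (cases "j = 0") auto
      then show "fps_nth (w (lprod (map Rs (\<phi> # \<phi>s)))) i = 0"
        unfolding mul[OF i(1)] by (rule sum.neutral[OF ballI])
    next
      assume len: "length (\<phi> # \<phi>s) \<le> n"
      let ?L = "Suc (length \<phi>s)"
      \<comment> \<open>The index j = 0 meets the zero constant term of \<open>?f\<close>, and j >=
        2 leaves an index below the order of \<open>?g\<close>.\<close>
      have "(\<Sum>j=0..?L. fps_nth ?f j * fps_nth ?g (?L - j)) = (\<Sum>j\<in>{1}. fps_nth ?f j * fps_nth ?g (?L - j))"
      proof (rule sum.mono_neutral_right)
        show "\<forall>j\<in>{0..?L} - {1}. fps_nth ?f j * fps_nth ?g (?L - j) = 0"
        proof
          fix j assume "j \<in> {0..?L} - {1}"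
          then have "j = 0 \<or> ?L - j < length \<phi>s" by auto
          then show "fps_nth ?f j * fps_nth ?g (?L - j) = 0"
            using f0 g0[of "?L - j"] len by auto
        qed
      qed auto
      also have "\<dots> = \<phi> x * word s P (replicate (length \<phi>s) x) \<phi>s"
        using w_1[OF \<phi>(2)] \<phi>(4) len Cons by simp
      finally show "fps_nth (w (lprod (map Rs (\<phi> # \<phi>s)))) (length (\<phi> # \<phi>s))
          = word s P (replicate (length (\<phi> # \<phi>s)) x) (\<phi> # \<phi>s)"
        using mul[of ?L] len \<phi> by (simp add: word_simps del: lprod_simps)
    qed
  qed
  define v where "v \<phi> = fps_nth (w \<phi>) n" for \<phi>
  have v: "linear_on fscale (*) A v"
    using w_add[of _ _ n] w_scale[of _ n] by (auto simp: linear_on_def v_def)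
  have fv: "form v \<phi>s = word s P (replicate n x) \<phi>s" if "n \<le> length \<phi>s" for \<phi>s
  proof (cases "set \<phi>s \<subseteq> D")
    case True
    then show ?thesis
      using coeff[OF True] that by (cases "n = length \<phi>s") (auto simp: form_def v_def word_simps(5))
  qed (auto simp: form_def word_simps(6))
  have "form v \<in> Phi ` C"
  proof (rule form_in_image[OF v])
    show "v \<phi> = 0" if "\<phi> \<in> ideal_power dring \<m> M" for \<phi>
      using w_cont[OF that] by (simp add: v_def)
    show "form v \<phi>s = 0" if "Suc n \<le> length \<phi>s" for \<phi>s
      using fv[of \<phi>s] that by (simp add: word_simps(5))
  qed
  then obtain c where "c \<in> C" "form v = Phi c" by blast
  with fv that show thesis by metis
qed

text \<open>Induction on a degree bound. The top component is a combination of powers, each lifted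
  by \<open>power_lift\<close>; whatever the lifts do in lower degrees is left to the induction
  hypothesis.\<close>

lemma Phi_surj: "Phi ` C = sym_tensors s P"
proof
  show "Phi ` C \<subseteq> sym_tensors s P" using Phi_sym_tensors by blast
  interpret f: vector_space fscale by (rule vector_space_fscale)
  have "t \<in> Phi ` C" if "t \<in> sym_tensors s P" "\<And>\<phi>s. N \<le> length \<phi>s \<Longrightarrow> t \<phi>s = 0" for t N
    using that
  proof (induction N arbitrary: t)
    case 0
    then have "t = 0" by (simp add: fun_eq_iff)
    then show ?case using f.subspace_0[OF Phi_image_subspace] by (simp only:)
  next
    case (Suc n)
    have ml: "multilin s P t" and sym: "\<And>\<phi>s \<psi>s. mset \<phi>s = mset \<psi>s \<Longrightarrow> t \<phi>s = t \<psi>s"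
      using Suc.prems(1) tensor_space_multilin(1) unfolding sym_tensors_def by blast+
    define tn where "tn = (\<lambda>\<phi>s. if length \<phi>s = n then t \<phi>s else 0)"
    have "tn \<in> f.span {word s P (replicate n x) | x. x \<in> P}"
      unfolding tn_def by (rule symmetric_in_span_powers[OF ml sym]) simp_all
    then have "\<exists>c\<in>C. \<forall>\<phi>s. n \<le> length \<phi>s \<longrightarrow> Phi c \<phi>s = tn \<phi>s"
    proof (induction rule: f.span_induct_alt)
      case base
      show ?case using linear_on_zero[OF vs vector_space_fscale subC Phi_linear] C_0
        by (intro bexI[of _ 0]) auto
    next
      case (step a x y)
      then obtain z c where z: "z \<in> P" "x = word s P (replicate n z)"
        and c: "c \<in> C" "\<forall>\<phi>s. n \<le> length \<phi>s \<longrightarrow> Phi c \<phi>s = y \<phi>s" by auto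
      obtain d where d: "d \<in> C" "\<And>\<phi>s. n \<le> length \<phi>s \<Longrightarrow> Phi d \<phi>s = word s P (replicate n z) \<phi>s"
        using power_lift[OF z(1)] by blast
      have "Phi (s a d + c) = fscale a (Phi d) + Phi c"
        using Phi_linear c d C_scale by (simp add: linear_on_def)
      with c d z show ?case
        by (intro bexI[of _ "s a d + c"]) (auto simp: fscale_apply C_add C_scale)
    qed
    then obtain c where c: "c \<in> C" "\<forall>\<phi>s. n \<le> length \<phi>s \<longrightarrow> Phi c \<phi>s = tn \<phi>s" by blast
    have "t - Phi c \<in> Phi ` C"
    proof (rule Suc.IH)
      show "t - Phi c \<in> sym_tensors s P"
        by (rule f.subspace_diff[OF sym_tensors_subspace Suc.prems(1) Phi_sym_tensors[OF c(1)]])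
      show "(t - Phi c) \<phi>s = 0" if "n \<le> length \<phi>s" for \<phi>s
        using c(2) that Suc.prems(2)[of \<phi>s] by (auto simp: tn_def)
    qed
    then have "(t - Phi c) + Phi c \<in> Phi ` C"
      using c(1) by (intro f.subspace_add[OF Phi_image_subspace]) auto
    then show ?case by simp
  qed
  then show "sym_tensors s P \<subseteq> Phi ` C"
    using tensor_space_multilin(2) unfolding sym_tensors_def by blast
qed

end


section \<open>Natural retractions of almost simplicial spaces\<close>

definition decr :: "nat \<Rightarrow> nat set \<Rightarrow> nat \<Rightarrow> nat" where
  "decr n S = (\<lambda>j\<in>{..n}. if j \<in> S then j - 1 else j)"

definition coface :: "nat \<Rightarrow> nat \<Rightarrow> nat \<Rightarrow> nat" where
  "coface n i = (\<lambda>j\<in>{..n}. if j < i then j else Suc j)"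

text \<open>The codegeneracy usually numbered i - 1: it identifies i - 1 with i. For i >= 1 it fixes
  0 and is a left inverse of \<open>coface n i\<close>.\<close>

definition codegen :: "nat \<Rightarrow> nat \<Rightarrow> nat \<Rightarrow> nat" where
  "codegen n i = (\<lambda>j\<in>{..Suc n}. if j < i then j else j - 1)"

lemma Delta_plus_iff:
  "\<alpha> \<in> Delta_plus m n \<longleftrightarrow> \<alpha> \<in> extensional {..m} \<and> (\<forall>i\<le>m. \<alpha> i \<le> n) \<and>
    (\<forall>i j. i \<le> j \<and> j \<le> m \<longrightarrow> \<alpha> i \<le> \<alpha> j) \<and> \<alpha> 0 = 0"
  by (auto simp: Delta_plus_def Delta_def PiE_iff monotone_on_def)

lemma Delta_plus_Delta: "\<alpha> \<in> Delta_plus m n \<Longrightarrow> \<alpha> \<in> Delta m n"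
  by (simp add: Delta_plus_def)

lemma decr_Delta_plus: "S \<subseteq> {1..n} \<Longrightarrow> decr n S \<in> Delta_plus n n"
proof -
  have "(if i \<in> S then i - 1 else i) \<le> (if j \<in> S then j - 1 else j)" if "i \<le> j" for i j
    using that by (cases "i = j") auto
  then show ?thesis by (auto simp: Delta_plus_iff decr_def)
qed

lemma coface_Delta_plus: "1 \<le> i \<Longrightarrow> coface n i \<in> Delta_plus n (Suc n)"
  by (auto simp: Delta_plus_iff coface_def)

lemma codegen_Delta_plus: "1 \<le> i \<Longrightarrow> i \<le> Suc n \<Longrightarrow> codegen n i \<in> Delta_plus (Suc n) n"
  by (auto simp: Delta_plus_iff codegen_def)

lemma compose_Delta_plus:
  "\<beta> \<in> Delta_plus l m \<Longrightarrow> \<alpha> \<in> Delta_plus m n \<Longrightarrow> compose {..l} \<alpha> \<beta> \<in> Delta_plus l n"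
  by (auto simp: Delta_plus_iff compose_def)

lemma decr_empty: "decr n {} = (\<lambda>i\<in>{..n}. i)"
  by (simp add: decr_def)

text \<open>The two operators differ only at i, which \<beta> never takes as a value.\<close>

lemma compose_decr_avoid:
  assumes "\<beta> \<in> Delta_plus m n" "i \<notin> \<beta> ` {..m}"
  shows "compose {..m} (decr n (insert i S)) \<beta> = compose {..m} (decr n S) \<beta>"
  using assms by (auto simp: compose_def decr_def fun_eq_iff Delta_plus_iff)

text \<open>The two operators differ only at i, with values i - 1 and i, which \<gamma>
  identifies.\<close>

lemma compose_decr_collapse:
  assumes "\<gamma> i = \<gamma> (i - 1)" "i \<notin> S"
  shows "compose {..n} \<gamma> (decr n (insert i S)) = compose {..n} \<gamma> (decr n S)"
  using assms by (auto simp: compose_def decr_def fun_eq_iff)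

text \<open>Cardinality yields a missed value, which is positive because 0 is attained.\<close>

lemma Delta_plus_avoid:
  assumes "\<beta> \<in> Delta_plus m n" "m < n"
  obtains i where "i \<in> {1..n}" "i \<notin> \<beta> ` {..m}"
proof -
  have "card (\<beta> ` {..m}) \<le> card {..m}" by (rule card_image_le) simp
  with assms have "card (\<beta> ` {..m}) < card {..n}" by simp
  then have "\<not> {..n} \<subseteq> \<beta> ` {..m}"
    using card_mono[of "\<beta> ` {..m}" "{..n}"] by auto
  then obtain i where i: "i \<le> n" "i \<notin> \<beta> ` {..m}" by auto
  have "0 \<in> \<beta> ` {..m}" using assms by (force simp: Delta_plus_iff)
  then have "i \<noteq> 0" using i by metis
  with i show thesis by (intro that[of i]) auto
qed

lemma strict_lower:
  assumes "\<alpha> \<in> Delta_plus m n" "\<And>i. i \<in> {1..m} \<Longrightarrow> \<alpha> i \<noteq> \<alpha> (i - 1)" "j \<le> m"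
  shows "j \<le> \<alpha> j"
  using assms(3)
proof (induction j)
  case (Suc j)
  have "\<alpha> j \<le> \<alpha> (Suc j)" "\<alpha> (Suc j) \<noteq> \<alpha> j"
    using assms(1) assms(2)[of "Suc j"] Suc.prems by (auto simp: Delta_plus_iff)
  with Suc show ?case by simp
qed simp

text \<open>Without a repeated value \<gamma> is strictly increasing, so \<gamma>(j) >= j and m >=
  n. For m = n, descending from the top gives the reverse inequality and leaves the
  identity.\<close>

lemma Delta_plus_collapse:
  assumes "\<gamma> \<in> Delta_plus n m" "m < n \<or> m = n \<and> \<gamma> \<noteq> (\<lambda>i\<in>{..n}. i)"
  obtains i where "i \<in> {1..n}" "\<gamma> i = \<gamma> (i - 1)"
proof (rule ccontr)
  assume "\<not> thesis"
  with that have *: "\<And>i. i \<in> {1..n} \<Longrightarrow> \<gamma> i \<noteq> \<gamma> (i - 1)" by blast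
  have low: "j \<le> \<gamma> j" if "j \<le> n" for j by (rule strict_lower[OF assms(1) * that])
  have "\<gamma> n \<le> m" using assms(1) by (simp add: Delta_plus_iff)
  then have mn: "m = n" using assms(2) low[of n] by auto
  have "\<gamma> j \<le> j" if "j \<le> n" for j
    using that
  proof (induction rule: inc_induct)
    case base
    then show ?case using assms(1) mn by (auto simp: Delta_plus_iff)
  next
    case (step j)
    have "\<gamma> j \<le> \<gamma> (Suc j)" "\<gamma> (Suc j) \<noteq> \<gamma> j"
      using assms(1) *[of "Suc j"] step.hyps by (auto simp: Delta_plus_iff)
    with step.IH show ?case by simp
  qed
  with low have "\<gamma> j = j" if "j \<le> n" for j using that by (simp add: le_antisym)
  then have "\<gamma> = (\<lambda>i\<in>{..n}. i)"
    using assms(1) by (auto simp: Delta_plus_iff fun_eq_iff extensional_def)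
  with assms(2) mn show False by simp
qed

text \<open>Passing through \<open>codegen n i\<close> and back by \<open>coface n i\<close> moves i
  to i - 1 and nothing else, and \<gamma> identifies these two.\<close>

lemma collapse_factor:
  assumes "\<gamma> \<in> Delta_plus (Suc n) m" "i \<in> {1..Suc n}" "\<gamma> i = \<gamma> (i - 1)"
  shows "compose {..Suc n} (compose {..n} \<gamma> (coface n i)) (codegen n i) = \<gamma>"
proof
  fix j
  show "compose {..Suc n} (compose {..n} \<gamma> (coface n i)) (codegen n i) j = \<gamma> j"
  proof (cases "j \<le> Suc n")
    case True
    consider "j < i" | "j = i" | "i < j" by linarith
    then show ?thesis
      using True assms(2,3) by cases (auto simp: compose_def coface_def codegen_def)
  qed (use assms in \<open>auto simp: compose_def Delta_plus_iff extensional_def\<close>)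
qed

definition decr_residue where "decr_residue n S = compose {..Suc n} (codegen n (Max S)) (decr (Suc n) S)"

text \<open>\<open>Max S\<close> is not a value of \<open>decr (Suc n) S\<close>: it is lowered
  itself and nothing above it is. Hence the operator factors through the coface at
  \<open>Max S\<close>, and so through degree n.\<close>

lemma decr_factor:
  assumes "S \<subseteq> {1..Suc n}" "S \<noteq> {}"
  shows "compose {..Suc n} (coface n (Max S)) (decr_residue n S) = decr (Suc n) S"
    "decr_residue n S \<in> Delta_plus (Suc n) n" "Max S \<ge> 1"
proof -
  have fin: "finite S" using assms finite_subset by blast
  have "Max S \<in> S" by (rule Max_in[OF fin assms(2)])
  moreover from this assms(1) have "Max S \<in> {1..Suc n}" by blast
  ultimately have Max: "Max S \<in> S" "Max S \<ge> 1" "Max S \<le> Suc n" by auto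
  then show "Max S \<ge> 1" by simp
  show "decr_residue n S \<in> Delta_plus (Suc n) n"
    unfolding decr_residue_def using Max assms
    by (intro compose_Delta_plus[OF decr_Delta_plus codegen_Delta_plus])
  show "compose {..Suc n} (coface n (Max S)) (decr_residue n S) = decr (Suc n) S"
  proof
    fix j
    show "compose {..Suc n} (coface n (Max S)) (decr_residue n S) j = decr (Suc n) S j"
    proof (cases "j \<le> Suc n")
      case True
      let ?v = "if j \<in> S then j - 1 else j"
      have "?v \<noteq> Max S"
      proof
        assume eq: "?v = Max S"
        with Max have "j \<in> S" by (auto split: if_splits)
        then have "j \<le> Max S" "j \<ge> 1" using fin assms by auto
        with eq \<open>j \<in> S\<close> show False by simp
      qed
      then show ?thesis using True Max
        by (auto simp: compose_def decr_residue_def decr_def codegen_def coface_def split: if_splits)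
    qed (auto simp: compose_def decr_def)
  qed
qed

text \<open>\<open>W\<close> will be the underlying spaces of the coalgebras, \<open>V\<close> their
  primitives and \<open>e\<close> the coaugmentations. Only linear data are kept; \<open>a_e\<close>
  allows a natural retraction to kill \<open>e\<close>.\<close>

locale almost_simplicial_space = vector_space s
  for s :: "'k::field \<Rightarrow> 'v::ab_group_add \<Rightarrow> 'v" +
  fixes W V :: "nat \<Rightarrow> 'v set" and a :: "nat \<Rightarrow> nat \<Rightarrow> (nat \<Rightarrow> nat) \<Rightarrow> 'v \<Rightarrow> 'v" and e :: "nat \<Rightarrow> 'v"
  assumes subW: "subspace (W n)" and subV: "subspace (V n)" and VW: "V n \<subseteq> W n"
    and a_lin: "\<alpha> \<in> Delta_plus m n \<Longrightarrow> linear_on s s (W n) (a m n \<alpha>)"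
    and a_W: "\<alpha> \<in> Delta_plus m n \<Longrightarrow> x \<in> W n \<Longrightarrow> a m n \<alpha> x \<in> W m"
    and a_V: "\<alpha> \<in> Delta_plus m n \<Longrightarrow> x \<in> V n \<Longrightarrow> a m n \<alpha> x \<in> V m"
    and a_id: "x \<in> W n \<Longrightarrow> a n n (\<lambda>i\<in>{..n}. i) x = x"
    and a_comp: "\<beta> \<in> Delta_plus l m \<Longrightarrow> \<alpha> \<in> Delta_plus m n \<Longrightarrow> x \<in> W n \<Longrightarrow>
      a l n (compose {..l} \<alpha> \<beta>) x = a l m \<beta> (a m n \<alpha> x)"
    and e_V: "e n \<notin> V n"
    and a_e: "\<alpha> \<in> Delta_plus m n \<Longrightarrow> a m n \<alpha> (e n) = e m"
begin

lemmas vs = vector_space_axioms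

text \<open>In a suitable order, the product of the operators \<open>1 - s_{i-1} d_i\<close> for i
  >= 1 multiplies out to this sum.\<close>

definition norm_part where
  "norm_part n x = (\<Sum>S\<in>Pow {1..n}. s ((-1) ^ card S) (a n n (decr n S) x))"

lemma a_sum: "\<alpha> \<in> Delta_plus m n \<Longrightarrow> (\<And>i. i \<in> I \<Longrightarrow> x i \<in> W n) \<Longrightarrow> a m n \<alpha> (\<Sum>i\<in>I. x i) = (\<Sum>i\<in>I. a m n \<alpha> (x i))"
  by (rule linear_on_sum[OF vs vs subW a_lin])

lemma a_scale: "\<alpha> \<in> Delta_plus m n \<Longrightarrow> x \<in> W n \<Longrightarrow> a m n \<alpha> (s c x) = s c (a m n \<alpha> x)"
  and a_add: "\<alpha> \<in> Delta_plus m n \<Longrightarrow> x \<in> W n \<Longrightarrow> y \<in> W n \<Longrightarrow> a m n \<alpha> (x + y) = a m n \<alpha> x + a m n \<alpha> y"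
  using a_lin by (auto simp: linear_on_def)

lemma norm_part_W: "x \<in> W n \<Longrightarrow> norm_part n x \<in> W n"
  unfolding norm_part_def by (intro subspace_sum[OF subW] subspace_scale[OF subW] a_W decr_Delta_plus) auto

lemma norm_part_V: "x \<in> V n \<Longrightarrow> norm_part n x \<in> V n"
  unfolding norm_part_def by (intro subspace_sum[OF subV] subspace_scale[OF subV] a_V decr_Delta_plus) auto

lemma norm_part_lin: "linear_on s s (W n) (norm_part n)"
  unfolding linear_on_def norm_part_def
  by (auto simp: a_add a_scale decr_Delta_plus scale_right_distrib sum.distrib scale_sum_right mult.commute
      intro!: sum.cong)

lemma norm_part_expand:
  assumes "x \<in> W n"
  shows "norm_part n x = x + (\<Sum>S\<in>Pow {1..n} - {{}}. s ((-1) ^ card S) (a n n (decr n S) x))"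
  unfolding norm_part_def using assms by (subst sum.remove[of _ "{}"]) (auto simp: decr_empty a_id)

lemma a_norm_part:
  assumes "\<beta> \<in> Delta_plus m n" "m < n" "x \<in> W n"
  shows "a m n \<beta> (norm_part n x) = 0"
proof -
  obtain i where i: "i \<in> {1..n}" "i \<notin> \<beta> ` {..m}" using Delta_plus_avoid[OF assms(1,2)] .
  have "a m n \<beta> (norm_part n x) = (\<Sum>S\<in>Pow {1..n}. s ((-1) ^ card S) (a m n (compose {..m} (decr n S) \<beta>) x))"
    unfolding norm_part_def using assms
    by (subst a_sum) (auto simp: a_scale a_comp decr_Delta_plus a_W intro!: subspace_scale[OF subW] sum.cong)
  also have "\<dots> = 0"
    by (rule sum_Pow_toggle[OF vs _ i(1)]) (auto simp: compose_decr_avoid[OF assms(1) i(2)])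
  finally show ?thesis .
qed

lemma sum_collapse:
  assumes "\<gamma> \<in> Delta_plus n m" "i \<in> {1..n}" "\<gamma> i = \<gamma> (i - 1)"
  shows "(\<Sum>S\<in>Pow {1..n}. s ((-1) ^ card S) (f (compose {..n} \<gamma> (decr n S)))) = 0"
  by (rule sum_Pow_toggle[OF vs _ assms(2)]) (auto simp: compose_decr_collapse[OF assms(3)])

lemma norm_part_a:
  assumes "\<gamma> \<in> Delta_plus n m" "i \<in> {1..n}" "\<gamma> i = \<gamma> (i - 1)" "x \<in> W m"
  shows "norm_part n (a n m \<gamma> x) = 0"
proof -
  have "norm_part n (a n m \<gamma> x) = (\<Sum>S\<in>Pow {1..n}. s ((-1) ^ card S) (a n m (compose {..n} \<gamma> (decr n S)) x))"
    unfolding norm_part_def using assms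
    by (intro sum.cong refl) (auto simp: a_comp[OF decr_Delta_plus assms(1)])
  also have "\<dots> = 0" by (rule sum_collapse[OF assms(1-3)])
  finally show ?thesis .
qed

text \<open>For nonempty S the operator \<open>decr n S\<close> sends \<open>Min S\<close> and its
  predecessor to the same value, so its term is degenerate and killed; only the empty S
  survives.\<close>

lemma norm_part_norm_part:
  assumes "x \<in> W n" shows "norm_part n (norm_part n x) = norm_part n x"
proof -
  have z: "norm_part n (a n n (decr n S) x) = 0" if S: "S \<in> Pow {1..n} - {{}}" for S
  proof -
    define i where "i = Min S"
    have fin: "finite S" using S finite_subset by blast
    have iS: "i \<in> S" using S Min_in[OF fin] by (auto simp: i_def)
    then have in1: "i \<in> {1..n}" using S by blast
    have "i - 1 \<notin> S" using Min_le[OF fin, of "i - 1"] in1 by (auto simp: i_def[symmetric])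
    with iS in1 have i: "i \<in> S" "i - 1 \<notin> S" and "i \<in> {1..n}" by auto
    moreover from this i have "decr n S i = decr n S (i - 1)" by (auto simp: decr_def)
    ultimately show ?thesis using norm_part_a[OF decr_Delta_plus _ _ assms, of S] S by auto
  qed
  have "(\<Sum>S\<in>Pow {1..n} - {{}}. s ((-1) ^ card S) (a n n (decr n S) x)) \<in> W n"
    by (intro subspace_sum[OF subW] subspace_scale[OF subW] a_W decr_Delta_plus assms) auto
  with norm_part_lin[of n] assms have "norm_part n (norm_part n x) = norm_part n x + norm_part n (\<Sum>S\<in>Pow {1..n} - {{}}. s ((-1) ^ card S) (a n n (decr n S) x))"
    unfolding linear_on_def by (subst norm_part_expand[OF assms]) blast
  also have "norm_part n (\<Sum>S\<in>Pow {1..n} - {{}}. s ((-1) ^ card S) (a n n (decr n S) x))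
    = (\<Sum>S\<in>Pow {1..n} - {{}}. norm_part n (s ((-1) ^ card S) (a n n (decr n S) x)))"
    by (rule linear_on_sum[OF vs vs subW norm_part_lin])
      (auto intro!: subspace_scale[OF subW] a_W decr_Delta_plus assms)
  also have "\<dots> = 0"
    using z norm_part_lin[of n] assms unfolding linear_on_def
    by (intro sum.neutral) (auto simp: a_W decr_Delta_plus)
  finally show ?thesis by simp
qed

section \<open>Recursive construction of the natural retraction\<close>

definition r where
  "r n = (SOME r. Vector_Spaces.linear s s r \<and> range r \<subseteq> V n \<and> (\<forall>x\<in>V n. r x = x) \<and> r (e n) = 0)"

lemma r: "Vector_Spaces.linear s s (r n)" "r n x \<in> V n" "x \<in> V n \<Longrightarrow> r n x = x" "r n (e n) = 0"
proof -
  have "\<exists>r. Vector_Spaces.linear s s r \<and> range r \<subseteq> V n \<and> (\<forall>x\<in>V n. r x = x) \<and> r (e n) = 0"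
    using subspace_retraction[OF vs subV e_V] by metis
  from someI_ex[OF this] show "Vector_Spaces.linear s s (r n)" "r n x \<in> V n" "x \<in> V n \<Longrightarrow> r n x = x" "r n (e n) = 0"
    unfolding r_def[symmetric] by auto
qed

text \<open>On the normalized part, the image of \<^const>\<open>norm_part\<close>, any retraction will do; on its complement, spanned
  by degenerate elements, naturality forces the value.\<close>

primrec retraction :: "nat \<Rightarrow> 'v \<Rightarrow> 'v" where
  "retraction 0 x = r 0 x"
| "retraction (Suc n) x = norm_part (Suc n) (r (Suc n) (norm_part (Suc n) x)) -
    (\<Sum>S\<in>Pow {1..Suc n} - {{}}. s ((-1) ^ card S)
      (a (Suc n) n (decr_residue n S) (retraction n (a n (Suc n) (coface n (Max S)) x))))"

lemma residue_Delta_plus: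
  assumes "S \<in> Pow {1..Suc n} - {{}}"
  shows "decr_residue n S \<in> Delta_plus (Suc n) n" "coface n (Max S) \<in> Delta_plus n (Suc n)"
proof -
  have S: "S \<subseteq> {1..Suc n}" "S \<noteq> {}" using assms by auto
  show "decr_residue n S \<in> Delta_plus (Suc n) n" "coface n (Max S) \<in> Delta_plus n (Suc n)"
    using decr_factor[OF S] by (simp_all add: coface_Delta_plus)
qed

lemma retraction_V: "x \<in> W n \<Longrightarrow> retraction n x \<in> V n"
proof (induction n arbitrary: x)
  case (Suc n)
  then show ?case
    unfolding retraction.simps
    by (intro subspace_diff[OF subV] subspace_sum[OF subV] subspace_scale[OF subV] norm_part_V r a_V Suc.IH a_W)
       (simp_all only: residue_Delta_plus)
qed (simp add: r)

lemma retraction_lin: "linear_on s s (W n) (retraction n)"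
proof (induction n)
  case 0
  then show ?case using r(1)[of 0] by (auto simp: linear_on_def Vector_Spaces.linear_iff)
next
  case (Suc n)
  have N: "norm_part (Suc n) (r (Suc n) (norm_part (Suc n) (x + y))) = norm_part (Suc n) (r (Suc n) (norm_part (Suc n) x)) + norm_part (Suc n) (r (Suc n) (norm_part (Suc n) y))"
    "norm_part (Suc n) (r (Suc n) (norm_part (Suc n) (s c x))) = s c (norm_part (Suc n) (r (Suc n) (norm_part (Suc n) x)))"
    if "x \<in> W (Suc n)" "y \<in> W (Suc n)" for x y c
  proof -
    have "r (Suc n) z \<in> W (Suc n)" for z using r(2) VW by blast
    with that norm_part_lin[of "Suc n"] r(1)[of "Suc n"]
    show "norm_part (Suc n) (r (Suc n) (norm_part (Suc n) (x + y))) = norm_part (Suc n) (r (Suc n) (norm_part (Suc n) x)) + norm_part (Suc n) (r (Suc n) (norm_part (Suc n) y))"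
    "norm_part (Suc n) (r (Suc n) (norm_part (Suc n) (s c x))) = s c (norm_part (Suc n) (r (Suc n) (norm_part (Suc n) x)))"
      by (simp_all add: linear_on_def Vector_Spaces.linear_iff)
  qed
  have T: "a (Suc n) n (decr_residue n S) (retraction n (a n (Suc n) (coface n (Max S)) (x + y)))
      = a (Suc n) n (decr_residue n S) (retraction n (a n (Suc n) (coface n (Max S)) x))
      + a (Suc n) n (decr_residue n S) (retraction n (a n (Suc n) (coface n (Max S)) y))"
    "a (Suc n) n (decr_residue n S) (retraction n (a n (Suc n) (coface n (Max S)) (s c x)))
      = s c (a (Suc n) n (decr_residue n S) (retraction n (a n (Suc n) (coface n (Max S)) x)))"
    if "x \<in> W (Suc n)" "y \<in> W (Suc n)" "S \<in> Pow {1..Suc n} - {{}}" for x y c S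
  proof -
    have S: "decr_residue n S \<in> Delta_plus (Suc n) n" "coface n (Max S) \<in> Delta_plus n (Suc n)"
      using residue_Delta_plus[OF that(3)] .
    have RW: "retraction n z \<in> W n" if "z \<in> W n" for z using retraction_V[OF that] VW by blast
    show "a (Suc n) n (decr_residue n S) (retraction n (a n (Suc n) (coface n (Max S)) (x + y)))
      = a (Suc n) n (decr_residue n S) (retraction n (a n (Suc n) (coface n (Max S)) x))
      + a (Suc n) n (decr_residue n S) (retraction n (a n (Suc n) (coface n (Max S)) y))"
     "a (Suc n) n (decr_residue n S) (retraction n (a n (Suc n) (coface n (Max S)) (s c x)))
      = s c (a (Suc n) n (decr_residue n S) (retraction n (a n (Suc n) (coface n (Max S)) x)))"
      using Suc that(1,2) S a_W[OF S(2)] RW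
      by (simp_all add: linear_on_def a_add[OF S(1)] a_scale[OF S(1)] a_add[OF S(2)] a_scale[OF S(2)])
  qed
  show ?case
    unfolding linear_on_def
  proof (intro conjI ballI allI)
    fix x y assume xy: "x \<in> W (Suc n)" "y \<in> W (Suc n)"
    show "retraction (Suc n) (x + y) = retraction (Suc n) x + retraction (Suc n) y"
      using xy by (simp add: N T scale_right_distrib sum.distrib algebra_simps)
  next
    fix c x assume x: "x \<in> W (Suc n)"
    show "retraction (Suc n) (s c x) = s c (retraction (Suc n) x)"
      using x by (simp add: N T[OF x x] scale_right_diff_distrib scale_sum_right mult.commute)
  qed
qed

lemma retraction_W: "x \<in> W n \<Longrightarrow> retraction n x \<in> W n"
  using retraction_V VW by blast

text \<open>The induction is on a common bound for both degrees, because factoring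
  \<open>decr (Suc N) S\<close> leads to composites between lower degrees of either kind. A
  non-identity map of [N + 1] to itself factors through [N] and reduces to the two mixed
  cases.\<close>

lemma retraction_natural_le:
  "m \<le> N \<Longrightarrow> n \<le> N \<Longrightarrow> \<alpha> \<in> Delta_plus m n \<Longrightarrow> x \<in> W n \<Longrightarrow> a m n \<alpha> (retraction n x) = retraction m (a m n \<alpha> x)"
proof (induction N arbitrary: m n \<alpha> x)
  case 0
  then have "\<alpha> = (\<lambda>i\<in>{..0}. i)" "m = 0" "n = 0"
    by (auto simp: Delta_plus_iff fun_eq_iff extensional_def)
  with 0 show ?case by (simp only: a_id[OF retraction_W] a_id)
next
  case (Suc N)
  let ?P = "Pow {1..Suc N}"
  have S: "decr_residue N S \<in> Delta_plus (Suc N) N" "coface N (Max S) \<in> Delta_plus N (Suc N)"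
      "compose {..Suc N} (coface N (Max S)) (decr_residue N S) = decr (Suc N) S"
      "decr (Suc N) S \<in> Delta_plus (Suc N) (Suc N)"
    if "S \<in> ?P - {{}}" for S
    using that residue_Delta_plus[OF that] decr_factor(1)[of S N] decr_Delta_plus[of S "Suc N"] by auto
  have split: "(\<Sum>S\<in>?P. s ((-1) ^ card S) (f S)) = f {} + (\<Sum>S\<in>?P - {{}}. s ((-1) ^ card S) (f S))" for f
    by (subst sum.remove[of _ "{}"]) auto
  \<comment> \<open>\<alpha> misses some i, so it annihilates the normalized term, and toggling i
    makes the full alternating sum zero. The terms with S nonempty therefore add up to minus the
    term with S empty.\<close>
  have face: "a m (Suc N) \<alpha> (retraction (Suc N) x) = retraction m (a m (Suc N) \<alpha> x)"
    if m: "m \<le> N" and \<alpha>: "\<alpha> \<in> Delta_plus m (Suc N)" and x: "x \<in> W (Suc N)" for m \<alpha> x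
  proof -
    obtain i where i: "i \<in> {1..Suc N}" "i \<notin> \<alpha> ` {..m}" using Delta_plus_avoid[OF \<alpha>] m by auto
    let ?y = "\<lambda>S. a (Suc N) N (decr_residue N S) (retraction N (a N (Suc N) (coface N (Max S)) x))"
    have y: "?y S \<in> W (Suc N)" if "S \<in> ?P - {{}}" for S
      using S[OF that] x by (intro a_W retraction_W)
    have "a m (Suc N) \<alpha> (?y S) = retraction m (a m (Suc N) (compose {..m} (decr (Suc N) S) \<alpha>) x)"
      if "S \<in> ?P - {{}}" for S
    proof -
      note S = S[OF that]
      have "a m (Suc N) \<alpha> (?y S) = a m N (compose {..m} (decr_residue N S) \<alpha>) (retraction N (a N (Suc N) (coface N (Max S)) x))"
        using S x by (intro a_comp[OF \<alpha> S(1), symmetric] retraction_W a_W)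
      also have "\<dots> = retraction m (a m N (compose {..m} (decr_residue N S) \<alpha>) (a N (Suc N) (coface N (Max S)) x))"
        using S x m by (intro Suc.IH compose_Delta_plus[OF \<alpha>] a_W) auto
      also have "a m N (compose {..m} (decr_residue N S) \<alpha>) (a N (Suc N) (coface N (Max S)) x)
         = a m (Suc N) \<alpha> (a (Suc N) N (decr_residue N S) (a N (Suc N) (coface N (Max S)) x))"
        using S x by (intro a_comp[OF \<alpha>] a_W)
      also have "a (Suc N) N (decr_residue N S) (a N (Suc N) (coface N (Max S)) x) = a (Suc N) (Suc N) (decr (Suc N) S) x"
        using a_comp[OF S(1,2) x] S(3) by simp
      also have "a m (Suc N) \<alpha> (a (Suc N) (Suc N) (decr (Suc N) S) x) = a m (Suc N) (compose {..m} (decr (Suc N) S) \<alpha>) x"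
        by (rule a_comp[OF \<alpha> S(4) x, symmetric])
      finally show ?thesis .
    qed
    moreover have "a m (Suc N) \<alpha> (\<Sum>S\<in>?P - {{}}. s ((-1) ^ card S) (?y S))
       = (\<Sum>S\<in>?P - {{}}. s ((-1) ^ card S) (a m (Suc N) \<alpha> (?y S)))"
      using y by (subst a_sum[OF \<alpha>]) (auto intro!: subspace_scale[OF subW] sum.cong a_scale[OF \<alpha>])
    ultimately have "a m (Suc N) \<alpha> (\<Sum>S\<in>?P - {{}}. s ((-1) ^ card S) (?y S))
       = (\<Sum>S\<in>?P - {{}}. s ((-1) ^ card S) (retraction m (a m (Suc N) (compose {..m} (decr (Suc N) S) \<alpha>) x)))"
      by (simp only: retraction.simps cong: sum.cong)
    also have "\<dots> = - retraction m (a m (Suc N) (compose {..m} (decr (Suc N) {}) \<alpha>) x)"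
    proof -
      have "(\<Sum>S\<in>?P. s ((-1) ^ card S) (retraction m (a m (Suc N) (compose {..m} (decr (Suc N) S) \<alpha>) x))) = 0"
        by (rule sum_Pow_toggle[OF vs _ i(1)]) (auto simp: compose_decr_avoid[OF \<alpha> i(2)])
      then show ?thesis unfolding split by (simp add: eq_neg_iff_add_eq_0 add.commute)
    qed
    also have "a m (Suc N) (compose {..m} (decr (Suc N) {}) \<alpha>) x = a m (Suc N) \<alpha> x"
      using a_comp[OF \<alpha> decr_Delta_plus[of "{}"] x] x by (simp add: decr_empty a_id)
    finally have 1: "a m (Suc N) \<alpha> (\<Sum>S\<in>?P - {{}}. s ((-1) ^ card S) (?y S)) = - retraction m (a m (Suc N) \<alpha> x)" .
    have rW: "r (Suc N) z \<in> W (Suc N)" for z using r(2) VW by blast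
    have "a m (Suc N) \<alpha> (retraction (Suc N) x) = a m (Suc N) \<alpha> (norm_part (Suc N) (r (Suc N) (norm_part (Suc N) x)))
       - a m (Suc N) \<alpha> (\<Sum>S\<in>?P - {{}}. s ((-1) ^ card S) (?y S))"
      unfolding retraction.simps using y
      by (intro linear_on_diff[OF vs vs a_lin[OF \<alpha>] subW] norm_part_W rW subspace_sum[OF subW] subspace_scale[OF subW])
    also have "a m (Suc N) \<alpha> (norm_part (Suc N) (r (Suc N) (norm_part (Suc N) x))) = 0"
      using m by (intro a_norm_part[OF \<alpha>] rW) simp
    finally show ?thesis using 1 by simp
  qed
  \<comment> \<open>The mirror image: \<alpha> repeats a value, so the normalized part of the
    degenerate element vanishes, and the alternating sum of the composites is again zero.\<close>
  have degen: "a (Suc N) n \<alpha> (retraction n x) = retraction (Suc N) (a (Suc N) n \<alpha> x)"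
    if n: "n \<le> N" and \<alpha>: "\<alpha> \<in> Delta_plus (Suc N) n" and x: "x \<in> W n" for n \<alpha> x
  proof -
    obtain i where i: "i \<in> {1..Suc N}" "\<alpha> i = \<alpha> (i - 1)" using Delta_plus_collapse[OF \<alpha>] n by auto
    have rx: "retraction n x \<in> W n" using x by (rule retraction_W)
    have "a (Suc N) N (decr_residue N S) (retraction N (a N (Suc N) (coface N (Max S)) (a (Suc N) n \<alpha> x)))
       = a (Suc N) n (compose {..Suc N} \<alpha> (decr (Suc N) S)) (retraction n x)" if "S \<in> ?P - {{}}" for S
    proof -
      note S = S[OF that]
      have "a N (Suc N) (coface N (Max S)) (a (Suc N) n \<alpha> x) = a N n (compose {..N} \<alpha> (coface N (Max S))) x"
        by (rule a_comp[OF S(2) \<alpha> x, symmetric])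
      moreover have "retraction N (a N n (compose {..N} \<alpha> (coface N (Max S))) x) = a N n (compose {..N} \<alpha> (coface N (Max S))) (retraction n x)"
        using n x by (intro Suc.IH[symmetric] compose_Delta_plus[OF S(2) \<alpha>]) auto
      moreover have "a N n (compose {..N} \<alpha> (coface N (Max S))) (retraction n x) = a N (Suc N) (coface N (Max S)) (a (Suc N) n \<alpha> (retraction n x))"
        by (rule a_comp[OF S(2) \<alpha> rx])
      moreover have "a (Suc N) N (decr_residue N S) (a N (Suc N) (coface N (Max S)) (a (Suc N) n \<alpha> (retraction n x)))
         = a (Suc N) (Suc N) (decr (Suc N) S) (a (Suc N) n \<alpha> (retraction n x))"
        using a_comp[OF S(1,2) a_W[OF \<alpha> rx]] S(3) by simp
      moreover have "\<dots> = a (Suc N) n (compose {..Suc N} \<alpha> (decr (Suc N) S)) (retraction n x)"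
        by (rule a_comp[OF S(4) \<alpha> rx, symmetric])
      ultimately show ?thesis by simp
    qed
    then have "retraction (Suc N) (a (Suc N) n \<alpha> x) = norm_part (Suc N) (r (Suc N) (norm_part (Suc N) (a (Suc N) n \<alpha> x)))
      - (\<Sum>S\<in>?P - {{}}. s ((-1) ^ card S) (a (Suc N) n (compose {..Suc N} \<alpha> (decr (Suc N) S)) (retraction n x)))"
      by (simp only: retraction.simps cong: sum.cong)
    also have "norm_part (Suc N) (a (Suc N) n \<alpha> x) = 0" by (rule norm_part_a[OF \<alpha> i x])
    also have "r (Suc N) 0 = 0" using r(3)[OF subspace_0[OF subV]] .
    also have "norm_part (Suc N) 0 = 0" by (rule linear_on_zero[OF vs vs subW norm_part_lin])
    also have "(\<Sum>S\<in>?P - {{}}. s ((-1) ^ card S) (a (Suc N) n (compose {..Suc N} \<alpha> (decr (Suc N) S)) (retraction n x)))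
      = - a (Suc N) n (compose {..Suc N} \<alpha> (decr (Suc N) {})) (retraction n x)"
      using sum_collapse[OF \<alpha> i, of "\<lambda>\<gamma>. a (Suc N) n \<gamma> (retraction n x)"]
      unfolding split by (simp add: eq_neg_iff_add_eq_0 add.commute)
    also have "a (Suc N) n (compose {..Suc N} \<alpha> (decr (Suc N) {})) (retraction n x) = a (Suc N) n \<alpha> (retraction n x)"
      using a_comp[OF decr_Delta_plus[of "{}"] \<alpha> rx] a_W[OF \<alpha> rx] by (simp add: decr_empty a_id)
    finally show ?thesis by simp
  qed
  consider "m \<le> N" "n \<le> N" | "m \<le> N" "n = Suc N" | "m = Suc N" "n \<le> N" | "m = Suc N" "n = Suc N"
    using Suc.prems by linarith
  then show ?case
  proof cases
    case 4
    show ?thesis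
    proof (cases "\<alpha> = (\<lambda>i\<in>{..Suc N}. i)")
      case True
      then show ?thesis using 4 Suc.prems by (simp only: a_id[OF retraction_W] a_id)
    next
      case False
      have \<alpha>: "\<alpha> \<in> Delta_plus (Suc N) (Suc N)" and x: "x \<in> W (Suc N)" using Suc.prems 4 by auto
      obtain i where i: "i \<in> {1..Suc N}" "\<alpha> i = \<alpha> (i - 1)"
        using Delta_plus_collapse[OF \<alpha>] False by auto
      \<comment> \<open>\<alpha> is the codegeneracy followed by \<delta>. The action is
        contravariant, so \<open>face\<close> treats \<delta> first and \<open>degen\<close> then
        treats the codegeneracy.\<close>
      define \<delta> where "\<delta> = compose {..N} \<alpha> (coface N i)"
      have \<sigma>: "codegen N i \<in> Delta_plus (Suc N) N" using i(1) by (intro codegen_Delta_plus) auto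
      have \<delta>: "\<delta> \<in> Delta_plus N (Suc N)"
        unfolding \<delta>_def using i by (intro compose_Delta_plus[OF coface_Delta_plus \<alpha>]) auto
      have eq: "a (Suc N) (Suc N) \<alpha> z = a (Suc N) N (codegen N i) (a N (Suc N) \<delta> z)" if "z \<in> W (Suc N)" for z
        using a_comp[OF \<sigma> \<delta> that] collapse_factor[OF \<alpha> i] by (simp add: \<delta>_def)
      show ?thesis using 4 x
        by (simp only: eq retraction_W face[OF order_refl \<delta>] degen[OF order_refl \<sigma>] a_W[OF \<delta>])
    qed
  qed (use Suc.IH Suc.prems face degen in auto)
qed

lemma retraction_natural: "\<alpha> \<in> Delta_plus m n \<Longrightarrow> x \<in> W n \<Longrightarrow> a m n \<alpha> (retraction n x) = retraction m (a m n \<alpha> x)"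
  by (rule retraction_natural_le[of m "max m n"]) auto

lemma a_decr_factor:
  assumes "S \<in> Pow {1..Suc n} - {{}}" "x \<in> W (Suc n)"
  shows "a (Suc n) n (decr_residue n S) (a n (Suc n) (coface n (Max S)) x) = a (Suc n) (Suc n) (decr (Suc n) S) x"
proof -
  have S: "S \<subseteq> {1..Suc n}" "S \<noteq> {}" using assms by auto
  show ?thesis
    using a_comp[OF decr_factor(2)[OF S] coface_Delta_plus[OF decr_factor(3)[OF S]] assms(2)] decr_factor(1)[OF S] by simp
qed

text \<open>On \<open>V\<close> the inner retractions are the identity by induction and
  \<open>r\<close> fixes \<open>norm_part x\<close>, so the recursion becomes
  \<open>norm_part_expand\<close> solved for x.\<close>

lemma retraction_id: "x \<in> V n \<Longrightarrow> retraction n x = x"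
proof (induction n arbitrary: x)
  case (Suc n)
  have x: "x \<in> W (Suc n)" using Suc.prems VW by auto
  have "retraction n (a n (Suc n) (coface n (Max S)) x) = a n (Suc n) (coface n (Max S)) x" if "S \<in> Pow {1..Suc n} - {{}}" for S
    using residue_Delta_plus[OF that] Suc.prems by (intro Suc.IH a_V)
  then have "(\<Sum>S\<in>Pow {1..Suc n} - {{}}. s ((-1) ^ card S)
      (a (Suc n) n (decr_residue n S) (retraction n (a n (Suc n) (coface n (Max S)) x))))
    = (\<Sum>S\<in>Pow {1..Suc n} - {{}}. s ((-1) ^ card S) (a (Suc n) (Suc n) (decr (Suc n) S) x))"
    using a_decr_factor[OF _ x] by (intro sum.cong refl) metis
  then have "retraction (Suc n) x = norm_part (Suc n) x -
      (\<Sum>S\<in>Pow {1..Suc n} - {{}}. s ((-1) ^ card S) (a (Suc n) (Suc n) (decr (Suc n) S) x))"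
    using x Suc.prems by (simp only: retraction.simps r norm_part_V norm_part_norm_part)
  also have "\<dots> = x" unfolding norm_part_expand[OF x] by simp
  finally show ?case .
qed (simp add: r)

text \<open>All operators fix \<open>e\<close>, so in positive degree its normalized part is
  \<open>e\<close> times the alternating count of subsets of a nonempty set, which is 0.\<close>

lemma retraction_e: "retraction n (e n) = 0"
proof (induction n)
  case (Suc n)
  have "retraction n (a n (Suc n) (coface n (Max S)) (e (Suc n))) = 0" if "S \<in> Pow {1..Suc n} - {{}}" for S
    using residue_Delta_plus[OF that] Suc by (simp add: a_e)
  then have sum0: "(\<Sum>S\<in>Pow {1..Suc n} - {{}}. s ((-1) ^ card S)
      (a (Suc n) n (decr_residue n S) (retraction n (a n (Suc n) (coface n (Max S)) (e (Suc n)))))) = 0"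
    by (intro sum.neutral ballI)
      (simp only: linear_on_zero[OF vs vs subW a_lin] residue_Delta_plus scale_zero_right)
  have "norm_part (Suc n) (e (Suc n)) = (\<Sum>S\<in>Pow {1..Suc n}. s ((-1) ^ card S) (e (Suc n)))"
    unfolding norm_part_def by (intro sum.cong refl) (auto simp: a_e decr_Delta_plus)
  also have "\<dots> = 0" by (rule sum_Pow_toggle[OF vs, of _ 1]) auto
  finally have "norm_part (Suc n) (e (Suc n)) = 0" .
  moreover have "r (Suc n) 0 = 0" using r(3)[OF subspace_0[OF subV]] .
  moreover have "norm_part (Suc n) 0 = 0" by (rule linear_on_zero[OF vs vs subW norm_part_lin])
  ultimately show ?case using sum0 by simp
qed (simp add: r)

end


section \<open>The isomorphism of almost simplicial coalgebras\<close>

lemma tensor_map_tensor: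
  assumes "vector_space s" "Modules.module.subspace s V" "linear_on s t V f" "f ` V \<subseteq> W" "\<tau> \<in> tensor s V s V"
  shows "tensor_map V t W f \<tau> \<in> tensor t W t W"
proof -
  interpret f: vector_space fscale by (rule vector_space_fscale)
  have "\<tau> \<in> f.span {pure_tensor s V s V v w | v w. v \<in> V \<and> w \<in> V}"
    using assms(5) by (simp add: tensor_def)
  then have "tensor_map V t W f \<tau> \<in> f.span {pure_tensor t W t W v w | v w. v \<in> W \<and> w \<in> W}"
  proof (induction rule: f.span_induct_alt)
    case base
    have "tensor_map V t W f 0 = 0" by (simp add: tensor_map_def zero_ext_def fun_eq_iff)
    then show ?case by (simp only: f.span_zero)
  next
    case (step c x y)
    then obtain v w where vw: "v \<in> V" "w \<in> V" "x = pure_tensor s V s V v w" by auto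
    have "pullback V f \<phi> \<in> dual s V" if "\<phi> \<in> dual t W" for \<phi>
      by (rule pullback_in_dual[OF assms(1-4) that])
    then have "tensor_map V t W f x = pure_tensor t W t W (f v) (f w)"
      using vw by (auto simp: tensor_map_def pure_tensor_def zero_ext_def pullback_def fun_eq_iff)
    then have "tensor_map V t W f x \<in> f.span {pure_tensor t W t W v w | v w. v \<in> W \<and> w \<in> W}"
      using vw assms(4) by (intro f.span_base) blast
    moreover have "tensor_map V t W f (fscale c x + y) = fscale c (tensor_map V t W f x) + tensor_map V t W f y"
      by (auto simp: tensor_map_def zero_ext_def fscale_apply fun_eq_iff)
    ultimately show ?case using step by (simp only: f.span_add f.span_scale)
  qed
  then show ?thesis by (simp add: tensor_def)
qed

lemma sym_eval_dual: "zero_ext (sym_tensors s V) (\<lambda>t. t \<phi>s) \<in> dual fscale (sym_tensors s V)"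
  by (rule zero_ext_in_dual[OF vector_space_fscale sym_tensors_subspace]) (simp add: linear_on_def fscale_apply)

text \<open>This is the uniqueness behind the definite description in \<open>deconcat\<close>.
  Evaluations separate symmetric tensors, and \<open>tensor_slice\<close> reduces a tensor to such
  elements one slot at a time.\<close>

lemma sym_tensor_eqI:
  fixes s :: "'k::field \<Rightarrow> 'v::ab_group_add \<Rightarrow> 'v" and V
  defines "T \<equiv> sym_tensors s V"
  assumes \<tau>: "\<tau> \<in> tensor fscale T fscale T" "\<tau>' \<in> tensor fscale T fscale T"
    and eq: "\<And>\<phi>s \<psi>s. \<tau> (zero_ext T (\<lambda>t. t \<phi>s), zero_ext T (\<lambda>t. t \<psi>s)) = \<tau>' (zero_ext T (\<lambda>t. t \<phi>s), zero_ext T (\<lambda>t. t \<psi>s))"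
  shows "\<tau> = \<tau>'"
proof
  fix p
  have T: "Modules.module.subspace fscale T" unfolding T_def by (rule sym_tensors_subspace)
  note slice = tensor_slice[OF vector_space_fscale vector_space_fscale T T]
  let ?ev = "\<lambda>\<phi>s. zero_ext T (\<lambda>t. t \<phi>s)"
  have ev: "?ev \<phi>s \<in> dual fscale T" for \<phi>s unfolding T_def by (rule sym_eval_dual)
  have eq_T: "x = y" if "x \<in> T" "y \<in> T" "\<And>\<phi>s. ?ev \<phi>s x = ?ev \<phi>s y" for x y
    using that by (auto simp: zero_ext_def fun_eq_iff)
  have half: "\<tau> (\<phi>, ?ev \<psi>s) = \<tau>' (\<phi>, ?ev \<psi>s)" if \<phi>: "\<phi> \<in> dual fscale T" for \<phi> \<psi>s
  proof -
    obtain x y where xy: "x \<in> T" "\<forall>\<phi>\<in>dual fscale T. \<tau> (\<phi>, ?ev \<psi>s) = \<phi> x"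
      "y \<in> T" "\<forall>\<phi>\<in>dual fscale T. \<tau>' (\<phi>, ?ev \<psi>s) = \<phi> y"
      using slice(2)[OF \<tau>(1) ev] slice(2)[OF \<tau>(2) ev] by metis
    have "?ev \<phi>s x = ?ev \<phi>s y" for \<phi>s
      using xy(2,4) ev[of \<phi>s] eq[of \<phi>s \<psi>s] by metis
    then have "x = y" by (rule eq_T[OF xy(1,3)])
    with xy(2,4) \<phi> show ?thesis by simp
  qed
  show "\<tau> p = \<tau>' p"
  proof (cases "p \<in> dual fscale T \<times> dual fscale T")
    case True
    then obtain \<phi> \<psi> where p: "p = (\<phi>, \<psi>)" "\<phi> \<in> dual fscale T" "\<psi> \<in> dual fscale T" by auto
    obtain x y where xy: "x \<in> T" "\<forall>\<psi>\<in>dual fscale T. \<tau> (\<phi>, \<psi>) = \<psi> x"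
      "y \<in> T" "\<forall>\<psi>\<in>dual fscale T. \<tau>' (\<phi>, \<psi>) = \<psi> y"
      using slice(1)[OF \<tau>(1) p(2)] slice(1)[OF \<tau>(2) p(2)] by metis
    have "?ev \<psi>s x = ?ev \<psi>s y" for \<psi>s
      using xy(2,4) ev[of \<psi>s] half[OF p(2), of \<psi>s] by metis
    then have "x = y" by (rule eq_T[OF xy(1,3)])
    with xy(2,4) p show ?thesis by simp
  next
    case False
    then show ?thesis using slice(3)[OF \<tau>(1)] slice(3)[OF \<tau>(2)] by simp
  qed
qed

text \<open>The coalgebra hypotheses are on the source, and the structure of the target is
  transported along \<open>f\<close>; so the coalgebra axioms are never verified for
  \<open>Sym_co\<close> separately.\<close>

lemma bijective_hom_iso:
  assumes vs: "vector_space s" "vector_space t"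
    and sub: "Modules.module.subspace s (cspace Co)"
    and comult: "comult Co ` cspace Co \<subseteq> tensor s (cspace Co) s (cspace Co)"
    and coaug: "coaug Co \<in> cspace Co"
    and f: "f \<in> coalg_hom s t Co Do" and inj: "inj_on f (cspace Co)" and surj: "f ` cspace Co = cspace Do"
  shows "f \<in> coalg_iso s t Co Do"
proof -
  interpret s: vector_space s by fact
  interpret t: vector_space t by fact
  let ?C = "cspace Co" and ?D = "cspace Do"
  define g where "g = inv_into ?C f"
  have gf: "g (f c) = c" if "c \<in> ?C" for c unfolding g_def using inj that by simp
  have gD: "g d \<in> ?C" and fg: "f (g d) = d" if "d \<in> ?D" for d
    unfolding g_def using that surj by (auto intro: inv_into_into f_inv_into_f)
  have f_lin: "linear_on s t ?C f" using f by (simp add: coalg_hom_def)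
  have f_comult: "comult Do (f c) = tensor_map ?C t ?D f (comult Co c)"
    and f_counit: "counit Do (f c) = counit Co c" if "c \<in> ?C" for c
    using f that by (simp_all add: coalg_hom_def)
  have f_coaug: "f (coaug Co) = coaug Do" using f by (simp add: coalg_hom_def)
  have f_add: "f (x + y) = f x + f y" and f_scale: "f (s a x) = t a (f x)" if "x \<in> ?C" "y \<in> ?C" for x y a
    using f_lin that by (auto simp: linear_on_def)
  have sub_add: "x + y \<in> ?C" and sub_scale: "s a x \<in> ?C" if "x \<in> ?C" "y \<in> ?C" for x y a
    using that s.subspace_add[OF sub] s.subspace_scale[OF sub] by auto
  have subD: "t.subspace ?D"
  proof (rule t.subspaceI)
    show "0 \<in> ?D" using linear_on_zero[OF vs sub f_lin] s.subspace_0[OF sub] surj by force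
    fix x y assume xy: "x \<in> ?D" "y \<in> ?D"
    then have "x + y = f (g x + g y)" by (simp add: f_add gD fg)
    then show "x + y \<in> ?D" using surj sub_add[OF gD[OF xy(1)] gD[OF xy(2)]] by auto
  next
    fix c x assume x: "x \<in> ?D"
    then have "t c x = f (s c (g x))" using f_scale[of "g x" "g x" c] by (simp add: gD fg)
    then show "t c x \<in> ?D" using surj sub_scale[OF gD[OF x] gD[OF x]] by auto
  qed
  have g_lin: "linear_on t s ?D g"
    unfolding linear_on_def
  proof (intro conjI ballI allI)
    fix x y assume xy: "x \<in> ?D" "y \<in> ?D"
    then have "x + y = f (g x + g y)" by (simp add: f_add gD fg)
    then show "g (x + y) = g x + g y" using gf[OF sub_add[OF gD[OF xy(1)] gD[OF xy(2)]]] by simp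
  next
    fix c x assume x: "x \<in> ?D"
    then have "t c x = f (s c (g x))" using f_scale[of "g x" "g x" c] by (simp add: gD fg)
    then show "g (t c x) = s c (g x)" using gf[OF sub_scale[OF gD[OF x] gD[OF x]]] by simp
  qed
  have "comult Co (g d) = tensor_map ?D s ?C g (comult Do d)" if d: "d \<in> ?D" for d
  proof
    fix p
    show "comult Co (g d) p = tensor_map ?D s ?C g (comult Do d) p"
    proof (cases "p \<in> dual s ?C \<times> dual s ?C")
      case True
      then obtain \<phi> \<psi> where p: "p = (\<phi>, \<psi>)" "\<phi> \<in> dual s ?C" "\<psi> \<in> dual s ?C" by auto
      have pb: "pullback ?D g \<phi> \<in> dual t ?D" "pullback ?C f (pullback ?D g \<phi>) = \<phi>" if "\<phi> \<in> dual s ?C" for \<phi>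
      proof -
        show "pullback ?D g \<phi> \<in> dual t ?D"
          using gD by (intro pullback_in_dual[OF vs(2) subD g_lin _ that]) auto
        show "pullback ?C f (pullback ?D g \<phi>) = \<phi>"
          using surj gf dual_outside[OF that] by (auto simp: pullback_def zero_ext_def fun_eq_iff)
      qed
      have "comult Do d = tensor_map ?C t ?D f (comult Co (g d))"
        using f_comult[OF gD[OF d]] by (simp only: fg[OF d])
      then show ?thesis using p pb by (simp add: tensor_map_def zero_ext_def)
    next
      case False
      then show ?thesis
        using tensor_slice(3)[OF vs(1) vs(1) sub sub] comult gD[OF d]
        by (auto simp: tensor_map_def zero_ext_def image_subset_iff)
    qed
  qed
  moreover have "counit Co (g d) = counit Do d" if "d \<in> ?D" for d
    using f_counit[OF gD[OF that]] by (simp only: fg[OF that])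
  moreover have "g (coaug Do) = coaug Co" using gf[OF coaug] by (simp only: f_coaug)
  ultimately have "g \<in> coalg_hom t s Do Co"
    using g_lin gD by (auto simp: coalg_hom_def)
  then show ?thesis unfolding coalg_iso_def mem_Collect_eq
    by (intro conjI f bexI[of _ g] ballI gf fg)
qed

context retracted_coalg
begin

lemma pullback_Phi:
  "pullback C Phi (zero_ext (sym_tensors s P) (\<lambda>t. t \<phi>s)) = (if set \<phi>s \<subseteq> D then lprod (map Rs \<phi>s) else 0)"
  using Phi_sym_tensors dual_outside[OF lprod_A[of "map Rs \<phi>s"]]
  by (auto simp: pullback_def zero_ext_def fun_eq_iff Phi_apply Phi_outside)

text \<open>By \<open>pullback_Phi\<close> evaluations at lists pull back to products in
  \<open>A\<close>, and multiplying two such products concatenates the lists. This is the property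
  that characterizes \<open>deconcat\<close>.\<close>

lemma Phi_comult:
  assumes c: "c \<in> C"
  shows "deconcat s P (Phi c) = tensor_map C fscale (sym_tensors s P) Phi (comult Co c)"
proof -
  let ?T = "sym_tensors s P" and ?\<tau> = "tensor_map C fscale (sym_tensors s P) Phi (comult Co c)"
  let ?ev = "\<lambda>\<phi>s. zero_ext ?T (\<lambda>t. t \<phi>s)"
  have \<tau>: "?\<tau> \<in> tensor fscale ?T fscale ?T"
    using Phi_sym_tensors by (intro tensor_map_tensor[OF vs subC Phi_linear _ comult_tensor[OF c]]) auto
  have ev: "?\<tau> (?ev \<phi>s, ?ev \<psi>s) = Phi c (\<phi>s @ \<psi>s)" for \<phi>s \<psi>s
  proof -
    have "?\<tau> (?ev \<phi>s, ?ev \<psi>s) = (pullback C Phi (?ev \<phi>s) \<star> pullback C Phi (?ev \<psi>s)) c"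
      using c by (simp add: tensor_map_def zero_ext_def[of "dual _ _ \<times> dual _ _"] sym_eval_dual mul_apply)
    also have "\<dots> = Phi c (\<phi>s @ \<psi>s)"
    proof (cases "set \<phi>s \<subseteq> D \<and> set \<psi>s \<subseteq> D")
      case True
      then show ?thesis using map_Rs(2)[of \<phi>s] by (simp add: pullback_Phi Phi_apply lprod_append)
    next
      case False
      then have "\<not> set (\<phi>s @ \<psi>s) \<subseteq> D" by simp
      with False show ?thesis by (auto simp: pullback_Phi mul_zero lprod_A dual_zero Phi_outside)
    qed
    finally show ?thesis .
  qed
  show ?thesis
    unfolding deconcat_def
  proof (rule the_equality)
    fix \<tau>' assume "\<tau>' \<in> tensor fscale ?T fscale ?T \<and> (\<forall>\<phi>s \<psi>s. \<tau>' (?ev \<phi>s, ?ev \<psi>s) = Phi c (\<phi>s @ \<psi>s))"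
    then show "\<tau>' = ?\<tau>" using \<tau> ev by (intro sym_tensor_eqI) auto
  qed (use \<tau> ev in blast)
qed

lemma Phi_hom: "Phi \<in> coalg_hom s fscale Co (Sym_co s P)"
proof -
  have "Phi \<u> = word s P []"
  proof
    fix \<phi>s
    show "Phi \<u> \<phi>s = word s P [] \<phi>s"
    proof (cases "\<phi>s = [] \<or> \<not> set \<phi>s \<subseteq> D")
      case True
      then show ?thesis
        using Phi_apply[of "[]" \<u>] Phi_outside[of \<phi>s \<u>] word_simps(6)[of \<phi>s s P "[]"]
        by (elim disjE) (simp_all only: word_simps(1) lprod_simps(1) list.simps list.set empty_subsetI simp_thms True_implies_equals eps_u)
    next
      case False
      then show ?thesis
        using m_u[OF lprod_m[OF map_Rs(1)]] by (simp add: Phi_apply word_simps(5))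
    qed
  qed
  then show ?thesis
    using Phi_sym_tensors Phi_linear Phi_comult
    by (auto simp: coalg_hom_def Sym_co_def Phi_apply eps_apply)
qed

end

lemma (in smooth_coalg) Phi_iso: "Phi \<in> coalg_iso s fscale Co (Sym_co s P)"
  using comult_tensor u_C
  by (intro bijective_hom_iso[OF vs vector_space_fscale subC _ _ Phi_hom Phi_inj])
    (auto simp: Sym_co_def Phi_surj[symmetric])

section \<open>Coalgebra morphisms as homomorphisms of dual algebras\<close>

locale coalg_morphism = C: conil_coalg s Co + D: conil_coalg s Do
  for s :: "'k::field \<Rightarrow> 'v::ab_group_add \<Rightarrow> 'v" and Co Do +
  fixes f
  assumes hom: "f \<in> coalg_hom s s Co Do"
begin

lemma f_C: "c \<in> cspace Co \<Longrightarrow> f c \<in> cspace Do" and f_lin: "linear_on s s (cspace Co) f"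
  and f_counit: "c \<in> cspace Co \<Longrightarrow> counit Do (f c) = counit Co c" and f_u: "f (coaug Co) = coaug Do"
  using hom by (auto simp: coalg_hom_def)

lemma pullback_A: "\<phi> \<in> D.A \<Longrightarrow> pullback (cspace Co) f \<phi> \<in> C.A"
  using f_C by (intro pullback_in_dual[OF C.vs C.subC f_lin]) auto

lemma pullback_mul:
  assumes "\<phi> \<in> D.A" "\<psi> \<in> D.A"
  shows "pullback (cspace Co) f (conv Do \<phi> \<psi>) = conv Co (pullback (cspace Co) f \<phi>) (pullback (cspace Co) f \<psi>)"
proof (rule dual_eqI[OF pullback_A[OF D.mul_A] C.mul_A])
  fix c assume c: "c \<in> cspace Co"
  then have "comult Do (f c) = tensor_map (cspace Co) s (cspace Do) f (comult Co c)"
    using hom by (simp add: coalg_hom_def)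
  with c assms show "pullback (cspace Co) f (conv Do \<phi> \<psi>) c = conv Co (pullback (cspace Co) f \<phi>) (pullback (cspace Co) f \<psi>) c"
    by (simp add: pullback_def[of _ _ "conv Do \<phi> \<psi>"] zero_ext_def[of "cspace Co"] C.mul_apply D.mul_apply f_C
        tensor_map_def zero_ext_def[of "dual _ _ \<times> dual _ _"])
qed

lemma pullback_eps: "pullback (cspace Co) f D.\<epsilon> = C.\<epsilon>"
  by (rule dual_eqI[OF pullback_A[OF D.eps_A] C.eps_A])
    (simp add: pullback_def zero_ext_def D.eps_apply C.eps_apply f_C f_counit)

lemma pullback_lprod:
  "set \<phi>s \<subseteq> D.A \<Longrightarrow> pullback (cspace Co) f (D.lprod \<phi>s) = C.lprod (map (pullback (cspace Co) f) \<phi>s)"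
  by (induction \<phi>s) (auto simp: pullback_eps pullback_mul D.lprod_A)

text \<open>Precomposing a derivation with the dual algebra homomorphism gives a derivation.\<close>

lemma f_prim:
  assumes "x \<in> prim s Co" shows "f x \<in> prim s Do"
  unfolding D.prim_iff
proof (intro conjI ballI)
  have x: "x \<in> cspace Co" using assms by (rule C.prim_C)
  then show "f x \<in> cspace Do" by (rule f_C)
  have pb: "pullback (cspace Co) f \<phi> x = \<phi> (f x)" "pullback (cspace Co) f \<phi> (coaug Co) = \<phi> (coaug Do)" for \<phi>
    using x C.u_C by (simp_all add: pullback_def zero_ext_def f_u)
  fix \<phi> \<psi> assume A: "\<phi> \<in> D.A" "\<psi> \<in> D.A"
  then show "conv Do \<phi> \<psi> (f x) = \<phi> (f x) * \<psi> (coaug Do) + \<phi> (coaug Do) * \<psi> (f x)"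
    using C.prim_mul[OF assms pullback_A[OF A(1)] pullback_A[OF A(2)]]
    by (simp add: pullback_mul[symmetric] pb)
qed

end

lemma pointed_formal_manifold_conil:
  assumes "Co \<in> pointed_formal_manifold s"
  shows "conil_coalg s Co"
  using assms by unfold_locales (auto simp: pointed_formal_manifold_def CoCom_conil_ft_def)

theorem theorem2p49:
  fixes s :: "'k::field_char_0 \<Rightarrow> 'v::ab_group_add \<Rightarrow> 'v"
    and X :: "(('k, 'v) coalg, 'v) presheaf"
  assumes "vector_space s"
    and "pointed_formal_infty_groupoid s X"
  shows "\<exists>\<Phi>. almost_simplicial_coalg_iso s fscale
    (U_plus X) (Sym_co_plus s (U_plus (Prim s X))) \<Phi>"
proof -
  have simplicial: "simplicial_object_in s (pointed_formal_manifold s) X"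
    using assms(2) by (simp add: pointed_formal_infty_groupoid_def)
  then have mfd: "ob X n \<in> pointed_formal_manifold s" for n
    by (simp add: simplicial_object_in_def)
  have hom: "act X m n \<alpha> \<in> coalg_hom s s (ob X n) (ob X m)" if "\<alpha> \<in> Delta_plus m n" for m n \<alpha>
    using simplicial Delta_plus_Delta[OF that] by (simp add: simplicial_object_in_def)
  interpret conil: conil_coalg s "ob X n" for n
    by (rule pointed_formal_manifold_conil[OF mfd])
  have mor: "coalg_morphism s (ob X n) (ob X m) (act X m n \<alpha>)" if "\<alpha> \<in> Delta_plus m n" for m n \<alpha>
    by unfold_locales (rule hom[OF that])
  interpret S: almost_simplicial_space s "\<lambda>n. cspace (ob X n)" "\<lambda>n. prim s (ob X n)" "act X" "\<lambda>n. coaug (ob X n)"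
  proof unfold_locales
    fix l m n \<alpha> \<beta> x assume "\<beta> \<in> Delta_plus l m" "\<alpha> \<in> Delta_plus m n" "x \<in> cspace (ob X n)"
    then show "act X l n (compose {..l} \<alpha> \<beta>) x = act X l m \<beta> (act X m n \<alpha> x)"
      using simplicial by (simp add: simplicial_object_in_def Delta_plus_Delta)
  next
    fix n x assume "x \<in> cspace (ob X n)"
    then show "act X n n (\<lambda>i\<in>{..n}. i) x = x" using simplicial by (simp add: simplicial_object_in_def)
  qed (use conil.subC conil.prim_subspace conil.prim_C conil.u_not_prim
      coalg_morphism.f_lin[OF mor] coalg_morphism.f_C[OF mor] coalg_morphism.f_prim[OF mor]
      coalg_morphism.f_u[OF mor] in blast)+
  have "\<exists>B \<beta>. finite_basis s (prim s (ob X n)) B \<beta>" for n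
  proof -
    obtain G where "finite G" "Modules.module.span s G = prim s (ob X n)"
      using mfd[of n] by (auto simp: pointed_formal_manifold_def CoCom_conil_ft_def)
    from finite_basis_ex[OF assms(1) this] show ?thesis by metis
  qed
  \<comment> \<open>The bases are chosen degree by degree: the formula for \<open>Phi\<close>
    involves the retraction alone, so naturality does not depend on them.\<close>
  then obtain B \<beta> where basis: "\<And>n. finite_basis s (prim s (ob X n)) (B n) (\<beta> n)" by metis
  interpret basis: finite_basis s "prim s (ob X n)" "B n" "\<beta> n" for n by (rule basis)
  interpret smooth_coalg s "ob X n" "B n" "\<beta> n" "S.retraction n" for n
    by unfold_locales
      (use mfd[of n] in \<open>simp_all add: S.retraction_lin S.retraction_V S.retraction_id S.retraction_e
        pointed_formal_manifold_def formal_submersion_def\<close>)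
  have "Phi m (act X m n \<alpha> x) = Sym_co_map (prim s (ob X n)) s (prim s (ob X m)) (act X m n \<alpha>) (Phi n x)"
    if \<alpha>: "\<alpha> \<in> Delta_plus m n" and x: "x \<in> cspace (ob X n)" for m n \<alpha> x
  proof
    interpret f: coalg_morphism s "ob X n" "ob X m" "act X m n \<alpha>" by (rule mor[OF \<alpha>])
    fix \<phi>s
    let ?D = "\<lambda>n. dual s (prim s (ob X n))"
    show "Phi m (act X m n \<alpha> x) \<phi>s = Sym_co_map (prim s (ob X n)) s (prim s (ob X m)) (act X m n \<alpha>) (Phi n x) \<phi>s"
    proof (cases "set \<phi>s \<subseteq> ?D m")
      case True
      have pb: "pullback (prim s (ob X n)) (act X m n \<alpha>) \<phi> \<in> ?D n" if "\<phi> \<in> ?D m" for \<phi>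
        using f.f_prim f.f_lin that conil.prim_C
        by (intro pullback_in_dual[OF assms(1) conil.prim_subspace]) (auto simp: linear_on_def)
      \<comment> \<open>The transpose of \<open>retraction_natural\<close>. As pullback along the
        structure map is multiplicative, compatibility of \<open>Phi\<close> reduces to this
        identity on coordinates.\<close>
      have Rs: "pullback (cspace (ob X n)) (act X m n \<alpha>) (Rs m \<phi>) = Rs n (pullback (prim s (ob X n)) (act X m n \<alpha>) \<phi>)"
        for \<phi>
        using S.retraction_natural[OF \<alpha>] f.f_C S.retraction_V[of _ n]
        by (auto simp: Rs_def pullback_def zero_ext_def fun_eq_iff)
      have "Phi m (act X m n \<alpha> x) \<phi>s = pullback (cspace (ob X n)) (act X m n \<alpha>) (conil.lprod m (map (Rs m) \<phi>s)) x"
        using True x by (simp add: Phi_apply pullback_def zero_ext_def)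
      also have "\<dots> = conil.lprod n (map (Rs n) (map (pullback (prim s (ob X n)) (act X m n \<alpha>)) \<phi>s)) x"
        using map_Rs(2)[OF True] by (subst f.pullback_lprod) (simp_all add: Rs comp_def)
      also have "\<dots> = Phi n x (map (pullback (prim s (ob X n)) (act X m n \<alpha>)) \<phi>s)"
        using True pb by (subst Phi_apply) auto
      finally show ?thesis using True by (simp add: Sym_co_map_def zero_ext_def)
    next
      case False
      then show ?thesis by (simp add: Phi_outside Sym_co_map_def zero_ext_def)
    qed
  qed
  then have "almost_simplicial_coalg_iso s fscale (U_plus X) (Sym_co_plus s (U_plus (Prim s X))) Phi"
    using Phi_iso by (simp add: almost_simplicial_coalg_iso_def U_plus_def Sym_co_plus_def Prim_def)
  then show ?thesis by (rule exI[where x = Phi])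
qed

end
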